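(* Let $\mathcal{M}_2$ be the family of origin-symmetric convex bodies in $\mathbb{R}^2$, and for $M\in\mathcal{M}_2$ and points $p,q$ with $\|p-q\|_M=1$ let $L_M(p,q)=\frac12\operatorname{perim}_M\big((p+M)\cap(q+M)\big)$. With the quantities $\operatorname{MinMin}(L)$, $\operatorname{MinMax}(L)$, $\operatorname{MaxMin}(L)$, $\operatorname{MaxMax}(L)$ defined in the context, we have: (i) $\operatorname{MinMin}(L)=2$, with equality (i.e. $\min\{L_M(p,q):\|q-p\|_M=1\}=2$) for example if $M$ is a parallelogram or an affinely regular hexagon; (ii) $\operatorname{MinMax}(L)=2$, with equality (i.e. $\max\{L_M(p,q):\|q-p\|_M=1\}=2$) for example if $M$ is an affinely regular hexagon; (iii) $\frac{2\pi}{3}\le\operatorname{MaxMin}(L)\le\frac83$; (iv) $\operatorname{MaxMax}(L)=3$, with equality (i.e. $\max\{L_M(p,q):\|q-p\|_M=1\}=3$) for example if $M$ is a parallelogram.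
   Context: A convex body is a compact convex set with nonempty interior. For $M\in\mathcal{M}_2$, $\mathbb{M}$ denotes the normed plane with closed unit disk $M$ and $\|\cdot\|_M$ its norm. The arclength of a curve in $\mathbb{M}$ is the supremum of the total $\|\cdot\|_M$-lengths of inscribed polygonal curves; for a convex disk $K$ (compact planar convex set with nonempty interior), $\operatorname{perim}_M(K)$ is the arclength in $\|\cdot\|_M$ of the boundary curve of $K$. An affinely regular hexagon is an affine image of a regular hexagon. The extremal quantities are $$\operatorname{MinMin}(L)=\min\{\min\{L_M(p,q):p,q\in\mathbb{M},\|q-p\|_M=1\}:M\in\mathcal{M}_2\},$$ $$\operatorname{MinMax}(L)=\min\{\max\{L_M(p,q):p,q\in\mathbb{M},\|q-p\|_M=1\}:M\in\mathcal{M}_2\},$$ $$\operatorname{MaxMin}(L)=\max\{\min\{L_M(p,q):p,q\in\mathbb{M},\|q-p\|_M=1\}:M\in\mathcal{M}_2\},$$ $$\operatorname{MaxMax}(L)=\max\{\max\{L_M(p,q):p,q\in\mathbb{M},\|q-p\|_M=1\}:M\in\mathcal{M}_2\}.$$ *)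

theory Defs
  imports "HOL-Analysis.Analysis"
begin

definition M2 :: "(real^2) set set" where
  "M2 = {M. compact M \<and> convex M \<and> interior M \<noteq> {} \<and> uminus ` M = M}"

(* The norm with closed unit disk M, as the Minkowski functional of M. *)
definition mnorm :: "(real^2) set \<Rightarrow> real^2 \<Rightarrow> real" where
  "mnorm M x = Inf {t. 0 \<le> t \<and> x \<in> (\<lambda>y. t *\<^sub>R y) ` M}"

(* Supremum of the lengths of inscribed polygonal curves.  The value is extended real, so that
   nothing is assumed about rectifiability; the lengths occurring below are in fact finite. *)
definition arclength :: "(real^2) set \<Rightarrow> (real \<Rightarrow> real^2) \<Rightarrow> ereal" where
  "arclength M g =
     Sup {ereal (\<Sum>i<n. mnorm M (g (t (Suc i)) - g (t i))) | (n::nat) (t::nat \<Rightarrow> real).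
            t 0 = 0 \<and> t n = 1 \<and> (\<forall>i<n. t i \<le> t (Suc i))}"

definition boundary_curve :: "(real^2) set \<Rightarrow> (real \<Rightarrow> real^2) \<Rightarrow> bool" where
  "boundary_curve K g \<longleftrightarrow>
     simple_path g \<and> pathfinish g = pathstart g \<and> path_image g = frontier K"

(* The boundary of a convex disk K is a simple closed curve, and its arclength does not depend
   on the chosen parametrization as a simple closed path. *)
definition perim :: "(real^2) set \<Rightarrow> (real^2) set \<Rightarrow> ereal" where
  "perim M K = arclength M (SOME g. boundary_curve K g)"

definition L :: "(real^2) set \<Rightarrow> real^2 \<Rightarrow> real^2 \<Rightarrow> ereal" where
  "L M p q = perim M ((\<lambda>x. p + x) ` M \<inter> (\<lambda>x. q + x) ` M) / 2"

definition L_values :: "(real^2) set \<Rightarrow> ereal set" where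
  "L_values M = {L M p q | p q. mnorm M (q - p) = 1}"

(* Minima and maxima are relations, so that every use asserts that the extremum is attained. *)
definition is_min :: "ereal set \<Rightarrow> ereal \<Rightarrow> bool" where
  "is_min S m \<longleftrightarrow> m \<in> S \<and> (\<forall>x\<in>S. m \<le> x)"

definition is_max :: "ereal set \<Rightarrow> ereal \<Rightarrow> bool" where
  "is_max S m \<longleftrightarrow> m \<in> S \<and> (\<forall>x\<in>S. x \<le> m)"

definition is_MinMin :: "ereal \<Rightarrow> bool" where
  "is_MinMin c \<longleftrightarrow> is_min {m. \<exists>M\<in>M2. is_min (L_values M) m} c"

definition is_MinMax :: "ereal \<Rightarrow> bool" where
  "is_MinMax c \<longleftrightarrow> is_min {m. \<exists>M\<in>M2. is_max (L_values M) m} c"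

definition is_MaxMin :: "ereal \<Rightarrow> bool" where
  "is_MaxMin c \<longleftrightarrow> is_max {m. \<exists>M\<in>M2. is_min (L_values M) m} c"

definition is_MaxMax :: "ereal \<Rightarrow> bool" where
  "is_MaxMax c \<longleftrightarrow> is_max {m. \<exists>M\<in>M2. is_max (L_values M) m} c"

definition parallelogram :: "(real^2) set \<Rightarrow> bool" where
  "parallelogram P \<longleftrightarrow>
     (\<exists>a u v. u \<noteq> v \<and> independent {u, v} \<and> P = convex hull {a, a + u, a + u + v, a + v})"

definition regular_hexagon :: "(real^2) set \<Rightarrow> bool" where
  "regular_hexagon H \<longleftrightarrow>
     (\<exists>c r \<theta>. r > 0 \<and>
        H = convex hull
              {c + r *\<^sub>R vector [cos (\<theta> + real k * pi / 3), sin (\<theta> + real k * pi / 3)] | k. k < (6::nat)})"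

definition affinely_regular_hexagon :: "(real^2) set \<Rightarrow> bool" where
  "affinely_regular_hexagon P \<longleftrightarrow>
     (\<exists>H a f. regular_hexagon H \<and> linear f \<and> bij f \<and> P = (\<lambda>x. a + f x) ` H)"

end

theory Submission
  imports Defs "HOL-Complex_Analysis.Complex_Analysis"
begin

text \<open>In the plane, every norm is a limit of zonotopal norms \<open>N(x) = \<Sum>\<^sub>j \<bar>\<phi>\<^sub>j \<bullet> x\<bar>\<close>: take half the differences of
  functionals norming equidistant directions. A level line of a linear functional meets the boundary of a
  convex body \<open>K\<close> at most twice, so the \<open>N\<close>-length of the boundary is twice the sum of the widths of \<open>K\<close> in
  the directions \<open>\<phi>\<^sub>j\<close>. Hence perimeters do not depend on the parametrization, and they inherit from widths
  monotonicity, homogeneity and additivity inequalities that can be checked on support functions.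

  Write \<open>C u\<close> for the lens moved to be centred at 0, i.e. \<open>C u = {a. a \<plusminus> u/2 \<in> M}\<close>, for a unit vector \<open>u\<close>, and
  choose \<open>x\<close> such that \<open>u\<close>, \<open>x\<close>, \<open>x - u\<close> are unit vectors. The parallelogram with vertices \<open>\<plusminus>u/2\<close> and
  \<open>\<plusminus>(x - u/2)\<close> is contained in \<open>C u\<close> and has perimeter 4, which gives \<open>L \<ge> 2\<close>. The support functions satisfy
  \<open>h (C u) + \<bar>v \<bullet> u\<bar>/2 \<le> h M\<close> in each direction \<open>v\<close>, and \<open>M\<close> has perimeter at most 8, because an inscribed
  parallelogram of maximal area lies in a circumscribed one with unit half-sides; this gives \<open>L \<le> 3\<close>. Finally
  \<open>h (C u) + h (C x) + h (C (x - u)) \<le> 2 h M\<close>, so one of these three lenses has perimeter at most \<open>16/3\<close>.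

  The perimeter of \<open>C u\<close> is stable under small changes of \<open>u\<close> and of \<open>M\<close>, since \<open>C u\<close> changes at most by a
  factor close to 1. The maximum of the minima is therefore attained: unit balls normalized by a linear map
  have uniformly Lipschitz norms, and the Arzela-Ascoli theorem applies.\<close>

section \<open>The norm of a symmetric convex body\<close>

text \<open>The perimeter is defined through an arbitrarily chosen parametrization of the boundary,
  so perimeters of different bodies cannot be compared directly; widths, being attached to the sets
  themselves, can. Finitely many functionals replace the measure in Crofton's formula. This is a
  planar device: centrally symmetric polygons are zonogons, whereas general norms in higher
  dimension are not limits of zonotopal ones. The bound 3 is (8 - 2)/2, where the 2 is the perimeter
  of the segment from -u/2 to u/2 by which the lens falls short of \<open>M\<close>. The lower bound
  2\<pi>/3 is witnessed by the Euclidean disk, whose lens is bounded by two arcs of angle 2\<pi>/3.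
  In a hexagonal norm all lenses have the same perimeter 4, so one hexagon settles both MinMin and
  MinMax; a square settles MaxMax. MaxMin is the only quantity that is enclosed rather than
  evaluated. No example can prove that it is attained, and this is what forces the compactness
  argument.\<close>

lemma M2D:
  assumes "M \<in> M2"
  shows "compact M" "closed M" "bounded M" "convex M" "interior M \<noteq> {}"
    and M2_uminus: "\<And>x. - x \<in> M \<longleftrightarrow> x \<in> M"
proof -
  show "compact M" "convex M" "interior M \<noteq> {}" and "closed M" "bounded M"
    using assms by (auto simp: M2_def compact_imp_closed compact_imp_bounded)
  have "uminus ` M = M"
    using assms by (simp add: M2_def)
  then show "\<And>x. - x \<in> M \<longleftrightarrow> x \<in> M"
    by (metis add.inverse_inverse image_eqI)
qed

lemma M2_zero_interior:
  assumes "M \<in> M2"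
  shows "0 \<in> interior M"
proof -
  note M = M2D[OF assms]
  obtain p where p: "p \<in> interior M"
    using M(5) by auto
  then have "- p \<in> M"
    using M2_uminus[OF assms, of p] interior_subset by blast
  then have "(- p) - (1/2) *\<^sub>R (- p - p) \<in> interior M"
    using mem_interior_convex_shrink[OF M(4) p, of "- p" "1/2"] by simp
  moreover have "(- p) - (1/2) *\<^sub>R (- p - p) = 0"
    by (simp add: vec_eq_iff)
  ultimately show ?thesis
    by simp
qed

lemma M2_zero: "M \<in> M2 \<Longrightarrow> 0 \<in> M"
  using M2_zero_interior interior_subset by blast

lemma M2_scale:
  assumes "M \<in> M2" "x \<in> M" "\<bar>c\<bar> \<le> 1"
  shows "c *\<^sub>R x \<in> M"
proof -
  have *: "d *\<^sub>R x \<in> M" if "0 \<le> d" "d \<le> 1" for d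
    using convexD_alt[OF M2D(4)[OF assms(1)] M2_zero[OF assms(1)] assms(2)] that by simp
  show ?thesis
  proof (cases "c \<ge> 0")
    case False
    then have "- (c *\<^sub>R x) \<in> M"
      using *[of "- c"] assms(3) by simp
    then show ?thesis
      by (simp add: M2_uminus[OF assms(1)])
  qed (use * assms(3) in auto)
qed

text \<open>The infimum is attained because \<open>M\<close> is closed, and admissible factors stay
  admissible when enlarged because \<open>M\<close> is star-shaped about 0. Positivity of
  \<open>t\<close> matters: with \<open>inverse 0 = 0\<close>, the right-hand side for
  \<open>t = 0\<close> would merely say \<open>0 \<in> M\<close>.\<close>

lemma mnorm_le_iff:
  assumes M: "M \<in> M2" and t: "t > 0"
  shows "mnorm M x \<le> t \<longleftrightarrow> x /\<^sub>R t \<in> M"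
proof -
  let ?S = "{t. 0 \<le> t \<and> x \<in> (\<lambda>y. t *\<^sub>R y) ` M}"
  have bdd: "bdd_below ?S"
    by (rule bdd_belowI[of _ 0]) auto
  have mem: "s \<in> ?S" if "s > 0" "x /\<^sub>R s \<in> M" for s
    using that by (auto intro!: image_eqI[where x="x /\<^sub>R s"])
  obtain r where r: "r > 0" "ball 0 r \<subseteq> M"
    using M2_zero_interior[OF M] by (meson mem_interior)
  have ne: "?S \<noteq> {}"
  proof -
    define s where "s = (norm x + 1) / (r/2)"
    have s: "s > 0"
      using r by (auto simp: s_def add_nonneg_pos)
    have "norm (x /\<^sub>R s) = norm x * (r/2) / (norm x + 1)"
      using s r by (simp add: s_def divide_simps)
    also have "\<dots> \<le> r/2"
      using r by (simp add: divide_simps add_nonneg_pos)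
    also have "\<dots> < r"
      using r by simp
    finally have "x /\<^sub>R s \<in> M"
      using r(2) by (auto simp: subset_iff)
    then show ?thesis
      using mem[OF s] by blast
  qed
  show ?thesis
  proof
    assume "x /\<^sub>R t \<in> M"
    then show "mnorm M x \<le> t"
      unfolding mnorm_def by (intro cInf_lower bdd mem t)
  next
    assume le: "mnorm M x \<le> t"
    have *: "x /\<^sub>R s \<in> M" if s: "s > t" for s
    proof -
      obtain t' where t': "0 \<le> t'" "t' < s" "x \<in> (\<lambda>y. t' *\<^sub>R y) ` M"
        using cInf_lessD[OF ne, of s] le s by (auto simp: mnorm_def)
      then obtain y where y: "y \<in> M" "x = t' *\<^sub>R y"
        by auto
      have "x /\<^sub>R s = (t' / s) *\<^sub>R y"
        using y by (simp add: field_simps)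
      then show ?thesis
        using M2_scale[OF M y(1), of "t'/s"] t' by simp
    qed
    have "(\<lambda>n. x /\<^sub>R (t + 1 / real (Suc n))) \<longlonglongrightarrow> x /\<^sub>R (t + 0)"
      by (intro tendsto_intros LIMSEQ_inverse_real_of_nat[unfolded inverse_eq_divide]) (use t in auto)
    moreover have "\<And>n. x /\<^sub>R (t + 1 / real (Suc n)) \<in> M"
      by (intro *) simp
    ultimately show "x /\<^sub>R t \<in> M"
      using closed_sequentially[OF M2D(2)[OF M]] by force
  qed
qed

text \<open>An infimum of nonnegative numbers; the point is that the set is nonempty, since
  \<open>Inf {}\<close> carries no information. The \<open>+ 1\<close> in \<open>s\<close> keeps it
  positive for \<open>x = 0\<close>.\<close>

lemma mnorm_nonneg: "M \<in> M2 \<Longrightarrow> 0 \<le> mnorm M x"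
proof (rule ccontr)
  assume M: "M \<in> M2" and "\<not> 0 \<le> mnorm M x"
  then have neg: "mnorm M x < 0" by simp
  let ?S = "{t. 0 \<le> t \<and> x \<in> (\<lambda>y. t *\<^sub>R y) ` M}"
  have "?S \<noteq> {}"
  proof -
    obtain r where r: "r > 0" "ball 0 r \<subseteq> M"
      using M2_zero_interior[OF M] by (meson mem_interior)
    define s where "s = (norm x + 1) / r"
    have s: "s > 0"
      using r by (auto simp: s_def add_nonneg_pos)
    have "norm (x /\<^sub>R s) = r * (norm x / (norm x + 1))"
      using s r by (simp add: s_def divide_simps)
    also have "\<dots> < r * 1"
      by (intro mult_strict_left_mono r) (simp add: divide_simps add_nonneg_pos)
    finally have "x /\<^sub>R s \<in> M"
      using r(2) by (auto simp: subset_iff)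
    then have "s \<in> ?S"
      using s by (auto intro!: image_eqI[where x="x /\<^sub>R s"])
    then show ?thesis by blast
  qed
  then have "0 \<le> mnorm M x"
    unfolding mnorm_def by (intro cInf_greatest) auto
  with neg show False by simp
qed

lemma mnorm_scale:
  assumes M: "M \<in> M2"
  shows "mnorm M (c *\<^sub>R x) = \<bar>c\<bar> * mnorm M x"
proof -
  have neg: "mnorm M (- x) = mnorm M x" for x
  proof (rule antisym)
    show "mnorm M (- x) \<le> mnorm M x" for x
    proof (rule field_le_epsilon)
      fix e :: real assume "e > 0"
      then have "mnorm M x + e > 0"
        using mnorm_nonneg[OF M, of x] by linarith
      then show "mnorm M (- x) \<le> mnorm M x + e"
        using mnorm_le_iff[OF M, of "mnorm M x + e" x] \<open>e > 0\<close>
        by (simp add: mnorm_le_iff[OF M] M2_uminus[OF M])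
    qed
    from this[of "- x"] show "mnorm M x \<le> mnorm M (- x)" by simp
  qed
  have le: "mnorm M (c *\<^sub>R x) \<le> c * mnorm M x" if c: "c > 0" for c x
  proof (rule field_le_epsilon)
    fix e :: real assume e: "e > 0"
    then have *: "mnorm M x + e / c > 0"
      using mnorm_nonneg[OF M, of x] c by (simp add: add_nonneg_pos)
    have eq: "c * mnorm M x + e = c * (mnorm M x + e / c)"
      using c by (simp add: field_simps)
    have "x /\<^sub>R (mnorm M x + e / c) \<in> M"
      using mnorm_le_iff[OF M *, of x] e c by simp
    moreover have "(c *\<^sub>R x) /\<^sub>R (c * s) = x /\<^sub>R s" for s
      using c by simp
    ultimately have "mnorm M (c *\<^sub>R x) \<le> c * (mnorm M x + e / c)"
      using mnorm_le_iff[OF M, of "c * (mnorm M x + e / c)" "c *\<^sub>R x"] mult_pos_pos[OF c *] by metis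
    then show "mnorm M (c *\<^sub>R x) \<le> c * mnorm M x + e" by (simp only: eq)
  qed
  have pos: "mnorm M (c *\<^sub>R x) = c * mnorm M x" if c: "c > 0" for c
    using le[OF c, of x] le[of "1/c" "c *\<^sub>R x"] c by (simp add: field_simps)
  have zero: "mnorm M 0 = 0"
  proof -
    have "mnorm M 0 \<le> e" if "e > 0" for e
      using that mnorm_le_iff[OF M, of e 0] M2_zero[OF M] by simp
    then show ?thesis
      using mnorm_nonneg[OF M, of 0] by (metis field_le_epsilon add_0 antisym)
  qed
  consider "c > 0" | "c = 0" | "c < 0" by linarith
  then show ?thesis
  proof cases
    case 1 then show ?thesis using pos by simp
  next
    case 2 then show ?thesis using zero by simp
  next
    case 3
    have "mnorm M (c *\<^sub>R x) = mnorm M (- ((- c) *\<^sub>R x))" by simp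
    also have "\<dots> = mnorm M ((- c) *\<^sub>R x)" by (rule neg)
    also have "\<dots> = \<bar>c\<bar> * mnorm M x"
      using 3 le[of "- c" x] le[of "1/(- c)" "(- c) *\<^sub>R x"] by (simp add: field_simps)
    finally show ?thesis .
  qed
qed

lemma mnorm_zero: "M \<in> M2 \<Longrightarrow> mnorm M 0 = 0"
  using mnorm_scale[of M 0 0] by simp

lemma mnorm_minus: "M \<in> M2 \<Longrightarrow> mnorm M (- x) = mnorm M x"
  using mnorm_scale[of M "-1" x] by simp

lemma mnorm_le_1_iff: "M \<in> M2 \<Longrightarrow> mnorm M x \<le> 1 \<longleftrightarrow> x \<in> M"
  using mnorm_le_iff[of M 1 x] by simp

text \<open>The slack makes \<open>a\<close> and \<open>b\<close> positive, so that
  \<open>(x + y) /\<^sub>R (a + b)\<close> is a convex combination of the points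
  \<open>x /\<^sub>R a\<close> and \<open>y /\<^sub>R b\<close> of \<open>M\<close>.\<close>

lemma mnorm_triangle:
  assumes M: "M \<in> M2"
  shows "mnorm M (x + y) \<le> mnorm M x + mnorm M y"
proof (rule field_le_epsilon)
  fix e :: real assume e: "e > 0"
  define a b where "a = mnorm M x + e/2" and "b = mnorm M y + e/2"
  have ab: "a > 0" "b > 0"
    using mnorm_nonneg[OF M, of x] mnorm_nonneg[OF M, of y] e by (auto simp: a_def b_def)
  have "x /\<^sub>R a \<in> M" "y /\<^sub>R b \<in> M"
    using mnorm_le_iff[OF M ab(1), of x] mnorm_le_iff[OF M ab(2), of y] e
    by (simp_all add: a_def b_def)
  then have "(a/(a+b)) *\<^sub>R (x /\<^sub>R a) + (b/(a+b)) *\<^sub>R (y /\<^sub>R b) \<in> M"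
    using ab by (intro convexD[OF M2D(4)[OF M]]) (auto simp: divide_simps)
  also have "(a/(a+b)) *\<^sub>R (x /\<^sub>R a) + (b/(a+b)) *\<^sub>R (y /\<^sub>R b) = (x + y) /\<^sub>R (a + b)"
    using ab by (simp add: divide_simps scaleR_add_right)
  finally have "mnorm M (x + y) \<le> a + b"
    using mnorm_le_iff[OF M, of "a + b"] ab by simp
  then show "mnorm M (x + y) \<le> mnorm M x + mnorm M y + e"
    by (simp add: a_def b_def)
qed

lemma mnorm_triangle_diff: "M \<in> M2 \<Longrightarrow> mnorm M (x - y) \<le> mnorm M x + mnorm M y"
  using mnorm_triangle[of M x "- y"] mnorm_minus[of M y] by simp

lemma mnorm_diff_ge: "M \<in> M2 \<Longrightarrow> mnorm M x - mnorm M y \<le> mnorm M (x - y)"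
  using mnorm_triangle[of M "x - y" y] by simp

lemma mnorm_equiv_norm:
  assumes M: "M \<in> M2"
  obtains c C where "0 < c" "0 < C" "\<And>x. c * norm x \<le> mnorm M x" "\<And>x. mnorm M x \<le> C * norm x"
proof -
  obtain r where r: "r > 0" "cball 0 r \<subseteq> M"
    using M2_zero_interior[OF M] by (meson mem_interior_cball)
  obtain B where B: "B > 0" "\<And>x. x \<in> M \<Longrightarrow> norm x \<le> B"
    using M2D(3)[OF M] by (auto simp: bounded_pos)
  show thesis
  proof (rule that[of "1/B" "1/r"])
    show "mnorm M x \<le> 1 / r * norm x" for x
    proof (cases "x = 0")
      case False
      then have "norm (x /\<^sub>R (norm x / r)) = r"
        using r by simp
      then have "x /\<^sub>R (norm x / r) \<in> M"
        using r(2) by (auto simp: subset_iff)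
      then show ?thesis
        using mnorm_le_iff[OF M, of "norm x / r" x] False r by simp
    qed (simp add: mnorm_zero[OF M])
    show "1 / B * norm x \<le> mnorm M x" for x
    proof (rule field_le_epsilon)
      fix e :: real assume e: "e > 0"
      define t where "t = mnorm M x + e"
      have t: "t > 0"
        using mnorm_nonneg[OF M, of x] e by (simp add: t_def)
      then have "norm (x /\<^sub>R t) \<le> B"
        using mnorm_le_iff[OF M t, of x] e by (intro B(2)) (simp add: t_def)
      then have "norm x \<le> B * t"
        using t by (simp add: field_simps)
      then show "1 / B * norm x \<le> mnorm M x + e"
        using B(1) by (simp add: t_def field_simps)
    qed
  qed (use B r in auto)
qed

lemma mnorm_eq_0_iff: "M \<in> M2 \<Longrightarrow> mnorm M x = 0 \<longleftrightarrow> x = 0"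
proof -
  assume M: "M \<in> M2"
  obtain c C where "0 < c" "0 < C" "\<And>x. c * norm x \<le> mnorm M x" "\<And>x. mnorm M x \<le> C * norm x"
    using mnorm_equiv_norm[OF M] by blast
  then show ?thesis
    using mnorm_zero[OF M] by (metis less_eq_real_def mult_pos_pos not_less zero_less_norm_iff)
qed

lemma mnorm_pos: "M \<in> M2 \<Longrightarrow> x \<noteq> 0 \<Longrightarrow> 0 < mnorm M x"
  using mnorm_eq_0_iff[of M x] mnorm_nonneg[of M x] by linarith

lemma mnorm_continuous:
  assumes M: "M \<in> M2"
  shows "continuous_on S (mnorm M)"
proof -
  obtain c C where C: "0 < c" "0 < C" "\<And>x. c * norm x \<le> mnorm M x" "\<And>x. mnorm M x \<le> C * norm x"
    using mnorm_equiv_norm[OF M] by blast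
  have "C-lipschitz_on S (mnorm M)"
  proof (rule lipschitz_onI)
    fix x y
    have "\<bar>mnorm M x - mnorm M y\<bar> \<le> mnorm M (x - y)"
      using mnorm_diff_ge[OF M, of x y] mnorm_diff_ge[OF M, of y x] mnorm_minus[OF M, of "x - y"]
      by simp
    then show "dist (mnorm M x) (mnorm M y) \<le> C * dist x y"
      using C(4)[of "x - y"] by (simp add: dist_norm)
  qed (use C in simp)
  then show ?thesis
    by (rule lipschitz_on_continuous_on)
qed

lemma mnorm_normalize:
  assumes "M \<in> M2" "x \<noteq> 0"
  shows "mnorm M (x /\<^sub>R mnorm M x) = 1"
  using mnorm_pos[OF assms] mnorm_scale[OF assms(1), of "inverse (mnorm M x)" x] by simp

text \<open>Planar Hahn-Banach: a supporting line of \<open>M\<close> at the normalized point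
  \<open>p\<close>, scaled so that the functional takes the value 1 there.\<close>

lemma norming_functional:
  assumes M: "M \<in> M2"
  obtains f where "\<And>x. f \<bullet> x \<le> mnorm M x" "f \<bullet> p = mnorm M p"
proof (cases "p = 0")
  case True
  with that[of 0] show thesis by (simp add: mnorm_zero[OF M] mnorm_nonneg[OF M])
next
  case False
  define y where "y = p /\<^sub>R mnorm M p"
  have p: "mnorm M p > 0" using mnorm_pos[OF M False] .
  have y: "mnorm M y = 1"
    using mnorm_normalize[OF M False] by (simp add: y_def)
  have "y \<notin> interior M"
  proof
    assume "y \<in> interior M"
    then obtain r where r: "r > 0" "cball y r \<subseteq> M"
      by (meson mem_interior_cball)
    have ny: "norm y > 0"
      using y mnorm_zero[OF M] by auto
    define z where "z = y + (r / norm y) *\<^sub>R y"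
    have "z \<in> cball y r"
      using r ny by (simp add: z_def dist_norm)
    then have "mnorm M z \<le> 1"
      using r mnorm_le_1_iff[OF M] by blast
    moreover have "z = (1 + r / norm y) *\<^sub>R y"
      by (simp add: z_def algebra_simps)
    then have "mnorm M z = 1 + r / norm y"
      using mnorm_scale[OF M, of "1 + r / norm y" y] y r ny by simp
    ultimately show False
      using r ny by (simp add: field_simps)
  qed
  then have "y \<notin> rel_interior M"
    using M2D(5)[OF M] by (simp add: rel_interior_nonempty_interior)
  moreover have "y \<in> closure M"
    using y mnorm_le_1_iff[OF M, of y] closure_subset by fastforce
  ultimately obtain a where a: "a \<noteq> 0" "\<And>z. z \<in> closure M \<Longrightarrow> a \<bullet> y \<le> a \<bullet> z"
    "\<And>z. z \<in> rel_interior M \<Longrightarrow> a \<bullet> y < a \<bullet> z"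
    using supporting_hyperplane_relative_frontier[OF M2D(4)[OF M]] by metis
  have neg: "a \<bullet> y < 0"
    using a(3)[of 0] M2_zero_interior[OF M] M2D(5)[OF M] by (simp add: rel_interior_nonempty_interior)
  \<comment> \<open>The functional \<open>a\<close> is minimal at \<open>y\<close> with a negative
    value, so dividing by that value reverses the inequality and makes \<open>f\<close> maximal at
    \<open>y\<close>.\<close>
  define f where "f = a /\<^sub>R (a \<bullet> y)"
  have fM: "f \<bullet> z \<le> 1" if "z \<in> M" for z
    using a(2)[of z] that neg closure_subset[of M] by (auto simp: f_def field_simps)
  show thesis
  proof (rule that[of f])
    show "f \<bullet> x \<le> mnorm M x" for x
    proof (cases "x = 0")
      case False
      then have "x /\<^sub>R mnorm M x \<in> M"
        using mnorm_normalize[OF M False] mnorm_le_1_iff[OF M, of "x /\<^sub>R mnorm M x"] by simp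
      then show ?thesis
        using fM[of "x /\<^sub>R mnorm M x"] mnorm_pos[OF M False] by (simp add: field_simps)
    qed (simp add: mnorm_nonneg[OF M])
    have "f \<bullet> y = 1"
      using neg by (simp add: f_def)
    then show "f \<bullet> p = mnorm M p"
      using p by (simp add: y_def field_simps)
  qed
qed

section \<open>Zonotopal norms\<close>

definition edir :: "real \<Rightarrow> real^2" where
  "edir t = vector [cos t, sin t]"

lemma edir_nth [simp]: "edir t $ 1 = cos t" "edir t $ 2 = sin t"
  by (simp_all add: edir_def)

lemma vec2_eq_iff: "(x::real^2) = y \<longleftrightarrow> x $ 1 = y $ 1 \<and> x $ 2 = y $ 2"
  by (simp add: vec_eq_iff forall_2)

lemma inner_vec2: "(x::real^2) \<bullet> y = x $ 1 * y $ 1 + x $ 2 * y $ 2"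
  by (simp add: inner_vec_def sum_2)

lemma edir_inner: "edir s \<bullet> edir t = cos (s - t)"
  by (simp add: inner_vec2 cos_diff)

lemma norm_edir [simp]: "norm (edir t) = 1"
  by (simp add: norm_eq_sqrt_inner edir_inner)

lemma edir_nonzero [simp]: "edir t \<noteq> 0"
  using norm_edir[of t] by (metis norm_zero zero_neq_one)

lemma edir_plus_pi [simp]: "edir (t + pi) = - edir t"
  by (simp add: vec2_eq_iff)

text \<open>Cramer's rule, the determinant of two unit vectors being the sine of the angle between
  them. It is multiplied out so that no angle has to be excluded.\<close>

lemma edir_combination:
  "sin (b - a) *\<^sub>R edir t = sin (t - a) *\<^sub>R edir b - sin (t - b) *\<^sub>R edir a"
proof -
  have "sin (b - a) * cos t = sin (t - a) * cos b - sin (t - b) * cos a"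
    "sin (b - a) * sin t = sin (t - a) * sin b - sin (t - b) * sin a"
    by (simp_all add: sin_diff algebra_simps)
  then show ?thesis
    by (simp add: vec2_eq_iff)
qed

lemma norm_edir_diff: "norm (edir s - edir t) \<le> 2 * \<bar>s - t\<bar>"
proof -
  have "norm (edir s - edir t) \<le> \<bar>cos s - cos t\<bar> + \<bar>sin s - sin t\<bar>"
    using norm_le_l1_cart[of "edir s - edir t"] by (simp add: sum_2)
  moreover have "\<bar>cos s - cos t\<bar> \<le> \<bar>s - t\<bar>" "\<bar>sin s - sin t\<bar> \<le> \<bar>s - t\<bar>"
  proof -
    have "\<bar>cos x - cos y\<bar> \<le> \<bar>x - y\<bar>" "\<bar>sin x - sin y\<bar> \<le> \<bar>x - y\<bar>" for x y :: real
    proof -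
      have "norm (cos x - cos y) \<le> 1 * norm (x - y)"
        by (rule field_differentiable_bound[where S=UNIV and f'="\<lambda>x. - sin x"])
           (auto intro!: derivative_eq_intros)
      then show "\<bar>cos x - cos y\<bar> \<le> \<bar>x - y\<bar>" by simp
      have "norm (sin x - sin y) \<le> 1 * norm (x - y)"
        by (rule field_differentiable_bound[where S=UNIV and f'="cos"])
           (auto intro!: derivative_eq_intros)
      then show "\<bar>sin x - sin y\<bar> \<le> \<bar>x - y\<bar>" by simp
    qed
    then show "\<bar>cos s - cos t\<bar> \<le> \<bar>s - t\<bar>" "\<bar>sin s - sin t\<bar> \<le> \<bar>s - t\<bar>" by auto
  qed
  ultimately have "norm (edir s - edir t) \<le> \<bar>s - t\<bar> + \<bar>s - t\<bar>"
    by (meson add_mono order_trans)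
  then show ?thesis by simp
qed

text \<open>Since \<open>r\<close> may be negative, a half turn from any starting angle reaches
  every vector. This suits even functions such as norms.\<close>

lemma polar_half:
  fixes x :: "real^2"
  obtains r t where "a \<le> t" "t \<le> a + pi" "x = r *\<^sub>R edir t"
proof (cases "x = 0")
  case True
  then show thesis using that[of a 0] by simp
next
  case False
  define y where "y = x /\<^sub>R norm x"
  have "norm y = 1" using False by (simp add: y_def)
  then have "(y $ 1)\<^sup>2 + (y $ 2)\<^sup>2 = 1"
    by (simp add: norm_eq_1 inner_vec2 power2_eq_square)
  then obtain s where s: "y = edir s"
    using sincos_total_2pi_le[of "y $ 1" "y $ 2"] by (auto simp: vec2_eq_iff)
  define k where "k = \<lfloor>(s - a) / pi\<rfloor>"
  define t where "t = s - of_int k * pi"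
  have "of_int k \<le> (s - a) / pi" "(s - a) / pi < of_int k + 1"
    unfolding k_def by linarith+
  then have t: "a \<le> t" "t \<le> a + pi"
    by (auto simp: t_def field_simps)
  have "\<exists>c::real. edir s = c *\<^sub>R edir t"
  proof -
    have "s = t + of_int k * pi"
      by (simp add: t_def)
    then have "edir s = cos (of_int k * pi) *\<^sub>R edir t"
      using sin_npi_int[of k] by (simp add: vec2_eq_iff cos_add sin_add mult.commute)
    then show ?thesis by blast
  qed
  then obtain c where "edir s = c *\<^sub>R edir t" by blast
  then have "y = c *\<^sub>R edir t" using s by simp
  moreover have "x = norm x *\<^sub>R y" using False by (simp add: y_def)
  ultimately have "x = (norm x * c) *\<^sub>R edir t" by simp
  then show thesis
    using that t by blast
qed

text \<open>The support function of the zonogon that is the sum of the segments from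
  \<open>- \<phi> j\<close> to \<open>\<phi> j\<close>. It is only a seminorm if the
  \<open>\<phi> j\<close> do not span the plane.\<close>

definition znorm :: "nat \<Rightarrow> (nat \<Rightarrow> real^2) \<Rightarrow> real^2 \<Rightarrow> real" where
  "znorm n \<phi> x = (\<Sum>j<n. \<bar>\<phi> j \<bullet> x\<bar>)"

lemma znorm_scale: "znorm n \<phi> (c *\<^sub>R x) = \<bar>c\<bar> * znorm n \<phi> x"
  by (simp add: znorm_def abs_mult sum_distrib_left)

text \<open>If \<open>f j\<close> norms the direction \<open>a + j\<pi>/n\<close>, the differences of consecutive functionals change
  sign only at the corresponding node, so that the sum of their absolute values telescopes.\<close>

lemma znorm_differences:
  fixes f :: "nat \<Rightarrow> real^2" and N :: "real^2 \<Rightarrow> real"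
  assumes n: "n \<ge> 2"
    and le: "\<And>j x. j \<le> n \<Longrightarrow> f j \<bullet> x \<le> N x"
    and eq: "\<And>j. j \<le> n \<Longrightarrow> f j \<bullet> edir (a + real j * pi / real n) = N (edir (a + real j * pi / real n))"
    and fn: "f n = - f 0"
    and i: "i < n" "a + real i * pi / real n \<le> t" "t \<le> a + real (Suc i) * pi / real n"
  shows "znorm n (\<lambda>j. (f (Suc j) - f j) /\<^sub>R 2) (edir t) = max (f i \<bullet> edir t) (f (Suc i) \<bullet> edir t)"
proof -
  define \<theta> where "\<theta> j = a + real j * pi / real n" for j
  define d where "d j = f (Suc j) - f j" for j
  let ?x = "edir t"
  have mono: "\<theta> j \<le> \<theta> k" if "j \<le> k" for j k
    using that n by (simp add: \<theta>_def divide_right_mono)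
  have step: "\<theta> (Suc j) - \<theta> j = pi / n" for j
    using n by (simp add: \<theta>_def field_simps)
  have sinpos: "sin (\<theta> (Suc j) - \<theta> j) > 0" for j
    unfolding step using n by (intro sin_gt_zero) (auto simp: divide_simps)
  have \<theta>n: "\<theta> n = \<theta> 0 + pi"
    using n by (simp add: \<theta>_def)
  have i': "\<theta> i \<le> t" "t \<le> \<theta> (Suc i)"
    using i by (simp_all add: \<theta>_def)
  \<comment> \<open>Each functional equals \<open>N\<close> at its own node and is at most
    \<open>N\<close> at the neighbouring one.\<close>
  have d1: "d j \<bullet> edir (\<theta> (Suc j)) \<ge> 0" "d j \<bullet> edir (\<theta> j) \<le> 0" if "j < n" for j
    using that le[of j "edir (\<theta> (Suc j))"] eq[of "Suc j"] le[of "Suc j" "edir (\<theta> j)"] eq[of j]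
    by (auto simp: d_def inner_diff_left \<theta>_def)
  have dx: "sin (\<theta> (Suc j) - \<theta> j) * (d j \<bullet> ?x) =
      sin (t - \<theta> j) * (d j \<bullet> edir (\<theta> (Suc j))) - sin (t - \<theta> (Suc j)) * (d j \<bullet> edir (\<theta> j))" for j
    using arg_cong[OF edir_combination[of "\<theta> (Suc j)" "\<theta> j" t], of "\<lambda>y. d j \<bullet> y"]
    by (simp add: inner_diff_right)
  \<comment> \<open>For nodes before the cell of \<open>t\<close>, the angles from the nodes to
    \<open>t\<close> lie between 0 and \<pi>. Both sines in \<open>dx\<close> are then nonnegative
    and meet the signs of \<open>d1\<close>. The nodes after the cell are treated likewise with the
    angles reversed.\<close>
  have pos: "d j \<bullet> ?x \<ge> 0" if "j < i" for j
  proof -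
    have "\<theta> (Suc j) \<le> t" "\<theta> j \<le> t" "t \<le> \<theta> n" "\<theta> 0 \<le> \<theta> j" "\<theta> 0 \<le> \<theta> (Suc j)"
      using mono[of "Suc j" i] mono[of j i] mono[of "Suc i" n] mono[of 0 j] mono[of 0 "Suc j"] i' that i(1)
      by linarith+
    then have "sin (t - \<theta> j) \<ge> 0" "sin (t - \<theta> (Suc j)) \<ge> 0"
      using \<theta>n by (auto intro!: sin_ge_zero)
    then have "sin (\<theta> (Suc j) - \<theta> j) * (d j \<bullet> ?x) \<ge> 0"
      unfolding dx using mult_nonneg_nonneg[of _ "d j \<bullet> edir (\<theta> (Suc j))"] d1[of j] that i(1)
        mult_nonneg_nonpos[of _ "d j \<bullet> edir (\<theta> j)"]
      by (smt (verit) less_trans)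
    then show ?thesis
      using sinpos[of j] by (simp add: zero_le_mult_iff)
  qed
  have neg: "d j \<bullet> ?x \<le> 0" if "i < j" "j < n" for j
  proof -
    have "t \<le> \<theta> (Suc j)" "t \<le> \<theta> j" "\<theta> (Suc j) \<le> \<theta> n" "\<theta> j \<le> \<theta> n" "\<theta> 0 \<le> t"
      using mono[of "Suc i" "Suc j"] mono[of "Suc i" j] mono[of "Suc j" n] mono[of j n] mono[of 0 i] i' that
      by linarith+
    then have "sin (\<theta> j - t) \<ge> 0" "sin (\<theta> (Suc j) - t) \<ge> 0"
      using \<theta>n by (auto intro!: sin_ge_zero)
    then have *: "sin (t - \<theta> j) \<le> 0" "sin (t - \<theta> (Suc j)) \<le> 0"
      using sin_minus[of "\<theta> j - t"] sin_minus[of "\<theta> (Suc j) - t"] by auto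
    have "sin (\<theta> (Suc j) - \<theta> j) * (d j \<bullet> ?x) \<le> 0"
      unfolding dx using mult_nonpos_nonneg[OF *(1) d1(1)[OF that(2)]]
        mult_nonpos_nonpos[OF *(2) d1(2)[OF that(2)]] by linarith
    then show ?thesis
      using sinpos[of j] by (simp add: mult_le_0_iff)
  qed
  have split: "{..<n} = {..<i} \<union> {i} \<union> {Suc i..<n}"
    using i(1) by auto
  have "(\<Sum>j<n. \<bar>d j \<bullet> ?x\<bar>) = (\<Sum>j<i. \<bar>d j \<bullet> ?x\<bar>) + \<bar>d i \<bullet> ?x\<bar> + (\<Sum>j\<in>{Suc i..<n}. \<bar>d j \<bullet> ?x\<bar>)"
    unfolding split by (subst sum.union_disjoint, auto)+
  also have "(\<Sum>j<i. \<bar>d j \<bullet> ?x\<bar>) = (\<Sum>j<i. f (Suc j) \<bullet> ?x - f j \<bullet> ?x)"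
    using pos by (intro sum.cong) (auto simp: d_def inner_diff_left)
  also have "\<dots> = f i \<bullet> ?x - f 0 \<bullet> ?x"
    by (rule sum_lessThan_telescope)
  also have "(\<Sum>j\<in>{Suc i..<n}. \<bar>d j \<bullet> ?x\<bar>) = - (\<Sum>j\<in>{Suc i..<n}. f (Suc j) \<bullet> ?x - f j \<bullet> ?x)"
    unfolding sum_negf[symmetric]
  proof (intro sum.cong refl)
    fix j assume "j \<in> {Suc i..<n}"
    with neg[of j] show "\<bar>d j \<bullet> ?x\<bar> = - (f (Suc j) \<bullet> ?x - f j \<bullet> ?x)"
      by (simp add: d_def inner_diff_left)
  qed
  also have "(\<Sum>j\<in>{Suc i..<n}. f (Suc j) \<bullet> ?x - f j \<bullet> ?x) = f n \<bullet> ?x - f (Suc i) \<bullet> ?x"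
    using i(1) by (intro sum_Suc_diff') auto
  \<comment> \<open>By \<open>f n = - f 0\<close> the outer terms of the two telescoped sums cancel.
    What remains is the sum of the values of \<open>f i\<close> and \<open>f (Suc i)\<close> plus
    the absolute value of their difference, hence twice their maximum.\<close>
  finally have "(\<Sum>j<n. \<bar>d j \<bullet> ?x\<bar>) = 2 * max (f i \<bullet> ?x) (f (Suc i) \<bullet> ?x)"
    by (simp add: fn d_def inner_diff_left max_def abs_if)
  moreover have "znorm n (\<lambda>j. (f (Suc j) - f j) /\<^sub>R 2) ?x = (\<Sum>j<n. \<bar>d j \<bullet> ?x\<bar>) / 2"
    unfolding znorm_def d_def sum_divide_distrib by (intro sum.cong refl) (simp add: abs_mult)
  ultimately show ?thesis by simp
qed

text \<open>The right end of the range is treated apart, because there the floor would give the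
  nonexistent cell \<open>n\<close>.\<close>

lemma node_exists:
  assumes n: "n > (0::nat)" and "a \<le> t" "t \<le> a + pi"
  obtains i where "i < n" "a + real i * pi / real n \<le> t" "t \<le> a + real (Suc i) * pi / real n"
proof (cases "t = a + pi")
  case True
  have "real (n - 1) * pi / real n \<le> pi" using n by (simp add: divide_simps)
  then show thesis using that[of "n - 1"] n True by simp
next
  case False
  define z where "z = (t - a) * n / pi"
  have "(t - a) / pi < 1" using assms False by (simp add: divide_simps)
  then have "(t - a) / pi * n < 1 * real n" using n by (intro mult_strict_right_mono) auto
  then have z: "0 \<le> z" "z < n" using assms by (auto simp: z_def)
  define i where "i = nat \<lfloor>z\<rfloor>"
  have i: "real i \<le> z" "z < real (Suc i)"
  proof -
    have "of_int \<lfloor>z\<rfloor> \<le> z" "z < of_int \<lfloor>z\<rfloor> + 1" by linarith+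
    moreover have "real i = of_int \<lfloor>z\<rfloor>"
      using z(1) by (simp add: i_def)
    ultimately show "real i \<le> z" "z < real (Suc i)"
      by linarith+
  qed
  have "t = a + z * pi / n" using n by (simp add: z_def)
  moreover have "real i * pi / n \<le> z * pi / n" "z * pi / n \<le> real (Suc i) * pi / n"
    using i by (auto intro!: divide_right_mono)
  ultimately show thesis
    using that[of i] i z by auto
qed

lemma znorm_differences_le:
  assumes M: "M \<in> M2" and n: "n \<ge> 2"
    and le: "\<And>j x. j \<le> n \<Longrightarrow> f j \<bullet> x \<le> mnorm M x"
    and eq: "\<And>j. j \<le> n \<Longrightarrow> f j \<bullet> edir (a + real j * pi / real n) = mnorm M (edir (a + real j * pi / real n))"
    and fn: "f n = - f 0"
  shows "znorm n (\<lambda>j. (f (Suc j) - f j) /\<^sub>R 2) x \<le> mnorm M x"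
proof -
  obtain r t where t: "a \<le> t" "t \<le> a + pi" "x = r *\<^sub>R edir t"
    using polar_half by blast
  obtain i where i: "i < n" "a + real i * pi / real n \<le> t" "t \<le> a + real (Suc i) * pi / real n"
    using node_exists[of n a t] n t by auto
  have "znorm n (\<lambda>j. (f (Suc j) - f j) /\<^sub>R 2) (edir t) = max (f i \<bullet> edir t) (f (Suc i) \<bullet> edir t)"
    by (rule znorm_differences[of n f "mnorm M", OF n le eq fn i])
  also have "\<dots> \<le> mnorm M (edir t)"
    using le[of i "edir t"] le[of "Suc i" "edir t"] i(1) by simp
  finally have "znorm n (\<lambda>j. (f (Suc j) - f j) /\<^sub>R 2) (edir t) \<le> mnorm M (edir t)" .
  then show ?thesis
    by (simp add: t znorm_scale mnorm_scale[OF M] mult_left_mono)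
qed

definition zapprox :: "(real^2) set \<Rightarrow> real \<Rightarrow> nat \<Rightarrow> (nat \<Rightarrow> real^2) \<Rightarrow> bool" where
  "zapprox M \<epsilon> n \<phi> \<longleftrightarrow> (\<forall>x. znorm n \<phi> x \<le> mnorm M x \<and> mnorm M x \<le> (1 + \<epsilon>) * znorm n \<phi> x)"

text \<open>In a cell the zonotopal norm is at least the functional that norms the left node.
  Replacing the node by \<open>edir t\<close> costs at most 2C\<pi>/n twice, once in the functional
  and once in the norm. The choice of \<open>m\<close> makes this total cost at most c\<epsilon>/(1
  + \<epsilon>).\<close>

lemma zapprox_exists:
  assumes M: "M \<in> M2" and eps: "\<epsilon> > 0"
  shows "\<exists>n \<phi>. zapprox M \<epsilon> n \<phi>"
proof -
  obtain c C where C: "0 < c" "0 < C" "\<And>x. c * norm x \<le> mnorm M x" "\<And>x. mnorm M x \<le> C * norm x"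
    using mnorm_equiv_norm[OF M] by blast
  obtain m :: nat where m: "real m > 4 * C * pi * (1 + \<epsilon>) / (c * \<epsilon>)"
    using reals_Archimedean2 by blast
  define n where "n = max 2 m"
  have n: "n \<ge> 2" "real n > 4 * C * pi * (1 + \<epsilon>) / (c * \<epsilon>)"
    using m by (auto simp: n_def)
  define \<theta> where "\<theta> j = real j * pi / n" for j
  have "\<exists>f. \<forall>p. (\<forall>x. f p \<bullet> x \<le> mnorm M x) \<and> f p \<bullet> p = mnorm M p"
    by (rule choice, rule allI, rule norming_functional[OF M], blast)
  then obtain F where F: "\<And>p x. F p \<bullet> x \<le> mnorm M x" "\<And>p. F p \<bullet> p = mnorm M p"
    by blast
  \<comment> \<open>The last functional is the negative of the first rather than a new choice for
    the direction \<pi>; otherwise the telescoped sum would not close up.\<close>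
  define f where "f j = (if j = n then - F (edir 0) else F (edir (\<theta> j)))" for j
  have le: "f j \<bullet> x \<le> mnorm M x" for j x
    using F(1)[of "edir 0" "- x"] by (auto simp: f_def F mnorm_minus[OF M])
  have \<theta>n: "\<theta> n = pi"
    using n by (simp add: \<theta>_def)
  have eq: "f j \<bullet> edir (\<theta> j) = mnorm M (edir (\<theta> j))" if "j \<le> n" for j
    using F(2)[of "edir 0"] \<theta>n edir_plus_pi[of 0] by (simp add: f_def F mnorm_minus[OF M])
  have fn: "f n = - f 0"
    using n by (simp add: f_def \<theta>_def)
  let ?\<phi> = "\<lambda>j. (f (Suc j) - f j) /\<^sub>R 2"
  have "znorm n ?\<phi> x \<le> mnorm M x" for x
    using le eq fn n by (intro znorm_differences_le[OF M, where a=0]) (auto simp: \<theta>_def)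
  moreover have "mnorm M x \<le> (1 + \<epsilon>) * znorm n ?\<phi> x" for x
  proof -
    obtain r t where t: "0 \<le> t" "t \<le> 0 + pi" "x = r *\<^sub>R edir t"
      using polar_half by blast
    obtain i where i: "i < n" "0 + real i * pi / real n \<le> t" "t \<le> 0 + real (Suc i) * pi / real n"
      using node_exists[of n 0 t] n t by auto
    have "znorm n ?\<phi> (edir t) = max (f i \<bullet> edir t) (f (Suc i) \<bullet> edir t)"
      using le eq fn n i by (intro znorm_differences[where a=0 and N="mnorm M"]) (auto simp: \<theta>_def)
    then have z: "znorm n ?\<phi> (edir t) \<ge> f i \<bullet> edir t" by simp
    have "real (Suc i) * pi / n = real i * pi / n + pi / n"
      by (simp add: algebra_simps add_divide_distrib)
    then have "\<bar>t - \<theta> i\<bar> \<le> pi / n"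
      using i by (simp add: \<theta>_def)
    then have "2 * \<bar>t - \<theta> i\<bar> \<le> 2 * (pi / n)" by simp
    then have d: "norm (edir t - edir (\<theta> i)) \<le> 2 * (pi / n)"
      using norm_edir_diff[of t "\<theta> i"] by linarith
    have dM: "mnorm M (edir t - edir (\<theta> i)) \<le> C * (2 * (pi / n))"
      using C(4)[of "edir t - edir (\<theta> i)"] mult_left_mono[OF d, of C] C by linarith
    have "f i \<bullet> edir t = mnorm M (edir (\<theta> i)) + f i \<bullet> (edir t - edir (\<theta> i))"
      using eq[of i] i by (simp add: inner_diff_right)
    moreover have "f i \<bullet> (edir t - edir (\<theta> i)) \<ge> - (C * (2 * (pi / n)))"
      using le[of i "- (edir t - edir (\<theta> i))"] dM mnorm_minus[OF M, of "edir t - edir (\<theta> i)"]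
      unfolding inner_minus_right by linarith
    moreover have "mnorm M (edir (\<theta> i)) \<ge> mnorm M (edir t) - C * (2 * (pi / n))"
      using mnorm_diff_ge[OF M, of "edir t" "edir (\<theta> i)"] dM by linarith
    ultimately have "znorm n ?\<phi> (edir t) \<ge> mnorm M (edir t) - 4 * C * pi / n"
      using z by simp
    moreover have "4 * C * pi / n \<le> c * \<epsilon> / (1 + \<epsilon>)"
      using n C eps by (simp add: field_simps)
    moreover have "c * \<epsilon> / (1 + \<epsilon>) \<le> mnorm M (edir t) * \<epsilon> / (1 + \<epsilon>)"
      using C(3)[of "edir t"] eps by (intro divide_right_mono mult_right_mono) auto
    ultimately have "znorm n ?\<phi> (edir t) \<ge> mnorm M (edir t) - mnorm M (edir t) * \<epsilon> / (1 + \<epsilon>)"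
      by linarith
    also have "mnorm M (edir t) - mnorm M (edir t) * \<epsilon> / (1 + \<epsilon>) = mnorm M (edir t) / (1 + \<epsilon>)"
      using eps by (simp add: field_simps)
    finally have "mnorm M (edir t) \<le> (1 + \<epsilon>) * znorm n ?\<phi> (edir t)"
      using eps by (simp add: field_simps)
    from mult_left_mono[OF this, of "\<bar>r\<bar>"] show ?thesis
      by (simp add: t znorm_scale mnorm_scale[OF M] mult_ac)
  qed
  ultimately show ?thesis
    unfolding zapprox_def by blast
qed

section \<open>Widths and the variation along the boundary\<close>

definition convex_body :: "(real^2) set \<Rightarrow> bool" where
  "convex_body K \<longleftrightarrow> compact K \<and> convex K \<and> interior K \<noteq> {}"

lemma convex_bodyD:
  assumes "convex_body K"
  shows "compact K" "closed K" "bounded K" "convex K" "interior K \<noteq> {}" "K \<noteq> {}"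
  using assms interior_subset by (auto simp: convex_body_def compact_imp_closed compact_imp_bounded)

definition supp :: "(real^2) set \<Rightarrow> real^2 \<Rightarrow> real" where
  "supp K v = Sup ((\<bullet>) v ` K)"

lemma supp_attained:
  assumes "compact K" "K \<noteq> {}"
  obtains x where "x \<in> K" "supp K v = v \<bullet> x" "\<And>y. y \<in> K \<Longrightarrow> v \<bullet> y \<le> v \<bullet> x"
proof -
  have "continuous_on K ((\<bullet>) v)" by (intro continuous_intros)
  then obtain x where x: "x \<in> K" "\<And>y. y \<in> K \<Longrightarrow> v \<bullet> y \<le> v \<bullet> x"
    using continuous_attains_sup[OF assms, of "(\<bullet>) v"] by auto
  then have "supp K v = v \<bullet> x"
    unfolding supp_def by (intro cSup_eq_maximum) auto
  with x show thesis using that by blast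
qed

lemma supp_ge:
  assumes "compact K" "x \<in> K"
  shows "v \<bullet> x \<le> supp K v"
  using assms supp_attained[of K v] by (metis empty_iff)

lemma supp_le:
  assumes "compact K" "K \<noteq> {}" "\<And>x. x \<in> K \<Longrightarrow> v \<bullet> x \<le> c"
  shows "supp K v \<le> c"
  using assms supp_attained[of K v] by metis

definition width :: "(real^2) set \<Rightarrow> real^2 \<Rightarrow> real" where
  "width K v = supp K v + supp K (- v)"

text \<open>Frontiers of planar convex bodies are homeomorphic, and comparison with the complex disk
  makes \<open>circlepath\<close> available. Without this, the choice in \<open>perim\<close> would
  be void.\<close>

lemma boundary_curve_exists:
  assumes K: "convex_body K"
  shows "\<exists>g. boundary_curve K g"
proof -
  note K = convex_bodyD[OF K]
  have "rel_frontier (cball (0::complex) 1) homeomorphic rel_frontier K"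
  proof (rule homeomorphic_rel_frontiers_convex_bounded_sets)
    have "aff_dim K = 2"
      using aff_dim_nonempty_interior[OF K(5)] by simp
    moreover have "aff_dim (cball (0::complex) 1) = 2"
      by (simp add: aff_dim_cball)
    ultimately show "aff_dim (cball (0::complex) 1) = aff_dim K" by simp
  qed (use K in auto)
  moreover have "rel_frontier (cball (0::complex) 1) = sphere 0 1"
    by (simp add: rel_frontier_nonempty_interior)
  moreover have "rel_frontier K = frontier K"
    using K(5) by (simp add: rel_frontier_nonempty_interior)
  ultimately obtain h k where h: "homeomorphism (sphere (0::complex) 1) (frontier K) h k"
    by (auto simp: homeomorphic_def)
  let ?c = "circlepath (0::complex) 1"
  have im: "path_image ?c = sphere (0::complex) 1"
    by simp
  have inj: "inj_on h (sphere 0 1)"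
    using h by (metis homeomorphism_def inj_on_inverseI)
  have "simple_path (h \<circ> ?c)"
    using h inj by (intro simple_path_continuous_image) (auto simp: simple_path_circlepath homeomorphism_def)
  moreover have "pathfinish (h \<circ> ?c) = pathstart (h \<circ> ?c)"
    by (simp add: pathfinish_compose pathstart_compose)
  moreover have "path_image (h \<circ> ?c) = frontier K"
    unfolding path_image_compose im using h by (simp add: homeomorphism_def)
  ultimately show ?thesis
    unfolding boundary_curve_def by blast
qed

text \<open>The interior is dense in \<open>K\<close>, so there are interior points strictly on both
  sides of the level line, and the segment between them crosses it.\<close>

lemma interior_level:
  assumes K: "convex_body K" and pq: "p \<in> K" "q \<in> K" "v \<bullet> p < c" "c < v \<bullet> q"
  obtains z where "z \<in> interior K" "v \<bullet> z = c"
proof -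
  have cl: "closure (interior K) = K"
    using convex_closure_interior[OF convex_bodyD(4,5)[OF K]] convex_bodyD(2)[OF K] by simp
  have "p \<in> {x. v \<bullet> x < c} \<inter> closure (interior K)" "q \<in> {x. v \<bullet> x > c} \<inter> closure (interior K)"
    using pq cl by auto
  then have "{x. v \<bullet> x < c} \<inter> interior K \<noteq> {}" "{x. v \<bullet> x > c} \<inter> interior K \<noteq> {}"
    using open_Int_closure_eq_empty[OF open_halfspace_lt, of v c "interior K"]
      open_Int_closure_eq_empty[OF open_halfspace_gt, of c v "interior K"] by blast+
  then obtain p' q' where p': "p' \<in> interior K" "v \<bullet> p' < c" and q': "q' \<in> interior K" "c < v \<bullet> q'"
    by blast
  define l where "l = (c - v \<bullet> p') / (v \<bullet> q' - v \<bullet> p')"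
  define z where "z = (1 - l) *\<^sub>R p' + l *\<^sub>R q'"
  have "0 \<le> l" "l \<le> 1"
    using p' q' by (auto simp: l_def divide_simps)
  then have "z \<in> interior K"
    using convexD_alt[OF convex_interior[OF convex_bodyD(4)[OF K]] p'(1) q'(1)] by (simp add: z_def)
  moreover have "v \<bullet> z = v \<bullet> p' + l * (v \<bullet> q' - v \<bullet> p')"
    by (simp add: z_def inner_add_right algebra_simps)
  then have "v \<bullet> z = c"
    using p' q' by (simp add: l_def)
  ultimately show thesis using that by blast
qed

text \<open>On either side of the interior point \<open>z\<close> the level line carries at most one
  frontier point: everything strictly between \<open>z\<close> and a point of \<open>K\<close> is
  interior.\<close>

lemma frontier_level_card:
  assumes K: "convex_body K" and z: "z \<in> interior K" and v: "v \<noteq> 0"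
    and S: "S \<subseteq> {x \<in> frontier K. v \<bullet> x = v \<bullet> z}"
  shows "card S \<le> 2"
proof -
  \<comment> \<open>The vector \<open>v\<close> turned by a right angle; \<open>s\<close> is the
    coordinate along the level line with origin \<open>z\<close>.\<close>
  define w :: "real^2" where "w = vector [- (v $ 2), v $ 1]"
  define s where "s x = w \<bullet> (x - z) / (v \<bullet> v)" for x
  have vv: "v \<bullet> v > 0" using v by simp
  have x_eq: "x = z + s x *\<^sub>R w" if "v \<bullet> x = v \<bullet> z" for x
  proof -
    define y where "y = x - z"
    have y: "v $ 1 * y $ 1 + v $ 2 * y $ 2 = 0"
      using that by (simp add: y_def inner_vec2 algebra_simps)
    have "(v \<bullet> v) * y $ 1 = (w \<bullet> y) * w $ 1" "(v \<bullet> v) * y $ 2 = (w \<bullet> y) * w $ 2"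
      using y unfolding w_def by (simp_all add: inner_vec2) algebra+
    then have "y = s x *\<^sub>R w"
      using vv by (simp add: vec2_eq_iff s_def field_simps flip: y_def)
    then show ?thesis by (simp add: y_def algebra_simps)
  qed
  have int: "x \<in> interior K" if y: "y \<in> frontier K" "v \<bullet> y = v \<bullet> z" and x: "v \<bullet> x = v \<bullet> z"
    and l: "s x = l * s y" "0 < l" "l < 1" for x y l
  proof -
    have "(1 - l) *\<^sub>R z + l *\<^sub>R y = (1 - l) *\<^sub>R z + l *\<^sub>R (z + s y *\<^sub>R w)"
      using x_eq[OF y(2)] by simp
    also have "\<dots> = z + s x *\<^sub>R w"
      using l(1) by (simp add: algebra_simps)
    finally have "x = (1 - l) *\<^sub>R z + l *\<^sub>R y"
      using x_eq[OF x] by simp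
    show ?thesis
    proof (cases "z = y")
      case False
      then have "x \<in> open_segment z y"
        using \<open>x = _\<close> l unfolding in_segment by blast
      moreover have "y \<in> closure K"
        using y(1) by (simp add: frontier_def)
      ultimately show ?thesis
        using in_interior_closure_convex_segment[OF convex_bodyD(4)[OF K] z] by blast
    qed (use z y in \<open>simp add: frontier_def\<close>)
  qed
  have nint: "x \<notin> interior K" if "x \<in> S" for x
    using that S by (auto simp: frontier_def)
  \<comment> \<open>Mapping a point to the side of \<open>z\<close> on which it lies is injective
    into \<open>bool\<close>, which gives the bound 2.\<close>
  have "inj_on (\<lambda>x. s x > 0) S"
  proof (rule inj_onI, rule ccontr)
    fix x y assume xy: "x \<in> S" "y \<in> S" "(s x > 0) = (s y > 0)" "x \<noteq> y"
    then have v: "v \<bullet> x = v \<bullet> z" "v \<bullet> y = v \<bullet> z" "x \<in> frontier K" "y \<in> frontier K" using S by auto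
    have nz: "s x \<noteq> 0" "s y \<noteq> 0"
      using nint[OF xy(1)] nint[OF xy(2)] x_eq[OF v(1)] x_eq[OF v(2)] z by fastforce+
    have ne: "s x \<noteq> s y"
      using xy(4) x_eq[OF v(1)] x_eq[OF v(2)] by metis
    consider "0 < s x / s y \<and> s x / s y < 1" | "0 < s y / s x \<and> s y / s x < 1"
      using nz ne xy(3) by (cases "s x > 0"; cases "s x < s y") (auto simp: divide_simps)
    then show False
    proof cases
      case 1
      then show False using int[OF v(4,2,1), of "s x / s y"] nint[OF xy(1)] nz by simp
    next
      case 2
      then show False using int[OF v(3,1,2), of "s y / s x"] nint[OF xy(2)] nz by simp
    qed
  qed
  then have "card S \<le> card (UNIV :: bool set)"
    by (rule card_inj_on_le) auto
  then show ?thesis by simp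
qed

text \<open>A line through an interior point meets the boundary at most twice, so the variation of a linear
  functional along the boundary is at most the integral of 2 over its range.\<close>

lemma boundary_variation_le:
  assumes K: "convex_body K" and g: "boundary_curve K g"
    and t: "t 0 = 0" "t n = 1" "\<And>i. i < n \<Longrightarrow> t i \<le> t (Suc i)"
  shows "(\<Sum>i<n. \<bar>v \<bullet> (g (t (Suc i)) - g (t i))\<bar>) \<le> 2 * width K v"
proof (cases "v = 0")
  case True
  have "width K 0 = 0"
    using convex_bodyD(6)[OF K] by (simp add: width_def supp_def image_constant_conv)
  with True show ?thesis by simp
next
  case False
  note Kc = convex_bodyD[OF K]
  have gp: "simple_path g" "path g" "path_image g = frontier K"
    using g by (auto simp: boundary_curve_def simple_path_imp_path)
  have frK: "frontier K \<subseteq> K"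
    using frontier_subset_closed[OF Kc(2)] .
  have tmono: "t i \<le> t j" if "i \<le> j" "j \<le> n" for i j
    using that
  proof (induction rule: dec_induct)
    case (step k)
    then show ?case using t(3)[of k] by simp
  qed simp
  have t01: "0 \<le> t i" "t i \<le> 1" if "i \<le> n" for i
    using tmono[of 0 i] tmono[of i n] that t by auto
  have gK: "g s \<in> frontier K" if "0 \<le> s" "s \<le> 1" for s
    using that gp(3) by (auto simp: path_image_def)
  define a where "a = - supp K (- v)"
  define b where "b = supp K v"
  have ab: "a \<le> v \<bullet> x" "v \<bullet> x \<le> b" if "x \<in> K" for x
    using supp_ge[OF Kc(1) that, of v] supp_ge[OF Kc(1) that, of "- v"] by (auto simp: a_def b_def)
  have "a \<le> b"
    using ab Kc(6) by (meson ex_in_conv order_trans)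
  define lo where "lo i = min (v \<bullet> g (t i)) (v \<bullet> g (t (Suc i)))" for i
  define hi where "hi i = max (v \<bullet> g (t i)) (v \<bullet> g (t (Suc i)))" for i
  \<comment> \<open>Every polygon edge that straddles \<open>c\<close> contains a crossing time in
    the open parameter interval of that edge. These intervals are disjoint and lie inside (0, 1),
    where \<open>g\<close> is injective, so the crossing points are distinct frontier points on the
    level \<open>c\<close>.\<close>
  have count: "(\<Sum>i<n. indicat_real {lo i<..<hi i} c) \<le> 2 * indicat_real {a..b} c" for c :: real
  proof -
    define A where "A = {i. i < n \<and> c \<in> {lo i<..<hi i}}"
    have fin: "finite A" by (simp add: A_def)
    have sum: "(\<Sum>i<n. indicat_real {lo i<..<hi i} c) = real (card A)"
    proof -
      have "(\<Sum>i<n. indicat_real {lo i<..<hi i} c) = (\<Sum>i\<in>A. 1::real)"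
        by (rule sum.mono_neutral_cong_right) (auto simp: A_def indicator_def)
      then show ?thesis by simp
    qed
    have ex: "\<exists>s. t i < s \<and> s < t (Suc i) \<and> v \<bullet> g s = c" if "i \<in> A" for i
    proof -
      have i: "i < n" "lo i < c" "c < hi i" using that by (auto simp: A_def)
      have le: "t i \<le> t (Suc i)" using t(3) i by simp
      have "{t i..t (Suc i)} \<subseteq> {0..1}"
        using t01[of i] t01[of "Suc i"] i(1) by simp
      with gp(2) have "continuous_on {t i..t (Suc i)} g"
        unfolding path_def by (rule continuous_on_subset)
      then have cont: "continuous_on {t i..t (Suc i)} (\<lambda>s. v \<bullet> g s)"
        by (intro continuous_intros)
      have "\<exists>s. t i \<le> s \<and> s \<le> t (Suc i) \<and> v \<bullet> g s = c"
      proof (cases "v \<bullet> g (t i) \<le> v \<bullet> g (t (Suc i))")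
        case True
        then show ?thesis
          using IVT'[of "\<lambda>s. v \<bullet> g s" "t i" c "t (Suc i)"] i le cont by (auto simp: lo_def hi_def)
      next
        case False
        then show ?thesis
          using IVT2'[of "\<lambda>s. v \<bullet> g s" "t (Suc i)" c "t i"] i le cont by (auto simp: lo_def hi_def)
      qed
      then obtain s where "t i \<le> s" "s \<le> t (Suc i)" "v \<bullet> g s = c" by blast
      moreover have "s \<noteq> t i" "s \<noteq> t (Suc i)"
        using calculation i by (auto simp: lo_def hi_def)
      ultimately show ?thesis by (intro exI[of _ s]) auto
    qed
    then obtain s where s: "\<And>i. i \<in> A \<Longrightarrow> t i < s i \<and> s i < t (Suc i) \<and> v \<bullet> g (s i) = c"
      by metis
    have sord: "s i < s j" if "i \<in> A" "j \<in> A" "i < j" for i j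
      using s[OF that(1)] s[OF that(2)] tmono[of "Suc i" j] that by (auto simp: A_def)
    have s01: "0 < s i" "s i < 1" if "i \<in> A" for i
      using s[OF that] t01[of i] t01[of "Suc i"] that by (auto simp: A_def)
    have "inj_on (\<lambda>i. g (s i)) A"
    proof (rule inj_onI)
      fix i j assume ij: "i \<in> A" "j \<in> A" "g (s i) = g (s j)"
      then have "s i = s j"
        using simple_path_inj_on[OF gp(1)] s01 by (auto dest!: inj_onD)
      then show "i = j"
        using sord[of i j] sord[of j i] ij by (metis less_irrefl nat_neq_iff)
    qed
    then have card: "card A = card ((\<lambda>i. g (s i)) ` A)"
      by (simp add: card_image)
    show ?thesis
    proof (cases "A = {}")
      case True
      then show ?thesis using sum by simp
    next
      case False
      then obtain i where "i \<in> A" by blast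
      then have i: "i < n" "lo i < c" "c < hi i" by (auto simp: A_def)
      have gi: "g (t i) \<in> K" "g (t (Suc i)) \<in> K"
        using gK frK t01[of i] t01[of "Suc i"] i by auto
      then have cab: "a < c" "c < b"
        using ab[OF gi(1)] ab[OF gi(2)] i by (auto simp: lo_def hi_def)
      obtain z where z: "z \<in> interior K" "v \<bullet> z = c"
        using interior_level[OF K gi, of v c] interior_level[OF K gi(2,1), of v c] i
        by (auto simp: lo_def hi_def min_def max_def split: if_splits)
      have "card ((\<lambda>i. g (s i)) ` A) \<le> 2"
      proof (rule frontier_level_card[OF K z(1) \<open>v \<noteq> 0\<close>])
        show "(\<lambda>i. g (s i)) ` A \<subseteq> {x \<in> frontier K. v \<bullet> x = v \<bullet> z}"
          using s s01 gK z(2) by (force simp: less_imp_le)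
      qed
      then show ?thesis
        using cab sum card by simp
    qed
  qed
  \<comment> \<open>Each absolute difference is the length of the open interval between the two
    values; interchanging sum and integral then counts crossings level by level, as with Banach's
    indicatrix.\<close>
  have "(\<Sum>i<n. \<bar>v \<bullet> (g (t (Suc i)) - g (t i))\<bar>) = (\<Sum>i<n. measure lborel {lo i<..<hi i})"
    by (intro sum.cong) (auto simp: lo_def hi_def inner_diff_right min_def max_def)
  also have "\<dots> = (\<Sum>i<n. \<integral>c. indicat_real {lo i<..<hi i} c \<partial>lborel)"
    by simp
  also have "\<dots> = (\<integral>c. (\<Sum>i<n. indicat_real {lo i<..<hi i} c) \<partial>lborel)"
    by (rule Bochner_Integration.integral_sum[symmetric])
       (auto simp: lo_def hi_def intro!: integrable_real_indicator)
  also have "\<dots> \<le> (\<integral>c. 2 * indicat_real {a..b} c \<partial>lborel)"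
    using \<open>a \<le> b\<close>
    by (intro integral_mono count Bochner_Integration.integrable_sum integrable_mult_right
         integrable_real_indicator) (auto simp: lo_def hi_def)
  also have "\<dots> = 2 * width K v"
    using \<open>a \<le> b\<close> by (simp add: a_def b_def width_def)
  finally show ?thesis .
qed

text \<open>A closed walk travels between two of its values twice: directly, and back through the
  common value \<open>F m = F 0\<close>.\<close>

lemma closed_variation_ge:
  fixes F :: "nat \<Rightarrow> real"
  assumes "F m = F 0" "i \<le> m" "j \<le> m"
  shows "2 * \<bar>F i - F j\<bar> \<le> (\<Sum>k<m. \<bar>F (Suc k) - F k\<bar>)"
proof -
  have *: "\<bar>F q - F p\<bar> \<le> (\<Sum>k\<in>{p..<q}. \<bar>F (Suc k) - F k\<bar>)" if "p \<le> q" for p q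
    using sum_abs[of "\<lambda>k. F (Suc k) - F k" "{p..<q}"] sum_Suc_diff'[OF that, of F] by simp
  have aux: "S = A + B + C \<Longrightarrow> d \<le> x + y \<Longrightarrow> d = w \<Longrightarrow> x \<le> A \<Longrightarrow> w \<le> B \<Longrightarrow> y \<le> C \<Longrightarrow> 2 * d \<le> S"
    for S A B C d x y w :: real
    by linarith
  have main: "2 * \<bar>F i - F j\<bar> \<le> (\<Sum>k<m. \<bar>F (Suc k) - F k\<bar>)" if "i \<le> j" "j \<le> m" for i j
  proof -
    have "(\<Sum>k<m. \<bar>F (Suc k) - F k\<bar>) = (\<Sum>k\<in>{0..<i}. \<bar>F (Suc k) - F k\<bar>) +
       (\<Sum>k\<in>{i..<j}. \<bar>F (Suc k) - F k\<bar>) + (\<Sum>k\<in>{j..<m}. \<bar>F (Suc k) - F k\<bar>)"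
      using that by (simp add: sum.atLeastLessThan_concat lessThan_atLeast0)
    moreover have "\<bar>F i - F j\<bar> \<le> \<bar>F i - F 0\<bar> + \<bar>F m - F j\<bar>" "\<bar>F i - F j\<bar> = \<bar>F j - F i\<bar>"
      using assms(1) by simp_all
    ultimately show ?thesis
      using *[OF le0[of i]] *[OF that(1)] *[OF that(2)] aux by blast
  qed
  show ?thesis
    using main[of i j] main[of j i] assms(2,3) abs_minus_commute[of "F i" "F j"] by (cases "i \<le> j") auto
qed

text \<open>The extreme values of \<open>v\<close> on \<open>K\<close> are taken on the frontier,
  hence at two times of the curve, and fine uniform partitions come close to both. Each extreme is
  missed by at most \<open>e / 4\<close> and the difference counts twice, which gives
  \<open>e\<close>. The form with all large \<open>m\<close> allows several functionals to share a
  partition.\<close>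

lemma boundary_variation_ge:
  assumes K: "convex_body K" and g: "boundary_curve K g" and e: "e > 0"
  shows "\<forall>\<^sub>F m in sequentially.
    2 * width K v - e \<le> (\<Sum>i<m. \<bar>v \<bullet> (g (real (Suc i) / real m) - g (real i / real m))\<bar>)"
proof (cases "v = 0")
  case True
  have "width K 0 = 0"
    using convex_bodyD(6)[OF K] by (simp add: width_def supp_def image_constant_conv)
  with True e show ?thesis by simp
next
  case False
  note Kc = convex_bodyD[OF K]
  have gp: "path g" "path_image g = frontier K" "g 1 = g 0"
    using g by (auto simp: boundary_curve_def simple_path_imp_path pathfinish_def pathstart_def)
  have ext: "\<exists>s\<in>{0..1}. supp K w = w \<bullet> g s" if w: "w \<noteq> 0" for w
  proof -
    obtain x where x: "x \<in> K" "supp K w = w \<bullet> x" "\<And>y. y \<in> K \<Longrightarrow> w \<bullet> y \<le> w \<bullet> x"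
      using supp_attained[OF Kc(1,6)] by metis
    have "x \<notin> interior K"
    proof
      assume "x \<in> interior K"
      then obtain r where r: "r > 0" "cball x r \<subseteq> K" by (meson mem_interior_cball)
      have "x + (r / norm w) *\<^sub>R w \<in> cball x r"
        using r w by (simp add: dist_norm)
      then have "w \<bullet> (x + (r / norm w) *\<^sub>R w) \<le> w \<bullet> x" using x(3) r by blast
      then have "w \<bullet> w \<le> 0" using r w by (simp add: inner_add_right mult_le_0_iff divide_le_0_iff)
      then show False using w by (metis inner_gt_zero_iff not_less)
    qed
    then have "x \<in> path_image g"
      using x(1) closure_subset[of K] by (auto simp: gp(2) frontier_def)
    then show ?thesis using x(2) by (auto simp: path_image_def)
  qed
  obtain s1 s2 where s: "s1 \<in> {0..1}" "supp K v = v \<bullet> g s1" "s2 \<in> {0..1}" "supp K (- v) = (- v) \<bullet> g s2"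
    using ext[of v] ext[of "- v"] False by auto
  have "uniformly_continuous_on {0..1} (\<lambda>s. v \<bullet> g s)"
    using gp(1) by (intro compact_uniformly_continuous continuous_intros) (auto simp: path_def)
  then obtain d where d: "d > 0"
    "\<And>x y. x \<in> {0..1} \<Longrightarrow> y \<in> {0..1} \<Longrightarrow> dist y x < d \<Longrightarrow> dist (v \<bullet> g y) (v \<bullet> g x) < e / 4"
    using e unfolding uniformly_continuous_on_def by (metis zero_less_divide_iff zero_less_numeral)
  have near: "\<exists>i\<le>m. \<bar>v \<bullet> g (real i / real m) - v \<bullet> g s\<bar> < e / 4"
    if s: "s \<in> {0..1}" and m: "real m > 1 / d" "m > 0" for s m
  proof -
    define i where "i = nat \<lfloor>s * m\<rfloor>"
    have "of_int \<lfloor>s * m\<rfloor> \<le> s * m" "s * m < of_int \<lfloor>s * m\<rfloor> + 1" by linarith+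
    moreover have "real i = of_int \<lfloor>s * m\<rfloor>"
      using s by (simp add: i_def)
    ultimately have i: "real i \<le> s * m" "s * m < real i + 1"
      by linarith+
    have "s * m \<le> m" using s by (simp add: mult_left_le_one_le)
    then have im: "i \<le> m" using i(1) by linarith
    have "\<bar>real i / m - s\<bar> \<le> 1 / m"
    proof -
      have "\<bar>real i / m - s\<bar> = \<bar>real i - s * m\<bar> / m"
        using m by (simp add: abs_div_pos diff_divide_distrib)
      also have "\<dots> \<le> 1 / m"
        using i by (intro divide_right_mono) auto
      finally show ?thesis .
    qed
    also have "\<dots> < d" using m d(1) by (simp add: field_simps)
    finally have "dist (v \<bullet> g (real i / m)) (v \<bullet> g s) < e / 4"
      using im m s by (intro d(2)) (auto simp: dist_real_def)
    then show ?thesis using im by (auto simp: dist_real_def)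
  qed
  have "\<forall>\<^sub>F m in sequentially. real m > 1 / d \<and> m > 0"
    using eventually_gt_at_top[of "nat \<lceil>1 / d\<rceil>"] by eventually_elim linarith
  then show ?thesis
  proof eventually_elim
    case (elim m)
    obtain i j where ij: "i \<le> m" "j \<le> m" "\<bar>v \<bullet> g (real i / real m) - v \<bullet> g s1\<bar> < e / 4"
      "\<bar>v \<bullet> g (real j / real m) - v \<bullet> g s2\<bar> < e / 4"
      using near[OF s(1)] near[OF s(3)] elim by blast
    have "2 * \<bar>v \<bullet> g (real i / m) - v \<bullet> g (real j / m)\<bar> \<le>
        (\<Sum>k<m. \<bar>v \<bullet> g (real (Suc k) / m) - v \<bullet> g (real k / m)\<bar>)"
      using elim gp(3) ij by (intro closed_variation_ge[where F="\<lambda>k. v \<bullet> g (real k / m)"]) auto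
    moreover have "width K v = v \<bullet> g s1 - v \<bullet> g s2"
      using s by (simp add: width_def)
    moreover have "2 * (y1 - y2) - e \<le> S"
      if "2 * \<bar>x1 - x2\<bar> \<le> S" "\<bar>x1 - y1\<bar> < e / 4" "\<bar>x2 - y2\<bar> < e / 4" for x1 x2 y1 y2 S :: real
      using that by (simp add: abs_if split: if_splits)
    ultimately show ?case
      using ij(3,4) unfolding inner_diff_right by simp
  qed
qed

text \<open>Crofton's formula for the perimeter of \<open>K\<close> in the norm
  \<open>znorm n \<phi>\<close>: every level line in the range is crossed twice.\<close>

definition zperim :: "nat \<Rightarrow> (nat \<Rightarrow> real^2) \<Rightarrow> (real^2) set \<Rightarrow> real" where
  "zperim n \<phi> K = 2 * (\<Sum>j<n. width K (\<phi> j))"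

text \<open>One fine partition serves all \<open>n\<close> functionals simultaneously, each
  receiving a share \<open>e'\<close> of the error; the \<open>+ 1\<close> in its denominator allows
  \<open>n = 0\<close>.\<close>

lemma arclength_ge:
  assumes K: "convex_body K" and g: "boundary_curve K g"
    and le: "\<And>x. znorm n \<phi> x \<le> mnorm M x"
  shows "ereal (zperim n \<phi> K) \<le> arclength M g"
proof (rule ereal_le_epsilon2)
  fix e :: real assume e: "e > 0"
  define e' where "e' = e / (real n + 1)"
  have e': "e' > 0" "real n * e' \<le> e"
    using e by (auto simp: e'_def field_simps)
  have "\<forall>\<^sub>F m in sequentially. \<forall>j\<in>{..<n}. 2 * width K (\<phi> j) - e' \<le>
      (\<Sum>i<m. \<bar>\<phi> j \<bullet> (g (real (Suc i) / real m) - g (real i / real m))\<bar>)"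
    by (rule eventually_ball_finite) (use boundary_variation_ge[OF K g e'(1)] in auto)
  then have "\<forall>\<^sub>F m in sequentially. (\<forall>j\<in>{..<n}. 2 * width K (\<phi> j) - e' \<le>
      (\<Sum>i<m. \<bar>\<phi> j \<bullet> (g (real (Suc i) / real m) - g (real i / real m))\<bar>)) \<and> m > 0"
    using eventually_gt_at_top[of 0] by eventually_elim auto
  from eventually_happens'[OF sequentially_bot this]
  obtain m where m: "m > 0" "\<And>j. j < n \<Longrightarrow> 2 * width K (\<phi> j) - e' \<le>
      (\<Sum>i<m. \<bar>\<phi> j \<bullet> (g (real (Suc i) / real m) - g (real i / real m))\<bar>)"
    by blast
  let ?t = "\<lambda>i. real i / real m"
  have "zperim n \<phi> K - e \<le> (\<Sum>j<n. 2 * width K (\<phi> j) - e')"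
    using e'(2) unfolding zperim_def sum_subtractf sum_distrib_left by simp
  also have "\<dots> \<le> (\<Sum>j<n. \<Sum>i<m. \<bar>\<phi> j \<bullet> (g (?t (Suc i)) - g (?t i))\<bar>)"
    by (intro sum_mono m(2)) auto
  also have "\<dots> = (\<Sum>i<m. znorm n \<phi> (g (?t (Suc i)) - g (?t i)))"
    unfolding znorm_def by (rule sum.swap)
  also have "\<dots> \<le> (\<Sum>i<m. mnorm M (g (?t (Suc i)) - g (?t i)))"
    by (intro sum_mono le)
  finally have "ereal (zperim n \<phi> K - e) \<le> ereal (\<Sum>i<m. mnorm M (g (?t (Suc i)) - g (?t i)))"
    unfolding ereal_less_eq(3) .
  also have "ereal (\<Sum>i<m. mnorm M (g (?t (Suc i)) - g (?t i))) \<le> arclength M g"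
    unfolding arclength_def
  proof (rule Sup_upper, rule CollectI, rule exI[of _ m], rule exI[of _ ?t], intro conjI refl allI impI)
    show "?t i \<le> ?t (Suc i)" for i
      by (rule divide_right_mono) auto
  qed (use m(1) in auto)
  finally have "ereal (zperim n \<phi> K - e) \<le> arclength M g" .
  then have "ereal (zperim n \<phi> K - e) + ereal e \<le> arclength M g + ereal e"
    by (rule add_right_mono)
  then show "ereal (zperim n \<phi> K) \<le> arclength M g + ereal e" by simp
qed

lemma arclength_le:
  assumes K: "convex_body K" and g: "boundary_curve K g"
    and le: "\<And>x. mnorm M x \<le> c * znorm n \<phi> x" and c: "c \<ge> 0"
  shows "arclength M g \<le> ereal (c * zperim n \<phi> K)"
  unfolding arclength_def
proof (rule Sup_least, clarify)
  fix m and t :: "nat \<Rightarrow> real"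
  assume t: "t 0 = 0" "t m = 1" "\<forall>i<m. t i \<le> t (Suc i)"
  have "(\<Sum>i<m. mnorm M (g (t (Suc i)) - g (t i))) \<le> (\<Sum>i<m. c * znorm n \<phi> (g (t (Suc i)) - g (t i)))"
    by (intro sum_mono le)
  also have "\<dots> = c * (\<Sum>j<n. \<Sum>i<m. \<bar>\<phi> j \<bullet> (g (t (Suc i)) - g (t i))\<bar>)"
    unfolding znorm_def sum_distrib_left[symmetric] by (subst sum.swap) simp
  also have "\<dots> \<le> c * (\<Sum>j<n. 2 * width K (\<phi> j))"
    using t by (intro mult_left_mono[OF _ c] sum_mono boundary_variation_le[OF K g]) auto
  finally show "ereal (\<Sum>i<m. mnorm M (g (t (Suc i)) - g (t i))) \<le> ereal (c * zperim n \<phi> K)"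
    by (simp add: zperim_def sum_distrib_left)
qed

section \<open>Perimeter as a limit of sums of widths\<close>

definition per :: "(real^2) set \<Rightarrow> (real^2) set \<Rightarrow> real" where
  "per M K = real_of_ereal (perim M K)"

lemma some_boundary_curve: "convex_body K \<Longrightarrow> boundary_curve K (SOME g. boundary_curve K g)"
  using boundary_curve_exists by (rule someI_ex)

lemma supp_scale_translate:
  assumes "compact K" "K \<noteq> {}" "c > 0"
  shows "supp ((\<lambda>x. a + c *\<^sub>R x) ` K) v = v \<bullet> a + c * supp K v"
proof (rule antisym)
  have comp: "compact ((\<lambda>x. a + c *\<^sub>R x) ` K)"
    using assms by (intro compact_continuous_image continuous_intros)
  show "supp ((\<lambda>x. a + c *\<^sub>R x) ` K) v \<le> v \<bullet> a + c * supp K v"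
    using assms supp_ge[OF assms(1)] by (intro supp_le comp) (auto simp: inner_add_right)
  obtain x where x: "x \<in> K" "supp K v = v \<bullet> x"
    using supp_attained[OF assms(1,2)] by metis
  then show "v \<bullet> a + c * supp K v \<le> supp ((\<lambda>x. a + c *\<^sub>R x) ` K) v"
    using supp_ge[OF comp imageI[OF x(1)], of v] by (simp add: inner_add_right)
qed

lemma zperim_scale_translate:
  assumes "compact K" "K \<noteq> {}" "c > 0"
  shows "zperim n \<phi> ((\<lambda>x. a + c *\<^sub>R x) ` K) = c * zperim n \<phi> K"
  by (simp add: zperim_def width_def supp_scale_translate[OF assms] sum_distrib_left algebra_simps)

lemma zperim_mono:
  assumes "compact K" "K \<noteq> {}" "compact K'" "K \<subseteq> K'"
  shows "zperim n \<phi> K \<le> zperim n \<phi> K'"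
proof -
  have "supp K v \<le> supp K' v" for v
    using assms by (intro supp_le supp_ge) auto
  then show ?thesis
    unfolding zperim_def width_def by (intro mult_left_mono sum_mono add_mono) auto
qed

text \<open>A zonotopal norm within a factor 2 of \<open>mnorm M\<close> already encloses the
  perimeter between finite bounds.\<close>

lemma perim_eq_per:
  assumes M: "M \<in> M2" and K: "convex_body K"
  shows "perim M K = ereal (per M K)"
proof -
  obtain n \<phi> where z: "zapprox M 1 n \<phi>"
    using zapprox_exists[OF M, of 1] by auto
  have "ereal (zperim n \<phi> K) \<le> perim M K"
    unfolding perim_def using z by (intro arclength_ge[OF K some_boundary_curve[OF K]]) (auto simp: zapprox_def)
  moreover have "perim M K \<le> ereal (2 * zperim n \<phi> K)"
    unfolding perim_def using z by (intro arclength_le[OF K some_boundary_curve[OF K]]) (auto simp: zapprox_def)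
  ultimately have "\<bar>perim M K\<bar> \<noteq> \<infinity>"
    by auto
  then show ?thesis
    by (simp add: per_def ereal_real)
qed

lemma per_ge:
  assumes M: "M \<in> M2" and K: "convex_body K" and le: "\<And>x. znorm n \<phi> x \<le> mnorm M x"
  shows "zperim n \<phi> K \<le> per M K"
proof -
  have "ereal (zperim n \<phi> K) \<le> perim M K"
    unfolding perim_def by (intro arclength_ge[OF K some_boundary_curve[OF K]] le)
  then show ?thesis
    by (simp add: perim_eq_per[OF M K])
qed

lemma per_nonneg:
  assumes M: "M \<in> M2" and K: "convex_body K"
  shows "0 \<le> per M K"
  using per_ge[OF assms, of 0 "\<lambda>_. 0"] mnorm_nonneg[OF M] by (simp add: znorm_def zperim_def)

lemma per_le:
  assumes M: "M \<in> M2" and K: "convex_body K" and z: "zapprox M \<epsilon> n \<phi>" "\<epsilon> \<ge> 0"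
  shows "per M K \<le> (1 + \<epsilon>) * zperim n \<phi> K"
proof -
  have "perim M K \<le> ereal ((1 + \<epsilon>) * zperim n \<phi> K)"
    unfolding perim_def using z by (intro arclength_le[OF K some_boundary_curve[OF K]]) (auto simp: zapprox_def)
  then show ?thesis
    by (simp add: perim_eq_per[OF M K])
qed

text \<open>The same sequence serves all vectors and all bodies, so inequalities combining several
  perimeters and norms can be checked for zonotopal norms and then passed to the limit.\<close>

lemma zapprox_seq:
  assumes M: "M \<in> M2"
  obtains n \<phi> where "\<And>k x. znorm (n k) (\<phi> k) x \<le> mnorm M x"
    "\<And>x. (\<lambda>k. znorm (n k) (\<phi> k) x) \<longlonglongrightarrow> mnorm M x"
    "\<And>K. convex_body K \<Longrightarrow> (\<lambda>k. zperim (n k) (\<phi> k) K) \<longlonglongrightarrow> per M K"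
proof -
  define e where "e k = 1 / real (Suc k)" for k
  have e: "e k > 0" for k by (simp add: e_def)
  have lim: "(\<lambda>k. y / (1 + e k)) \<longlonglongrightarrow> y" for y :: real
  proof -
    have "(\<lambda>k. y / (1 + e k)) \<longlonglongrightarrow> y / (1 + 0)"
      unfolding e_def by (intro tendsto_intros LIMSEQ_inverse_real_of_nat[unfolded inverse_eq_divide]) auto
    then show ?thesis by simp
  qed
  have "\<exists>q. zapprox M (e k) (fst q) (snd q)" for k
    using zapprox_exists[OF M e] by auto
  then obtain q where q: "\<And>k. zapprox M (e k) (fst (q k)) (snd (q k))"
    by metis
  define n \<phi> where "n k = fst (q k)" and "\<phi> k = snd (q k)" for k
  have z: "zapprox M (e k) (n k) (\<phi> k)" for k
    using q by (simp add: n_def \<phi>_def)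
  have le: "znorm (n k) (\<phi> k) x \<le> mnorm M x" for k x
    using z by (simp add: zapprox_def)
  show thesis
  proof (rule that[of n \<phi>])
    show "(\<lambda>k. znorm (n k) (\<phi> k) x) \<longlonglongrightarrow> mnorm M x" for x
    proof (rule tendsto_sandwich[OF _ _ lim tendsto_const])
      have "mnorm M x / (1 + e k) \<le> znorm (n k) (\<phi> k) x" for k
        using z[of k] e[of k] by (simp add: zapprox_def field_simps)
      then show "\<forall>\<^sub>F k in sequentially. mnorm M x / (1 + e k) \<le> znorm (n k) (\<phi> k) x" by simp
    qed (simp add: le)
    show "(\<lambda>k. zperim (n k) (\<phi> k) K) \<longlonglongrightarrow> per M K" if K: "convex_body K" for K
    proof (rule tendsto_sandwich[OF _ _ lim tendsto_const])
      have "per M K / (1 + e k) \<le> zperim (n k) (\<phi> k) K" for k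
        using per_le[OF M K z[of k]] e[of k] by (simp add: field_simps)
      then show "\<forall>\<^sub>F k in sequentially. per M K / (1 + e k) \<le> zperim (n k) (\<phi> k) K" by simp
      show "\<forall>\<^sub>F k in sequentially. zperim (n k) (\<phi> k) K \<le> per M K"
        using per_ge[OF M K le] by simp
    qed
  qed (rule le)
qed

text \<open>The perimeter is the supremum of the \<open>zperim\<close> values over zonotopal
  seminorms below the norm. With \<open>per_ge\<close> this reduces comparisons of perimeters to
  widths.\<close>

lemma per_least:
  assumes M: "M \<in> M2" and K: "convex_body K"
    and le: "\<And>n \<phi>. (\<And>x. znorm n \<phi> x \<le> mnorm M x) \<Longrightarrow> zperim n \<phi> K \<le> c"
  shows "per M K \<le> c"
proof -
  obtain n \<phi> where s: "\<And>k x. znorm (n k) (\<phi> k) x \<le> mnorm M x"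
    "(\<lambda>k. zperim (n k) (\<phi> k) K) \<longlonglongrightarrow> per M K"
    using zapprox_seq[OF M] K by metis
  show ?thesis
    by (rule LIMSEQ_le_const2[OF s(2)]) (use le s(1) in blast)
qed

lemma per_mono:
  assumes M: "M \<in> M2" and K: "convex_body K" and K': "convex_body K'" and "K \<subseteq> K'"
  shows "per M K \<le> per M K'"
proof (rule per_least[OF M K])
  fix n \<phi> assume "\<And>x. znorm n \<phi> x \<le> mnorm M x"
  then have "zperim n \<phi> K' \<le> per M K'" by (rule per_ge[OF M K'])
  moreover have "zperim n \<phi> K \<le> zperim n \<phi> K'"
    using convex_bodyD[OF K] convex_bodyD[OF K'] assms by (intro zperim_mono) auto
  ultimately show "zperim n \<phi> K \<le> per M K'" by simp
qed

lemma convex_body_scale_translate: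
  assumes K: "convex_body K" and c: "c > 0"
  shows "convex_body ((\<lambda>x. a + c *\<^sub>R x) ` K)"
proof -
  note Kc = convex_bodyD[OF K]
  have "(\<lambda>x. a + c *\<^sub>R x) ` K = (+) a ` ((*\<^sub>R) c ` K)" by (simp add: image_image)
  moreover have "interior ((+) a ` ((*\<^sub>R) c ` K)) \<noteq> {}"
    using Kc(5) c by (simp add: interior_translation interior_injective_linear_image linear_scaleR inj_on_def)
  moreover have "compact ((+) a ` ((*\<^sub>R) c ` K))"
    using Kc(1) by (simp add: compact_scaling compact_translation)
  moreover have "convex ((+) a ` ((*\<^sub>R) c ` K))"
    using Kc(4) by (simp add: convex_scaling)
  ultimately show ?thesis by (simp add: convex_body_def)
qed

lemma per_scale_translate:
  assumes M: "M \<in> M2" and K: "convex_body K" and c: "c > 0"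
  shows "per M ((\<lambda>x. a + c *\<^sub>R x) ` K) = c * per M K"
proof (rule antisym)
  note Kc = convex_bodyD[OF K]
  let ?K = "(\<lambda>x. a + c *\<^sub>R x) ` K"
  have K': "convex_body ?K" by (rule convex_body_scale_translate[OF K c])
  show "per M ?K \<le> c * per M K"
  proof (rule per_least[OF M K'])
    fix n \<phi> assume "\<And>x. znorm n \<phi> x \<le> mnorm M x"
    then have "zperim n \<phi> K \<le> per M K" by (rule per_ge[OF M K])
    then show "zperim n \<phi> ?K \<le> c * per M K"
      using c by (simp add: zperim_scale_translate[OF Kc(1,6) c])
  qed
  have "per M K \<le> per M ?K / c"
  proof (rule per_least[OF M K])
    fix n \<phi> assume "\<And>x. znorm n \<phi> x \<le> mnorm M x"
    then have "zperim n \<phi> ?K \<le> per M ?K" by (rule per_ge[OF M K'])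
    then show "zperim n \<phi> K \<le> per M ?K / c"
      using c by (simp add: zperim_scale_translate[OF Kc(1,6) c] field_simps)
  qed
  then show "c * per M K \<le> per M ?K"
    using c by (simp add: field_simps)
qed

lemma per_mono_scale:
  assumes M: "M \<in> M2" and K: "convex_body K" and K': "convex_body K'" and c: "c > 0"
    and sub: "\<And>x. x \<in> K \<Longrightarrow> x /\<^sub>R c \<in> K'"
  shows "per M K \<le> c * per M K'"
proof -
  have "K \<subseteq> (\<lambda>x. 0 + c *\<^sub>R x) ` K'"
  proof
    fix x assume "x \<in> K"
    from sub[OF this] show "x \<in> (\<lambda>x. 0 + c *\<^sub>R x) ` K'"
      using c by (intro image_eqI[where x="x /\<^sub>R c"]) auto
  qed
  then have "per M K \<le> per M ((\<lambda>x. 0 + c *\<^sub>R x) ` K')"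
    by (intro per_mono M K convex_body_scale_translate K' c)
  then show ?thesis
    by (simp only: per_scale_translate[OF M K' c])
qed

text \<open>Dividing the functionals by \<open>c\<close> turns a seminorm below
  \<open>mnorm M'\<close> into one below \<open>mnorm M\<close>, and widths are homogeneous in the
  functional.\<close>

lemma per_mono_unit_ball:
  assumes M: "M \<in> M2" and M': "M' \<in> M2" and K: "convex_body K" and c: "c > 0"
    and le: "\<And>x. mnorm M' x \<le> c * mnorm M x"
  shows "per M' K \<le> c * per M K"
proof (rule per_least[OF M' K])
  fix n \<phi> assume z: "\<And>x. znorm n \<phi> x \<le> mnorm M' x"
  let ?\<psi> = "\<lambda>j. \<phi> j /\<^sub>R c"
  have "znorm n ?\<psi> x = znorm n \<phi> x / c" for x
    using c by (simp add: znorm_def abs_mult sum_distrib_left field_simps flip: sum_divide_distrib)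
  moreover have "znorm n \<phi> x / c \<le> mnorm M x" for x
    using order_trans[OF z[of x] le[of x]] c by (simp add: field_simps)
  ultimately have 1: "zperim n ?\<psi> K \<le> per M K"
    by (intro per_ge[OF M K]) simp
  have "supp K (v /\<^sub>R c) = supp K v / c" for v
  proof -
    obtain x where x: "x \<in> K" "supp K v = v \<bullet> x"
      using supp_attained[OF convex_bodyD(1,6)[OF K]] by metis
    have "supp K (v /\<^sub>R c) \<le> supp K v / c"
      using c supp_ge[OF convex_bodyD(1)[OF K], of _ v]
      by (intro supp_le convex_bodyD[OF K]) (auto simp: field_simps)
    moreover have "supp K v / c \<le> supp K (v /\<^sub>R c)"
      using supp_ge[OF convex_bodyD(1)[OF K] x(1), of "v /\<^sub>R c"] x(2) c by (simp add: field_simps)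
    ultimately show ?thesis by simp
  qed
  then have "zperim n ?\<psi> K = zperim n \<phi> K / c"
    by (simp add: zperim_def width_def flip: scaleR_minus_right sum_divide_distrib add_divide_distrib)
  then have "zperim n \<phi> K / c \<le> per M K"
    using 1 by simp
  then show "zperim n \<phi> K \<le> c * per M K"
    using c by (simp add: divide_le_eq mult.commute)
qed

lemma M2_convex_body: "M \<in> M2 \<Longrightarrow> convex_body M"
  using M2D by (simp add: convex_body_def)

section \<open>Lenses\<close>

definition lens :: "(real^2) set \<Rightarrow> real^2 \<Rightarrow> (real^2) set" where
  "lens M u = {a. a + u /\<^sub>R 2 \<in> M \<and> a - u /\<^sub>R 2 \<in> M}"

lemma lens_eq_Int: "lens M u = (+) (- (u /\<^sub>R 2)) ` M \<inter> (+) (u /\<^sub>R 2) ` M"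
proof -
  have "x \<in> (+) b ` M \<longleftrightarrow> x - b \<in> M" for x b
    by (metis (no_types, lifting) add_diff_cancel_left' diff_add_cancel add.commute image_iff)
  from this[of _ "- (u /\<^sub>R 2)"] this[of _ "u /\<^sub>R 2"] show ?thesis
    by (auto simp: lens_def)
qed

text \<open>The centre 0 is interior because \<open>u /\<^sub>R 2\<close> has norm at most 1/2, well
  inside the unit ball.\<close>

lemma lens_convex_body:
  assumes M: "M \<in> M2" and u: "mnorm M u \<le> 1"
  shows "convex_body (lens M u)"
proof -
  have "open {x. mnorm M (x + u /\<^sub>R 2) < 1}" "open {x. mnorm M (x - u /\<^sub>R 2) < 1}"
    by (intro open_Collect_less continuous_intros continuous_on_compose2[OF mnorm_continuous[OF M, of UNIV]]; simp)+
  then have op: "open ({x. mnorm M (x + u /\<^sub>R 2) < 1} \<inter> {x. mnorm M (x - u /\<^sub>R 2) < 1})" (is "open ?U")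
    by blast
  have half: "mnorm M (u /\<^sub>R 2) < 1"
    using u by (simp add: mnorm_scale[OF M])
  have "0 \<in> ?U"
    using half mnorm_minus[OF M, of "u /\<^sub>R 2"] by simp
  moreover have "?U \<subseteq> lens M u"
    using mnorm_le_1_iff[OF M] by (fastforce simp: lens_def)
  ultimately have "interior (lens M u) \<noteq> {}"
    using interior_maximal[OF _ op] by blast
  moreover have "compact (lens M u)" "convex (lens M u)"
    unfolding lens_eq_Int using M2D[OF M]
    by (intro compact_Int compact_translation convex_Int; simp)+
  ultimately show ?thesis by (simp add: convex_body_def)
qed

lemma L_eq:
  assumes M: "M \<in> M2" and pq: "mnorm M (q - p) = 1"
  shows "L M p q = ereal (per M (lens M (q - p)) / 2)"
proof -
  let ?K = "lens M (q - p)" and ?c = "(p + q) /\<^sub>R 2"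
  have K: "convex_body ?K"
    using pq by (intro lens_convex_body[OF M]) simp
  have mem: "x \<in> (+) b ` A \<longleftrightarrow> x - b \<in> A" for x b :: "real^2" and A
    by (metis (no_types, lifting) add_diff_cancel_left' diff_add_cancel add.commute image_iff)
  have "x - ?c + (q - p) /\<^sub>R 2 = x - p" "x - ?c - (q - p) /\<^sub>R 2 = x - q" for x
    by (simp_all add: vec_eq_iff field_simps)
  moreover have "x \<in> (\<lambda>x. ?c + 1 *\<^sub>R x) ` ?K \<longleftrightarrow> x - ?c \<in> ?K" for x
    by (simp only: scaleR_one mem)
  ultimately have "x \<in> (\<lambda>x. p + x) ` M \<inter> (\<lambda>x. q + x) ` M \<longleftrightarrow> x \<in> (\<lambda>x. ?c + 1 *\<^sub>R x) ` ?K" for x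
    by (simp only: mem lens_def mem_Collect_eq Int_iff)
  then have eq: "(\<lambda>x. p + x) ` M \<inter> (\<lambda>x. q + x) ` M = (\<lambda>x. ?c + 1 *\<^sub>R x) ` ?K"
    by blast
  have "per M ((\<lambda>x. ?c + 1 *\<^sub>R x) ` ?K) = per M ?K"
    using per_scale_translate[OF M K, of 1 ?c] by simp
  then show ?thesis
    unfolding L_def eq perim_eq_per[OF M convex_body_scale_translate[OF K zero_less_one]] by simp
qed

lemma L_values_eq:
  assumes M: "M \<in> M2"
  shows "L_values M = (\<lambda>u. ereal (per M (lens M u) / 2)) ` {u. mnorm M u = 1}"
proof -
  have "\<exists>p q. ereal (per M (lens M u) / 2) = L M p q \<and> mnorm M (q - p) = 1" if "mnorm M u = 1" for u
    using L_eq[OF M, of u 0] that by (intro exI[of _ 0] exI[of _ u]) simp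
  then show ?thesis
    unfolding L_values_def using L_eq[OF M] by force
qed

lemma is_min_L_values_iff:
  assumes M: "M \<in> M2"
  shows "is_min (L_values M) m \<longleftrightarrow> (\<exists>u. mnorm M u = 1 \<and> m = ereal (per M (lens M u) / 2) \<and>
    (\<forall>w. mnorm M w = 1 \<longrightarrow> per M (lens M u) \<le> per M (lens M w)))"
  unfolding is_min_def L_values_eq[OF M] by auto

lemma is_max_L_values_iff:
  assumes M: "M \<in> M2"
  shows "is_max (L_values M) m \<longleftrightarrow> (\<exists>u. mnorm M u = 1 \<and> m = ereal (per M (lens M u) / 2) \<and>
    (\<forall>w. mnorm M w = 1 \<longrightarrow> per M (lens M w) \<le> per M (lens M u)))"
  unfolding is_max_def L_values_eq[OF M] by auto

text \<open>Handles both perturbations at once: \<open>e\<close> measures the change of the unit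
  ball and \<open>d\<close> that of the vector. A shrunken point gains room in proportion to the
  shrinking, as half of \<open>u\<close> uses up only half of the radius.\<close>

lemma lens_compare:
  assumes M: "M \<in> M2" and e: "e \<ge> 0" and MM': "\<And>x. x \<in> M' \<Longrightarrow> mnorm M x \<le> 1 + e"
    and u: "mnorm M u \<le> 1" and d: "mnorm M (u - u') \<le> d"
    and a: "a \<in> lens M' u'"
  shows "a /\<^sub>R (1 + 2 * e + d) \<in> lens M u"
proof -
  have d0: "d \<ge> 0" using d mnorm_nonneg[OF M, of "u - u'"] by linarith
  \<comment> \<open>The largest factor for which the bound s(1 + e) + sd/2 + (1 - s)/2 obtained in
    \<open>key\<close> does not exceed 1.\<close>
  define s where "s = 1 / (1 + 2 * e + d)"
  have s: "0 < s" "s \<le> 1" using d0 e by (auto simp: s_def field_simps)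
  have key: "s *\<^sub>R a + \<sigma> *\<^sub>R (u /\<^sub>R 2) \<in> M" if \<sigma>: "\<sigma> = 1 \<or> \<sigma> = -1" for \<sigma> :: real
  proof -
    have "a + \<sigma> *\<^sub>R (u' /\<^sub>R 2) \<in> M'"
      using a \<sigma> by (auto simp: lens_def)
    then have 1: "mnorm M (a + \<sigma> *\<^sub>R (u' /\<^sub>R 2)) \<le> 1 + e" by (rule MM')
    have abs: "\<bar>\<sigma>\<bar> = 1" using \<sigma> by auto
    have "s *\<^sub>R a + \<sigma> *\<^sub>R (u /\<^sub>R 2) =
        s *\<^sub>R (a + \<sigma> *\<^sub>R (u' /\<^sub>R 2)) + (\<sigma> * s / 2) *\<^sub>R (u - u') + (\<sigma> * (1 - s) / 2) *\<^sub>R u"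
      by (simp add: vec2_eq_iff field_simps)
    then have "mnorm M (s *\<^sub>R a + \<sigma> *\<^sub>R (u /\<^sub>R 2)) \<le>
        mnorm M (s *\<^sub>R (a + \<sigma> *\<^sub>R (u' /\<^sub>R 2))) + mnorm M ((\<sigma> * s / 2) *\<^sub>R (u - u')) + mnorm M ((\<sigma> * (1 - s) / 2) *\<^sub>R u)"
      using order_trans[OF mnorm_triangle[OF M] add_right_mono[OF mnorm_triangle[OF M]]] by simp
    also have "\<dots> = s * mnorm M (a + \<sigma> *\<^sub>R (u' /\<^sub>R 2)) + s / 2 * mnorm M (u - u') + (1 - s) / 2 * mnorm M u"
      using s abs by (simp add: mnorm_scale[OF M] abs_mult)
    also have "\<dots> \<le> s * (1 + e) + s / 2 * d + (1 - s) / 2 * 1"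
      using s by (intro add_mono mult_left_mono 1 d u) auto
    also have "\<dots> = s * (1 + 2 * e + d) / 2 + 1 / 2"
      by (simp add: field_simps)
    also have "\<dots> = 1"
      using d0 e by (simp add: s_def)
    finally show ?thesis
      by (simp add: mnorm_le_1_iff[OF M])
  qed
  have "a /\<^sub>R (1 + 2 * e + d) = s *\<^sub>R a"
    by (simp add: s_def inverse_eq_divide)
  moreover have "s *\<^sub>R a + u /\<^sub>R 2 \<in> M"
    using key[of 1] by (simp only: scaleR_one simp_thms)
  moreover have "s *\<^sub>R a - u /\<^sub>R 2 \<in> M"
    using key[of "-1"] by (simp only: scaleR_minus1_left add_uminus_conv_diff simp_thms)
  ultimately show ?thesis by (simp only: lens_def mem_Collect_eq simp_thms)
qed

lemma per_lens_compare:
  assumes M: "M \<in> M2" and u: "mnorm M u \<le> 1" and u': "mnorm M u' \<le> 1"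
  shows "per M (lens M u') \<le> (1 + mnorm M (u - u')) * per M (lens M u)"
proof (rule per_mono_scale[OF M lens_convex_body[OF M u'] lens_convex_body[OF M u]])
  show "0 < 1 + mnorm M (u - u')"
    using mnorm_nonneg[OF M, of "u - u'"] by linarith
  fix a assume "a \<in> lens M u'"
  then show "a /\<^sub>R (1 + mnorm M (u - u')) \<in> lens M u"
    using lens_compare[OF M order_refl, of M u u' "mnorm M (u - u')" a] u
    by (simp add: mnorm_le_1_iff[OF M])
qed

lemma lens_subset: "M \<in> M2 \<Longrightarrow> lens M u \<subseteq> M"
proof
  fix a assume M: "M \<in> M2" and a: "a \<in> lens M u"
  then have "(1/2) *\<^sub>R (a + u /\<^sub>R 2) + (1/2) *\<^sub>R (a - u /\<^sub>R 2) \<in> M"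
    by (intro convexD[OF M2D(4)[OF M]]) (auto simp: lens_def)
  also have "(1/2) *\<^sub>R (a + u /\<^sub>R 2) + (1/2) *\<^sub>R (a - u /\<^sub>R 2) = a"
    by (simp add: vec2_eq_iff field_simps)
  finally show "a \<in> M" .
qed

text \<open>Comparing two lenses in both directions yields a Lipschitz estimate; \<open>B\<close>
  dominates all lens perimeters because every lens is contained in \<open>M\<close>.\<close>

lemma per_lens_continuous:
  assumes M: "M \<in> M2"
  shows "continuous_on {u. mnorm M u = 1} (\<lambda>u. per M (lens M u))"
proof -
  obtain c C where C: "0 < c" "0 < C" "\<And>x. c * norm x \<le> mnorm M x" "\<And>x. mnorm M x \<le> C * norm x"
    using mnorm_equiv_norm[OF M] by blast
  define B where "B = per M M"
  have B: "B \<ge> 0" unfolding B_def by (rule per_nonneg[OF M M2_convex_body[OF M]])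
  have le: "per M (lens M u') - per M (lens M u) \<le> C * B * norm (u - u')"
    if u: "mnorm M u = 1" "mnorm M u' = 1" for u u'
  proof -
    have "per M (lens M u') - per M (lens M u) \<le> mnorm M (u - u') * per M (lens M u)"
      using per_lens_compare[OF M, of u u'] u by (simp add: algebra_simps)
    also have "\<dots> \<le> (C * norm (u - u')) * B"
      unfolding B_def using u mnorm_nonneg[OF M]
      by (intro mult_mono C per_mono M lens_convex_body M2_convex_body lens_subset per_nonneg) (auto simp: C less_imp_le)
    finally show ?thesis by (simp add: mult_ac)
  qed
  have "(C * B)-lipschitz_on {u. mnorm M u = 1} (\<lambda>u. per M (lens M u))"
  proof (rule lipschitz_onI)
    fix u u' assume "u \<in> {u. mnorm M u = 1}" "u' \<in> {u. mnorm M u = 1}"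
    then show "dist (per M (lens M u)) (per M (lens M u')) \<le> C * B * dist u u'"
      using le[of u u'] le[of u' u] norm_minus_commute[of u u']
      unfolding dist_norm real_norm_def abs_le_iff by simp
  qed (use C B in simp)
  then show ?thesis by (rule lipschitz_on_continuous_on)
qed

lemma unit_sphere_compact:
  assumes M: "M \<in> M2"
  shows "compact {u. mnorm M u = 1}" "{u. mnorm M u = 1} \<noteq> {}"
proof -
  have "closed {u. mnorm M u = 1}"
    by (intro closed_Collect_eq continuous_intros mnorm_continuous[OF M])
  moreover have "{u. mnorm M u = 1} \<subseteq> M"
    by (simp add: subset_iff mnorm_le_1_iff[OF M, symmetric])
  then have "bounded {u. mnorm M u = 1}"
    using M2D(3)[OF M] bounded_subset by blast
  ultimately show "compact {u. mnorm M u = 1}"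
    by (simp add: compact_eq_bounded_closed)
  show "{u. mnorm M u = 1} \<noteq> {}"
    using mnorm_normalize[OF M edir_nonzero] by blast
qed

lemma L_values_min_exists:
  assumes M: "M \<in> M2"
  shows "\<exists>m. is_min (L_values M) m"
proof -
  obtain u where "mnorm M u = 1" "\<And>w. mnorm M w = 1 \<Longrightarrow> per M (lens M u) \<le> per M (lens M w)"
    using continuous_attains_inf[OF unit_sphere_compact[OF M] per_lens_continuous[OF M]] by auto
  then show ?thesis
    unfolding is_min_L_values_iff[OF M] by blast
qed

lemma L_values_max_exists:
  assumes M: "M \<in> M2"
  shows "\<exists>m. is_max (L_values M) m"
proof -
  obtain u where "mnorm M u = 1" "\<And>w. mnorm M w = 1 \<Longrightarrow> per M (lens M w) \<le> per M (lens M u)"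
    using continuous_attains_sup[OF unit_sphere_compact[OF M] per_lens_continuous[OF M]] by auto
  then show ?thesis
    unfolding is_max_L_values_iff[OF M] by blast
qed

section \<open>Upper and lower bounds for the perimeter of a single lens\<close>

lemma supp_lens_le:
  assumes M: "M \<in> M2" and u: "mnorm M u \<le> 1"
  shows "supp (lens M u) v \<le> supp M v - \<bar>v \<bullet> u\<bar> / 2"
proof (rule supp_le)
  show "compact (lens M u)" "lens M u \<noteq> {}"
    using convex_bodyD[OF lens_convex_body[OF M u]] by auto
  fix a assume "a \<in> lens M u"
  then have "v \<bullet> (a + u /\<^sub>R 2) \<le> supp M v" "v \<bullet> (a - u /\<^sub>R 2) \<le> supp M v"
    by (auto simp: lens_def intro: supp_ge M2D[OF M])
  then show "v \<bullet> a \<le> supp M v - \<bar>v \<bullet> u\<bar> / 2"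
    by (simp add: inner_add_right inner_diff_right abs_if)
qed

lemma lens_minus: "lens M (- u) = lens M u"
  by (auto simp: lens_def)

text \<open>The sum of the lens and the segment from -u/2 to u/2 lies in \<open>M\<close>. In
  direction \<open>v\<close> the segment has width \<open>\<bar>v \<bullet> u\<bar>\<close>, so its
  contribution to the perimeter is \<open>2 * mnorm M u\<close>.\<close>

lemma per_lens_le:
  assumes M: "M \<in> M2" and u: "mnorm M u \<le> 1"
  shows "per M (lens M u) \<le> per M M - 2 * mnorm M u"
proof -
  note B = lens_convex_body[OF M u] M2_convex_body[OF M]
  obtain n \<phi> where s: "\<And>k x. znorm (n k) (\<phi> k) x \<le> mnorm M x"
    "\<And>x. (\<lambda>k. znorm (n k) (\<phi> k) x) \<longlonglongrightarrow> mnorm M x"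
    "\<And>K. convex_body K \<Longrightarrow> (\<lambda>k. zperim (n k) (\<phi> k) K) \<longlonglongrightarrow> per M K"
    by (rule zapprox_seq[OF M]) (rule that; assumption)
  have "zperim n \<phi> (lens M u) \<le> zperim n \<phi> M - 2 * znorm n \<phi> u" for n \<phi>
  proof -
    have "width (lens M u) v \<le> width M v - \<bar>v \<bullet> u\<bar>" for v
      using supp_lens_le[OF M u, of v] supp_lens_le[OF M u, of "- v"] by (simp add: width_def)
    then have "(\<Sum>j<n. width (lens M u) (\<phi> j)) \<le> (\<Sum>j<n. width M (\<phi> j) - \<bar>\<phi> j \<bullet> u\<bar>)"
      by (intro sum_mono)
    then show ?thesis by (simp add: zperim_def znorm_def sum_subtractf)
  qed
  moreover have "(\<lambda>k. zperim (n k) (\<phi> k) M - 2 * znorm (n k) (\<phi> k) u) \<longlonglongrightarrow> per M M - 2 * mnorm M u"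
    by (intro tendsto_intros s B)
  ultimately show ?thesis
    by (intro LIMSEQ_le[OF s(3)[OF B(1)]]) auto
qed

text \<open>The four points span the parallelogram with half-sides \<open>a\<close> and
  \<open>b\<close>. Its support function is the sum of those of two segments, which makes the
  perimeter additive in the half-sides.\<close>

lemma per_ge_parallelogram:
  assumes M: "M \<in> M2" and K: "convex_body K"
    and sub: "a + b \<in> K" "a - b \<in> K" "- a + b \<in> K" "- a - b \<in> K"
  shows "4 * (mnorm M a + mnorm M b) \<le> per M K"
proof -
  obtain n \<phi> where s: "\<And>k x. znorm (n k) (\<phi> k) x \<le> mnorm M x"
    "\<And>x. (\<lambda>k. znorm (n k) (\<phi> k) x) \<longlonglongrightarrow> mnorm M x"
    "\<And>K. convex_body K \<Longrightarrow> (\<lambda>k. zperim (n k) (\<phi> k) K) \<longlonglongrightarrow> per M K"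
    by (rule zapprox_seq[OF M]) (rule that; assumption)
  have "4 * (znorm n \<phi> a + znorm n \<phi> b) \<le> zperim n \<phi> K" for n \<phi>
  proof -
    have supp: "\<bar>v \<bullet> a\<bar> + \<bar>v \<bullet> b\<bar> \<le> supp K v" for v
    proof -
      note ge = supp_ge[OF convex_bodyD(1)[OF K]]
      have "v \<bullet> a + v \<bullet> b \<le> supp K v" "v \<bullet> a - v \<bullet> b \<le> supp K v"
        "- (v \<bullet> a) + v \<bullet> b \<le> supp K v" "- (v \<bullet> a) - v \<bullet> b \<le> supp K v"
        using ge[OF sub(1), of v] ge[OF sub(2), of v] ge[OF sub(3), of v] ge[OF sub(4), of v]
        by (simp_all only: inner_add_right inner_diff_right inner_minus_right)
      then show ?thesis by linarith
    qed
    have "2 * (\<bar>v \<bullet> a\<bar> + \<bar>v \<bullet> b\<bar>) \<le> width K v" for v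
      using supp[of v] supp[of "- v"] by (simp add: width_def)
    then have "(\<Sum>j<n. 2 * (\<bar>\<phi> j \<bullet> a\<bar> + \<bar>\<phi> j \<bullet> b\<bar>)) \<le> (\<Sum>j<n. width K (\<phi> j))"
      by (intro sum_mono)
    then show ?thesis
      by (simp add: zperim_def znorm_def sum.distrib flip: sum_distrib_left)
  qed
  moreover have "(\<lambda>k. 4 * (znorm (n k) (\<phi> k) a + znorm (n k) (\<phi> k) b)) \<longlonglongrightarrow> 4 * (mnorm M a + mnorm M b)"
    by (intro tendsto_intros s)
  ultimately show ?thesis
    by (intro LIMSEQ_le[OF _ s(3)[OF K]]) auto
qed

text \<open>The hypothesis places \<open>K\<close> in a hexagon that is a sum of three segments,
  whose perimeter is again additive. Parallelograms are obtained with \<open>c = 0\<close>.\<close>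

lemma per_le_zonogon:
  assumes M: "M \<in> M2" and K: "convex_body K"
    and sub: "\<And>x. x \<in> K \<Longrightarrow> \<exists>\<kappa> \<mu> \<nu>. \<bar>\<kappa>\<bar> \<le> 1 \<and> \<bar>\<mu>\<bar> \<le> 1 \<and> \<bar>\<nu>\<bar> \<le> 1 \<and> x = \<kappa> *\<^sub>R a + \<mu> *\<^sub>R b + \<nu> *\<^sub>R c"
  shows "per M K \<le> 4 * (mnorm M a + mnorm M b + mnorm M c)"
proof (rule per_least[OF M K])
  fix n \<phi> assume z: "\<And>x. znorm n \<phi> x \<le> mnorm M x"
  have supp: "supp K v \<le> \<bar>v \<bullet> a\<bar> + \<bar>v \<bullet> b\<bar> + \<bar>v \<bullet> c\<bar>" for v
  proof (rule supp_le[OF convex_bodyD(1,6)[OF K]])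
    fix x assume "x \<in> K"
    then obtain \<kappa> \<mu> \<nu> where l: "\<bar>\<kappa>\<bar> \<le> 1" "\<bar>\<mu>\<bar> \<le> 1" "\<bar>\<nu>\<bar> \<le> 1" and x: "x = \<kappa> *\<^sub>R a + \<mu> *\<^sub>R b + \<nu> *\<^sub>R c"
      using sub by blast
    have m: "t * y \<le> \<bar>y\<bar>" if "\<bar>t\<bar> \<le> 1" for t y :: real
      using mult_right_mono[OF that abs_ge_zero[of y]] by (simp add: abs_le_iff flip: abs_mult)
    show "v \<bullet> x \<le> \<bar>v \<bullet> a\<bar> + \<bar>v \<bullet> b\<bar> + \<bar>v \<bullet> c\<bar>"
      unfolding x inner_add_right inner_scaleR_right by (intro add_mono m l)
  qed
  have "width K v \<le> 2 * (\<bar>v \<bullet> a\<bar> + \<bar>v \<bullet> b\<bar> + \<bar>v \<bullet> c\<bar>)" for v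
    using supp[of v] supp[of "- v"] by (simp add: width_def)
  then have "(\<Sum>j<n. width K (\<phi> j)) \<le> (\<Sum>j<n. 2 * (\<bar>\<phi> j \<bullet> a\<bar> + \<bar>\<phi> j \<bullet> b\<bar> + \<bar>\<phi> j \<bullet> c\<bar>))"
    by (intro sum_mono)
  then have "zperim n \<phi> K \<le> 4 * (znorm n \<phi> a + znorm n \<phi> b + znorm n \<phi> c)"
    by (simp add: zperim_def znorm_def sum.distrib flip: sum_distrib_left)
  also have "\<dots> \<le> 4 * (mnorm M a + mnorm M b + mnorm M c)"
    by (intro mult_left_mono add_mono z) auto
  finally show "zperim n \<phi> K \<le> 4 * (mnorm M a + mnorm M b + mnorm M c)" .
qed

definition det2 :: "real^2 \<Rightarrow> real^2 \<Rightarrow> real" where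
  "det2 x y = x $ 1 * y $ 2 - x $ 2 * y $ 1"

lemma det2_cramer: "det2 a b *\<^sub>R x = det2 x b *\<^sub>R a + det2 a x *\<^sub>R b"
  by (simp add: vec2_eq_iff det2_def algebra_simps)

lemma det2_expand:
  assumes "det2 a b \<noteq> 0"
  shows "x = (det2 x b / det2 a b) *\<^sub>R a + (det2 a x / det2 a b) *\<^sub>R b"
proof -
  have "x = (1 / det2 a b) *\<^sub>R (det2 a b *\<^sub>R x)"
    using assms by simp
  also have "\<dots> = (1 / det2 a b) *\<^sub>R (det2 x b *\<^sub>R a + det2 a x *\<^sub>R b)"
    by (rule arg_cong[OF det2_cramer])
  also have "\<dots> = (det2 x b / det2 a b) *\<^sub>R a + (det2 a x / det2 a b) *\<^sub>R b"
    by (simp add: scaleR_add_right)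
  finally show ?thesis .
qed

text \<open>A pair of points of \<open>M\<close> with maximal determinant. Replacing one of them by
  \<open>x\<close> cannot increase the determinant, which by Cramer's rule bounds the coordinates of
  every point of \<open>M\<close> by 1.\<close>

lemma auerbach_basis:
  assumes M: "M \<in> M2"
  obtains a b where "a \<in> M" "b \<in> M" "det2 a b > 0"
    "\<And>x. x \<in> M \<Longrightarrow> \<bar>det2 x b\<bar> \<le> det2 a b" "\<And>x. x \<in> M \<Longrightarrow> \<bar>det2 a x\<bar> \<le> det2 a b"
proof -
  have comp: "compact (M \<times> M)" and ne: "M \<times> M \<noteq> {}"
    using M2D(1)[OF M] M2_zero[OF M] by (auto intro: compact_Times)
  have "continuous_on (M \<times> M) (\<lambda>p. det2 (fst p) (snd p))"
    unfolding det2_def by (intro continuous_intros)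
  from continuous_attains_sup[OF comp ne this] obtain p where p: "p \<in> M \<times> M"
    "\<forall>y\<in>M \<times> M. det2 (fst y) (snd y) \<le> det2 (fst p) (snd p)" by blast
  define a b where "a = fst p" and "b = snd p"
  have ab: "a \<in> M" "b \<in> M" "\<And>x y. x \<in> M \<Longrightarrow> y \<in> M \<Longrightarrow> det2 x y \<le> det2 a b"
    using p by (auto simp: a_def b_def)
  obtain r where r: "r > 0" "cball 0 r \<subseteq> M"
    using M2_zero_interior[OF M] by (meson mem_interior_cball)
  have "r *\<^sub>R edir 0 \<in> M" "r *\<^sub>R edir (pi/2) \<in> M"
    using r by (auto simp: subset_iff)
  from ab(3)[OF this] have "r * r \<le> det2 a b"
    by (simp add: det2_def)
  then have pos: "det2 a b > 0"
    using mult_pos_pos[OF r(1) r(1)] by linarith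
  have neg: "det2 (- x) y = - det2 x y" "det2 x (- y) = - det2 x y" for x y
    by (simp_all add: det2_def)
  show thesis
  proof (rule that[OF ab(1,2) pos])
    show "\<bar>det2 x b\<bar> \<le> det2 a b" if "x \<in> M" for x
      using ab(3)[OF that ab(2)] ab(3)[of "- x" b] that ab(2) M2_uminus[OF M, of x] by (simp add: neg abs_le_iff)
    show "\<bar>det2 a x\<bar> \<le> det2 a b" if "x \<in> M" for x
      using ab(3)[OF ab(1) that] ab(3)[of a "- x"] that ab(1) M2_uminus[OF M, of x] by (simp add: neg abs_le_iff)
  qed
qed

lemma per_unit_ball_le:
  assumes M: "M \<in> M2"
  shows "per M M \<le> 8"
proof -
  obtain a b where ab: "a \<in> M" "b \<in> M" "det2 a b > 0"
    "\<And>x. x \<in> M \<Longrightarrow> \<bar>det2 x b\<bar> \<le> det2 a b" "\<And>x. x \<in> M \<Longrightarrow> \<bar>det2 a x\<bar> \<le> det2 a b"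
    using auerbach_basis[OF M] by metis
  have "per M M \<le> 4 * (mnorm M a + mnorm M b + mnorm M 0)"
  proof (rule per_le_zonogon[OF M M2_convex_body[OF M]])
    fix x assume x: "x \<in> M"
    have "x = (det2 x b / det2 a b) *\<^sub>R a + (det2 a x / det2 a b) *\<^sub>R b + 0 *\<^sub>R 0"
      using det2_expand[of a b x] ab(3) by simp
    moreover have "\<bar>det2 x b / det2 a b\<bar> \<le> 1" "\<bar>det2 a x / det2 a b\<bar> \<le> 1"
      using ab(3) ab(4,5)[OF x] by (simp_all add: divide_le_eq)
    ultimately show "\<exists>\<kappa> \<mu> \<nu>. \<bar>\<kappa>\<bar> \<le> 1 \<and> \<bar>\<mu>\<bar> \<le> 1 \<and> \<bar>\<nu>\<bar> \<le> 1 \<and> x = \<kappa> *\<^sub>R a + \<mu> *\<^sub>R b + \<nu> *\<^sub>R 0"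
      by (metis abs_zero zero_le_one)
  qed
  moreover have "mnorm M a \<le> 1" "mnorm M b \<le> 1"
    using ab mnorm_le_1_iff[OF M] by auto
  ultimately show ?thesis
    by (simp add: mnorm_zero[OF M])
qed

lemma per_lens_le_6:
  assumes "M \<in> M2" "mnorm M u = 1"
  shows "per M (lens M u) \<le> 6"
  using per_lens_le[of M u] per_unit_ball_le[of M] assms by simp

text \<open>Along a half circle from \<open>u\<close> to \<open>- u\<close> the distance to
  \<open>u\<close> varies continuously from 0 to 2, hence takes the value 1.\<close>

lemma unit_triangle_exists:
  assumes M: "M \<in> M2" and u: "mnorm M u = 1"
  obtains x where "mnorm M x = 1" "mnorm M (x - u) = 1"
proof -
  obtain r t where t: "u = r *\<^sub>R edir t"
    using polar_half[of 0 u] by metis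
  define e where "e s = edir s /\<^sub>R mnorm M (edir s)" for s
  have pos: "mnorm M (edir s) > 0" for s
    by (rule mnorm_pos[OF M edir_nonzero])
  have e1: "mnorm M (e s) = 1" for s
    unfolding e_def by (rule mnorm_normalize[OF M edir_nonzero])
  have r: "\<bar>r\<bar> * mnorm M (edir t) = 1"
    using u by (simp add: t mnorm_scale[OF M])
  \<comment> \<open>A negative \<open>r\<close> makes \<open>u\<close> the end of the parametrized
    half circle instead of its start, whence the two cases of the intermediate value argument
    below.\<close>
  have ue: "u = (if r > 0 then e t else - e t)"
  proof -
    have "inverse (mnorm M (edir t)) = \<bar>r\<bar>"
      using r by (metis inverse_unique mult.commute)
    then show ?thesis by (auto simp: t e_def)
  qed
  have epi: "e (t + pi) = - e t"
    by (simp add: e_def mnorm_minus[OF M])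
  have cont_edir: "continuous_on S edir" for S
    by (rule lipschitz_on_continuous_on[of 2], rule lipschitz_onI)
       (use norm_edir_diff in \<open>simp_all add: dist_norm\<close>)
  have cont: "continuous_on {t..t+pi} (\<lambda>s. mnorm M (e s - u))"
    unfolding e_def using pos
    by (intro continuous_on_compose2[OF mnorm_continuous[OF M, of UNIV]] continuous_intros cont_edir) (auto simp: less_imp_neq[symmetric])
  have two: "mnorm M (2 *\<^sub>R e t) = 2" "mnorm M (- 2 *\<^sub>R e t) = 2"
    using e1 by (simp_all add: mnorm_scale[OF M] mnorm_minus[OF M])
  have "\<exists>s. mnorm M (e s - u) = 1"
  proof (cases "r > 0")
    case True
    then have "mnorm M (e t - u) \<le> 1" "1 \<le> mnorm M (e (t + pi) - u)"
      using ue two by (simp_all add: mnorm_zero[OF M] epi scaleR_2)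
    then show ?thesis
      using IVT'[OF _ _ _ cont, of 1] by auto
  next
    case False
    then have "mnorm M (e (t + pi) - u) \<le> 1" "1 \<le> mnorm M (e t - u)"
      using ue two by (simp_all add: mnorm_zero[OF M] epi scaleR_2)
    then show ?thesis
      using IVT2'[OF _ _ _ cont, of 1] by auto
  qed
  then show thesis using that e1 by blast
qed

lemma per_lens_ge_4:
  assumes M: "M \<in> M2" and u: "mnorm M u = 1"
  shows "4 \<le> per M (lens M u)"
proof -
  obtain x where x: "mnorm M x = 1" "mnorm M (x - u) = 1"
    using unit_triangle_exists[OF M u] by metis
  have mem: "y \<in> M \<longleftrightarrow> mnorm M y \<le> 1" for y
    by (simp add: mnorm_le_1_iff[OF M])
  \<comment> \<open>With half-sides x/2 and (x - u)/2 the vertices are x - u/2, u/2 and their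
    antipodes. Shifted by u/2 either way they become 0, u, x, x - u up to sign, all of norm at most
    1.\<close>
  have eqs: "x /\<^sub>R 2 + (x - u) /\<^sub>R 2 + u /\<^sub>R 2 = x" "x /\<^sub>R 2 + (x - u) /\<^sub>R 2 - u /\<^sub>R 2 = x - u"
    "x /\<^sub>R 2 - (x - u) /\<^sub>R 2 + u /\<^sub>R 2 = u" "x /\<^sub>R 2 - (x - u) /\<^sub>R 2 - u /\<^sub>R 2 = 0"
    "- (x /\<^sub>R 2) + (x - u) /\<^sub>R 2 + u /\<^sub>R 2 = 0" "- (x /\<^sub>R 2) + (x - u) /\<^sub>R 2 - u /\<^sub>R 2 = - u"
    "- (x /\<^sub>R 2) - (x - u) /\<^sub>R 2 + u /\<^sub>R 2 = - (x - u)" "- (x /\<^sub>R 2) - (x - u) /\<^sub>R 2 - u /\<^sub>R 2 = - x"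
    by (simp_all add: vec2_eq_iff field_simps)
  have "4 * (mnorm M (x /\<^sub>R 2) + mnorm M ((x - u) /\<^sub>R 2)) \<le> per M (lens M u)"
    using x u
    by (intro per_ge_parallelogram[OF M lens_convex_body[OF M]])
       (simp_all only: lens_def mem_Collect_eq eqs mem mnorm_minus[OF M] mnorm_zero[OF M] order_refl zero_le_one simp_thms)
  then show ?thesis
    using x by (simp add: mnorm_scale[OF M])
qed

section \<open>Three lenses belonging to a unit triangle\<close>

lemma det2_unit_triangle:
  assumes M: "M \<in> M2" and "mnorm M p = 1" "mnorm M q = 1" "mnorm M (p - q) = 1"
  shows "det2 p q \<noteq> 0"
proof
  assume 0: "det2 p q = 0"
  have "p \<noteq> 0" using assms mnorm_zero[OF M] by force
  have "(p \<bullet> p) *\<^sub>R q = (p \<bullet> q) *\<^sub>R p"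
    using 0 by (simp add: vec2_eq_iff det2_def inner_vec2) algebra
  then have q: "q = (p \<bullet> q / (p \<bullet> p)) *\<^sub>R p"
    using \<open>p \<noteq> 0\<close> by (metis divide_inverse inner_eq_zero_iff mult.commute right_inverse scaleR_one scaleR_scaleR)
  \<comment> \<open>If \<open>p\<close> and \<open>q\<close> were parallel, the conditions would
    read \<open>\<bar>c\<bar> = 1\<close> and \<open>\<bar>1 - c\<bar> = 1\<close>, which no real
    number satisfies.\<close>
  define c where "c = p \<bullet> q / (p \<bullet> p)"
  have qc: "q = c *\<^sub>R p" using q by (simp add: c_def)
  then have "\<bar>c\<bar> = 1" using assms by (simp add: mnorm_scale[OF M])
  moreover have "p - q = (1 - c) *\<^sub>R p" using qc by (simp add: algebra_simps)
  then have "\<bar>1 - c\<bar> = 1" using assms by (simp add: mnorm_scale[OF M])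
  ultimately show False by auto
qed

text \<open>With \<open>z\<close> a point of \<open>M\<close> furthest in direction \<open>v\<close>: if \<open>z\<close> lies in the sector spanned by the
  hexagon vertices \<open>p\<close> and \<open>q\<close>, then the lens for \<open>p - q\<close> is cut off in direction \<open>v\<close> at its vertex
  \<open>(p + q)/2\<close>, because the chord \<open>[q, p]\<close> cannot be moved parallel to itself further away from 0.\<close>

lemma lens_vertex_bound:
  assumes M: "M \<in> M2" and p: "mnorm M p = 1" and q: "mnorm M q = 1" and pq: "mnorm M (p - q) = 1"
    and z: "z \<in> M" "\<And>y. y \<in> M \<Longrightarrow> v \<bullet> y \<le> v \<bullet> z" and zpq: "z = \<alpha> *\<^sub>R p + \<beta> *\<^sub>R q" "\<alpha> \<ge> 0" "\<beta> \<ge> 0"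
    and vpq: "v \<bullet> q \<le> v \<bullet> p"
    and c: "c \<in> M" "c - (p - q) \<in> M"
  shows "v \<bullet> c \<le> v \<bullet> p"
proof (cases "v = 0")
  case False
  have mem: "y \<in> M \<longleftrightarrow> mnorm M y \<le> 1" for y
    by (simp add: mnorm_le_1_iff[OF M])
  have "v \<bullet> z > 0"
  proof -
    have "mnorm M v > 0" by (rule mnorm_pos[OF M False])
    then have "v \<bullet> (v /\<^sub>R mnorm M v) > 0" using False by simp
    moreover have "v /\<^sub>R mnorm M v \<in> M" using mnorm_normalize[OF M False] mem by simp
    ultimately show ?thesis using z(2) by fastforce
  qed
  \<comment> \<open>A maximizer of a nonzero functional has norm 1, while the coordinates of
    \<open>z\<close> bound its norm by \<alpha> + \<beta>.\<close>
  have h: "\<alpha> + \<beta> \<ge> 1"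
  proof (rule ccontr)
    assume "\<not> ?thesis"
    moreover have "mnorm M z \<le> \<alpha> + \<beta>"
      using mnorm_triangle[OF M, of "\<alpha> *\<^sub>R p" "\<beta> *\<^sub>R q"] zpq p q by (simp add: mnorm_scale[OF M])
    ultimately have l: "mnorm M z < 1" by simp
    have nz: "z \<noteq> 0" using \<open>v \<bullet> z > 0\<close> by auto
    then have "z /\<^sub>R mnorm M z \<in> M" using mnorm_normalize[OF M nz] mem by simp
    then have "v \<bullet> z / mnorm M z \<le> v \<bullet> z" using z(2)[of "z /\<^sub>R mnorm M z"] by (simp add: divide_inverse mult.commute)
    then show False
      using l \<open>v \<bullet> z > 0\<close> mnorm_pos[OF M nz] by (simp add: divide_le_eq)
  qed
  have "det2 p q \<noteq> 0" by (rule det2_unit_triangle[OF M p q pq])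
  then obtain a b where ab: "c = a *\<^sub>R p + b *\<^sub>R q"
    using det2_expand by blast
  \<comment> \<open>The chord from \<open>c - (p - q)\<close> to \<open>c\<close> cannot lie beyond
    the line through \<open>p\<close> and \<open>q\<close>. If a + b > 1 and b < 0, the first of the
    three triangle inequalities fails; if b \<ge> 0, the third gives a \<le> 1 and then the second
    gives a + b \<le> 1.\<close>
  have t: "a + b \<le> 1"
  proof (rule ccontr)
    assume "\<not> ?thesis"
    then have t1: "a + b > 1" by simp
    have "\<bar>a\<bar> \<le> 1 + \<bar>b\<bar>"
    proof -
      have "a *\<^sub>R p = c - b *\<^sub>R q" using ab by simp
      then have "\<bar>a\<bar> = mnorm M (c - b *\<^sub>R q)"
        using mnorm_scale[OF M, of a p] p by simp
      then show ?thesis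
        using mnorm_triangle_diff[OF M, of c "b *\<^sub>R q"] c(1) q by (simp add: mem mnorm_scale[OF M])
    qed
    moreover have "\<bar>b + 1\<bar> \<le> 1 + \<bar>a - 1\<bar>"
    proof -
      have "(b + 1) *\<^sub>R q = (c - (p - q)) - (a - 1) *\<^sub>R p" using ab by (simp add: algebra_simps)
      then have "\<bar>b + 1\<bar> = mnorm M ((c - (p - q)) - (a - 1) *\<^sub>R p)"
        using mnorm_scale[OF M, of "b + 1" q] q by simp
      then show ?thesis
        using mnorm_triangle_diff[OF M, of "c - (p - q)" "(a - 1) *\<^sub>R p"] c(2) mnorm_scale[OF M, of "a - 1" p] p
        unfolding mem by simp
    qed
    moreover have "\<bar>a + b\<bar> \<le> 1 + \<bar>b\<bar>"
    proof -
      have "(a + b) *\<^sub>R p = c + b *\<^sub>R (p - q)" using ab by (simp add: algebra_simps)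
      then have "\<bar>a + b\<bar> = mnorm M (c + b *\<^sub>R (p - q))"
        using mnorm_scale[OF M, of "a + b" p] p by simp
      then show ?thesis
        using mnorm_triangle[OF M, of c "b *\<^sub>R (p - q)"] c(1) mnorm_scale[OF M, of b "p - q"] pq
        unfolding mem by simp
    qed
    ultimately show False using t1 by (simp add: abs_if split: if_splits)
  qed
  show ?thesis
  proof (cases "\<alpha> + \<beta> = 1")
    case True
    then have \<alpha>: "\<alpha> = 1 - \<beta>" by simp
    have "v \<bullet> c \<le> v \<bullet> z" using z(2) c(1) by simp
    also have "v \<bullet> z = v \<bullet> p - \<beta> * (v \<bullet> p - v \<bullet> q)"
      by (simp add: zpq(1) inner_add_right \<alpha> algebra_simps)
    also have "\<dots> \<le> v \<bullet> p" using zpq(3) vpq by simp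
    finally show ?thesis .
  next
    case False
    define h where "h = \<alpha> + \<beta>"
    \<comment> \<open>Chosen so that the point \<open>w\<close> of the segment from \<open>c\<close>
      to \<open>z\<close> lies on the line through \<open>p\<close> and \<open>q\<close>, where the
      coordinates add up to 1.\<close>
    define l where "l = (1 - (a + b)) / (h - (a + b))"
    have h1: "h > 1" using h False by (simp add: h_def)
    have l: "0 \<le> l" "l \<le> 1" using h1 t by (auto simp: l_def divide_simps)
    define w where "w = (1 - l) *\<^sub>R c + l *\<^sub>R z"
    have wM: "w \<in> M"
      unfolding w_def using convexD_alt[OF M2D(4)[OF M] c(1) z(1)] l by simp
    define s where "s = (1 - l) * a + l * \<alpha> - 1"
    have "l * (h - (a + b)) = 1 - (a + b)"
      using h1 t by (simp add: l_def)
    then have "(1 - l) * (a + b) + l * h = 1"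
      by (simp add: algebra_simps)
    then have sb: "(1 - l) * b + l * \<beta> = - s"
      by (simp add: s_def h_def algebra_simps)
    have sa: "(1 - l) * a + l * \<alpha> = 1 + s"
      by (simp add: s_def)
    have "w = ((1 - l) * a + l * \<alpha>) *\<^sub>R p + ((1 - l) * b + l * \<beta>) *\<^sub>R q"
      by (simp add: w_def ab zpq(1) algebra_simps)
    then have w: "w = (1 + s) *\<^sub>R p - s *\<^sub>R q"
      unfolding sa sb by simp
    \<comment> \<open>If \<open>w\<close> lay beyond \<open>p\<close> on that line, a multiple of
      \<open>p\<close> with factor greater than 1 would be a convex combination of \<open>z\<close>
      and \<open>w\<close>, so \<open>p\<close> would have norm below 1.\<close>
    have "s \<le> 0"
    proof (rule ccontr)
      assume "\<not> ?thesis"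
      then have s: "s > 0" by simp
      have "(s * \<alpha> + \<beta> * (1 + s)) *\<^sub>R p = s *\<^sub>R z + \<beta> *\<^sub>R w"
        by (simp add: w zpq(1) algebra_simps)
      then have "\<bar>s * \<alpha> + \<beta> * (1 + s)\<bar> = mnorm M (s *\<^sub>R z + \<beta> *\<^sub>R w)"
        using p mnorm_scale[OF M, of "s * \<alpha> + \<beta> * (1 + s)" p] by simp
      also have "\<dots> \<le> s * mnorm M z + \<beta> * mnorm M w"
        using mnorm_triangle[OF M, of "s *\<^sub>R z" "\<beta> *\<^sub>R w"] s zpq(3) by (simp add: mnorm_scale[OF M])
      also have "\<dots> \<le> s * 1 + \<beta> * 1"
        using z(1) wM s zpq(3) mem by (intro add_mono mult_left_mono) auto
      finally have "s * h \<le> s" by (simp add: h_def algebra_simps)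
      then show False using s h1 by simp
    qed
    have "v \<bullet> c \<le> v \<bullet> w"
    proof -
      have "v \<bullet> w = v \<bullet> c + l * (v \<bullet> z - v \<bullet> c)"
        by (simp add: w_def inner_add_right algebra_simps)
      then show ?thesis using l(1) z(2)[OF c(1)] by simp
    qed
    also have "v \<bullet> w = v \<bullet> p + s * (v \<bullet> p - v \<bullet> q)"
      by (simp add: w inner_diff_right algebra_simps)
    also have "\<dots> \<le> v \<bullet> p"
      using \<open>s \<le> 0\<close> vpq by (simp add: mult_nonpos_nonneg)
    finally show ?thesis .
  qed
qed simp

text \<open>The vertex (p + q)/2 bounds the support function of the lens for \<open>p - q\<close>.
  This amount is compensated by the losses \<open>\<bar>v \<bullet> p\<bar> / 2\<close> and
  \<open>\<bar>v \<bullet> q\<bar> / 2\<close> of the other two lenses.\<close>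

lemma supp_three_lenses_sector:
  assumes M: "M \<in> M2" and p: "mnorm M p = 1" and q: "mnorm M q = 1" and pq: "mnorm M (p - q) = 1"
    and z: "z \<in> M" "\<And>y. y \<in> M \<Longrightarrow> v \<bullet> y \<le> v \<bullet> z" and zpq: "z = \<alpha> *\<^sub>R p + \<beta> *\<^sub>R q" "\<alpha> \<ge> 0" "\<beta> \<ge> 0"
  shows "supp (lens M (p - q)) v + supp (lens M p) v + supp (lens M q) v \<le> 2 * supp M v"
proof -
  have "supp (lens M (p - q)) v \<le> (v \<bullet> p + v \<bullet> q) / 2"
  proof (rule supp_le)
    show "compact (lens M (p - q))" "lens M (p - q) \<noteq> {}"
      using convex_bodyD[OF lens_convex_body[OF M]] pq by auto
    fix a assume a: "a \<in> lens M (p - q)"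
    define c d where "c = a + (p - q) /\<^sub>R 2" and "d = a - (p - q) /\<^sub>R 2"
    have cd: "c \<in> M" "d \<in> M" "d = c - (p - q)" "c = d - (q - p)"
    proof -
      have half: "y - X /\<^sub>R 2 = (y + X /\<^sub>R 2) - X" "y + X /\<^sub>R 2 = (y - X /\<^sub>R 2) + X" for X y :: "real^2"
        by (simp_all add: vec2_eq_iff)
      show "c \<in> M" "d \<in> M" using a by (simp_all add: lens_def c_def d_def)
      show "d = c - (p - q)" unfolding c_def d_def by (rule half)
      then show "c = d - (q - p)" by simp
    qed
    show "v \<bullet> a \<le> (v \<bullet> p + v \<bullet> q) / 2"
    \<comment> \<open>The endpoint of the chord on the side of the larger of the two values is the
      one to be bounded; the second case exchanges \<open>p\<close> and \<open>q\<close>, and with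
      them \<open>c\<close> and \<open>d\<close>.\<close>
    proof (cases "v \<bullet> q \<le> v \<bullet> p")
      case True
      have "v \<bullet> c \<le> v \<bullet> p"
        using lens_vertex_bound[OF M p q pq z zpq True cd(1)] cd(2) unfolding cd(3) by blast
      moreover have "v \<bullet> c = v \<bullet> a + (v \<bullet> p - v \<bullet> q) / 2"
        by (simp add: c_def inner_add_right inner_diff_right)
      ultimately show ?thesis by argo
    next
      case False
      have "mnorm M (q - p) = 1" using pq mnorm_minus[OF M, of "p - q"] by simp
      moreover have "z = \<beta> *\<^sub>R q + \<alpha> *\<^sub>R p" using zpq by simp
      moreover have "v \<bullet> p \<le> v \<bullet> q" using False by simp
      moreover have "d - (q - p) \<in> M" using cd(1) unfolding cd(4) .
      ultimately have "v \<bullet> d \<le> v \<bullet> q"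
        using lens_vertex_bound[OF M q p _ z _ zpq(3,2) _ cd(2)] by blast
      moreover have "v \<bullet> d = v \<bullet> a - (v \<bullet> p - v \<bullet> q) / 2"
        by (simp add: d_def inner_diff_right)
      ultimately show ?thesis by argo
    qed
  qed
  then show ?thesis
    using supp_lens_le[OF M, of p v] supp_lens_le[OF M, of q v] p q by (auto simp: abs_if split: if_splits)
qed

text \<open>The vectors u, x, x - u and their negatives cut the plane into six sectors, one of which
  contains the maximizer \<open>z\<close>. As lenses do not change under
  \<open>u \<mapsto> - u\<close>, each sector involves the same three lenses.\<close>

lemma supp_three_lenses:
  assumes M: "M \<in> M2" and u: "mnorm M u = 1" and x: "mnorm M x = 1" and xu: "mnorm M (x - u) = 1"
  shows "supp (lens M u) v + supp (lens M x) v + supp (lens M (x - u)) v \<le> 2 * supp M v"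
proof -
  have "M \<noteq> {}" using M2_zero[OF M] by blast
  then obtain z where z: "z \<in> M" "supp M v = v \<bullet> z" "\<And>y. y \<in> M \<Longrightarrow> v \<bullet> y \<le> v \<bullet> z"
    by (rule supp_attained[OF M2D(1)[OF M]]) (rule that; assumption)
  have ux: "mnorm M (u - x) = 1" using xu mnorm_minus[OF M, of "x - u"] by simp
  have "det2 x u \<noteq> 0" by (rule det2_unit_triangle[OF M x u xu])
  then obtain b a where ab: "z = b *\<^sub>R x + a *\<^sub>R u"
    using det2_expand by blast
  have neg: "lens M (u - x) = lens M (x - u)"
    using lens_minus[of M "x - u"] by simp
  have m: "mnorm M (- u) = 1" "mnorm M (- x) = 1" "mnorm M (- u - (- x)) = 1"
    "mnorm M (x - (x - u)) = 1" "mnorm M (- x - (u - x)) = 1" "mnorm M (x - u - (- u)) = 1" "mnorm M (u - x - u) = 1"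
    using u x xu by (simp_all add: mnorm_minus[OF M])
  consider (1) "a \<ge> 0" "b \<ge> 0" | (2) "a \<le> 0" "b \<le> 0" | (3) "a \<le> 0" "b \<ge> 0" "a + b \<ge> 0"
    | (4) "a \<ge> 0" "b \<le> 0" "a + b \<le> 0" | (5) "a \<le> 0" "b \<ge> 0" "a + b \<le> 0" | (6) "a \<ge> 0" "b \<le> 0" "a + b \<ge> 0"
    by linarith
  then show ?thesis
  proof cases
    case 1
    then show ?thesis
      using supp_three_lenses_sector[OF M u x ux z(1,3), of a b] ab neg by (simp add: add.commute)
  next
    case 2
    then show ?thesis
      using supp_three_lenses_sector[OF M m(1-3) z(1,3), of "- a" "- b"] ab by (simp add: lens_minus add.commute)
  next
    case 3
    have "z = (a + b) *\<^sub>R x + (- a) *\<^sub>R (x - u)" using ab by (simp add: algebra_simps)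
    from supp_three_lenses_sector[OF M x xu m(4) z(1,3) this] 3 show ?thesis by simp
  next
    case 4
    have "z = (- (a + b)) *\<^sub>R (- x) + a *\<^sub>R (u - x)" using ab by (simp add: algebra_simps)
    from supp_three_lenses_sector[OF M m(2) ux m(5) z(1,3) this] 4 show ?thesis by (simp add: lens_minus neg)
  next
    case 5
    have "z = b *\<^sub>R (x - u) + (- (a + b)) *\<^sub>R (- u)" using ab by (simp add: algebra_simps)
    from supp_three_lenses_sector[OF M xu m(1) m(6) z(1,3) this] 5 show ?thesis by (simp add: lens_minus)
  next
    case 6
    have "z = (- b) *\<^sub>R (u - x) + (a + b) *\<^sub>R u" using ab by (simp add: algebra_simps)
    from supp_three_lenses_sector[OF M ux u m(7) z(1,3) this] 6 show ?thesis by (simp add: lens_minus neg)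
  qed
qed

lemma per_three_lenses:
  assumes M: "M \<in> M2" and u: "mnorm M u = 1" and x: "mnorm M x = 1" and xu: "mnorm M (x - u) = 1"
  shows "per M (lens M u) + per M (lens M x) + per M (lens M (x - u)) \<le> 2 * per M M"
proof -
  note B = lens_convex_body[OF M, of u] lens_convex_body[OF M, of x] lens_convex_body[OF M, of "x - u"]
    M2_convex_body[OF M]
  obtain n \<phi> where "\<And>k x. znorm (n k) (\<phi> k) x \<le> mnorm M x"
    "\<And>x. (\<lambda>k. znorm (n k) (\<phi> k) x) \<longlonglongrightarrow> mnorm M x"
    and s: "\<And>K. convex_body K \<Longrightarrow> (\<lambda>k. zperim (n k) (\<phi> k) K) \<longlonglongrightarrow> per M K"
    by (rule zapprox_seq[OF M]) (rule that; assumption)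
  have "zperim n \<phi> (lens M u) + zperim n \<phi> (lens M x) + zperim n \<phi> (lens M (x - u)) \<le> 2 * zperim n \<phi> M" for n \<phi>
  proof -
    have "width (lens M u) v + width (lens M x) v + width (lens M (x - u)) v \<le> 2 * width M v" for v
      using supp_three_lenses[OF assms, of v] supp_three_lenses[OF assms, of "- v"] by (simp add: width_def)
    then have "(\<Sum>j<n. width (lens M u) (\<phi> j) + width (lens M x) (\<phi> j) + width (lens M (x - u)) (\<phi> j))
        \<le> (\<Sum>j<n. 2 * width M (\<phi> j))"
      by (intro sum_mono)
    then show ?thesis by (simp add: zperim_def sum.distrib flip: sum_distrib_left)
  qed
  moreover have "(\<lambda>k. zperim (n k) (\<phi> k) (lens M u) + zperim (n k) (\<phi> k) (lens M x) + zperim (n k) (\<phi> k) (lens M (x - u)))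
      \<longlonglongrightarrow> per M (lens M u) + per M (lens M x) + per M (lens M (x - u))"
    using u x xu by (intro tendsto_intros s B) auto
  moreover have "(\<lambda>k. 2 * zperim (n k) (\<phi> k) M) \<longlonglongrightarrow> 2 * per M M"
    by (intro tendsto_intros s B)
  ultimately show ?thesis
    using LIMSEQ_le by blast
qed

lemma short_lens_exists:
  assumes M: "M \<in> M2"
  obtains u where "mnorm M u = 1" "per M (lens M u) \<le> 16 / 3"
proof -
  obtain u where u: "mnorm M u = 1"
    using unit_sphere_compact(2)[OF M] by blast
  obtain x where x: "mnorm M x = 1" "mnorm M (x - u) = 1"
    using unit_triangle_exists[OF M u] by metis
  have "per M (lens M u) + per M (lens M x) + per M (lens M (x - u)) \<le> 16"
    using per_three_lenses[OF M u x] per_unit_ball_le[OF M] by simp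
  then consider "per M (lens M u) \<le> 16/3" | "per M (lens M x) \<le> 16/3" | "per M (lens M (x - u)) \<le> 16/3"
    by linarith
  then show thesis
    using that u x by cases blast+
qed

section \<open>Linear invariance\<close>

text \<open>Pulling the functionals back along \<open>f\<close> transports zonotopal norms and
  perimeters, since only the inner products enter.\<close>

lemma inner_adjoint_sum:
  assumes "linear (f :: real^2 \<Rightarrow> real^2)"
  shows "znorm n (\<lambda>j. adjoint f (\<phi> j)) x = znorm n \<phi> (f x)"
    and "compact K \<Longrightarrow> K \<noteq> {} \<Longrightarrow> zperim n (\<lambda>j. adjoint f (\<phi> j)) K = zperim n \<phi> (f ` K)"
proof -
  note adj = adjoint_works[OF assms]
  have "adjoint f v \<bullet> x = v \<bullet> f x" for v x
    using adj[of x v] by (simp add: inner_commute)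
  then show "znorm n (\<lambda>j. adjoint f (\<phi> j)) x = znorm n \<phi> (f x)"
    and "zperim n (\<lambda>j. adjoint f (\<phi> j)) K = zperim n \<phi> (f ` K)"
    by (simp_all add: znorm_def zperim_def width_def supp_def image_image flip: linear_neg[OF adjoint_linear[OF assms]])
qed

lemma M2_linear_image:
  assumes M: "M \<in> M2" and f: "linear f" "bij f"
  shows "f ` M \<in> M2"
proof -
  have "interior (f ` M) \<noteq> {}"
    using M2D(5)[OF M] by (simp add: interior_bijective_linear_image[OF f])
  moreover have "uminus ` M = M"
    using M by (simp add: M2_def)
  then have "uminus ` f ` M = f ` M"
    by (metis (no_types, lifting) image_cong image_image linear_neg[OF f(1)])
  moreover have "compact (f ` M)"
    using M2D(1)[OF M] linear_continuous_on f(1)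
    by (intro compact_continuous_image) (auto simp: linear_conv_bounded_linear)
  ultimately show ?thesis
    using M2D[OF M] f by (simp add: M2_def convex_linear_image)
qed

lemma mnorm_linear_image:
  assumes f: "linear f" "bij f"
  shows "mnorm (f ` M) (f x) = mnorm M x"
proof -
  have "f x \<in> (\<lambda>y. t *\<^sub>R y) ` f ` M \<longleftrightarrow> x \<in> (\<lambda>y. t *\<^sub>R y) ` M" for t
  proof -
    have "(\<lambda>y. t *\<^sub>R y) ` f ` M = f ` (\<lambda>y. t *\<^sub>R y) ` M"
      by (simp add: image_image linear_scale[OF f(1)])
    then show ?thesis
      using bij_is_inj[OF f(2)] by (simp add: inj_image_mem_iff)
  qed
  then show ?thesis by (simp add: mnorm_def)
qed

lemma convex_body_linear_image:
  assumes K: "convex_body K" and f: "linear f" "bij f"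
  shows "convex_body (f ` K)"
proof -
  have "compact (f ` K)"
    using convex_bodyD(1)[OF K] linear_continuous_on f(1)
    by (intro compact_continuous_image) (auto simp: linear_conv_bounded_linear)
  then show ?thesis
    using convex_bodyD[OF K] f
    by (simp add: convex_body_def interior_bijective_linear_image[OF f] convex_linear_image)
qed

text \<open>One inequality, proved for all bodies and isomorphisms, gives the other when applied to
  the inverse map.\<close>

lemma per_linear_image:
  assumes M: "M \<in> M2" and K: "convex_body K" and f: "linear f" "bij f"
  shows "per (f ` M) (f ` K) = per M K"
proof -
  have le: "per (f ` M) (f ` K) \<le> per M K"
    if M: "M \<in> M2" and K: "convex_body K" and f: "linear f" "bij f" for M K and f :: "real^2 \<Rightarrow> real^2"
  proof (rule per_least[OF M2_linear_image[OF M f] convex_body_linear_image[OF K f]])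
    fix n \<phi> assume z: "\<And>x. znorm n \<phi> x \<le> mnorm (f ` M) x"
    have "znorm n (\<lambda>j. adjoint f (\<phi> j)) x \<le> mnorm M x" for x
      using z[of "f x"] by (simp add: inner_adjoint_sum(1)[OF f(1)] mnorm_linear_image[OF f])
    from per_ge[OF M K this] show "zperim n \<phi> (f ` K) \<le> per M K"
      by (simp add: inner_adjoint_sum(2)[OF f(1) convex_bodyD(1,6)[OF K]])
  qed
  obtain g where g: "linear g" "g \<circ> f = id" "f \<circ> g = id"
    using linear_injective_isomorphism[OF f(1) bij_is_inj[OF f(2)]] by (auto simp: fun_eq_iff)
  have "bij g" using g o_bij by blast
  have "g ` f ` S = S" for S
    using g(2) by (metis image_comp image_id id_apply)
  with le[OF M2_linear_image[OF M f] convex_body_linear_image[OF K f] g(1) \<open>bij g\<close>]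
  have "per M K \<le> per (f ` M) (f ` K)" by simp
  with le[OF M K f] show ?thesis by simp
qed

lemma lens_linear_image:
  assumes f: "linear f" "bij f"
  shows "lens (f ` M) (f u) = f ` lens M u"
proof -
  have "x \<in> lens (f ` M) (f u) \<longleftrightarrow> x \<in> f ` lens M u" for x
  proof -
    obtain y where y: "x = f y" using bij_is_surj[OF f(2)] by (metis surjD)
    have "x + f u /\<^sub>R 2 = f (y + u /\<^sub>R 2)" "x - f u /\<^sub>R 2 = f (y - u /\<^sub>R 2)"
      by (simp_all add: y linear_add[OF f(1)] linear_diff[OF f(1)] linear_scale[OF f(1)])
    then show ?thesis
      by (simp add: lens_def inj_image_mem_iff[OF bij_is_inj[OF f(2)]]) (simp add: y inj_image_mem_iff[OF bij_is_inj[OF f(2)]])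
  qed
  then show ?thesis by blast
qed

text \<open>The ball \<open>M\<close> contains two orthogonal vectors, and the determinant of two
  combinations of \<open>a\<close> and \<open>b\<close> is a multiple of
  \<open>det2 a b\<close>.\<close>

lemma det2_nonzero_if_spanning:
  assumes M: "M \<in> M2" and span: "\<And>x. x \<in> M \<Longrightarrow> \<exists>\<alpha> \<beta>. x = \<alpha> *\<^sub>R a + \<beta> *\<^sub>R b"
  shows "det2 a b \<noteq> 0"
proof
  assume 0: "det2 a b = 0"
  obtain r where r: "r > 0" "cball 0 r \<subseteq> M"
    using M2_zero_interior[OF M] by (meson mem_interior_cball)
  then have e: "r *\<^sub>R edir 0 \<in> M" "r *\<^sub>R edir (pi/2) \<in> M"
    by (auto simp: subset_iff)
  obtain c d c' d' where cd: "r *\<^sub>R edir 0 = c *\<^sub>R a + d *\<^sub>R b" "r *\<^sub>R edir (pi/2) = c' *\<^sub>R a + d' *\<^sub>R b"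
    using span[OF e(1)] span[OF e(2)] by blast
  have "det2 (c *\<^sub>R a + d *\<^sub>R b) (c' *\<^sub>R a + d' *\<^sub>R b) = (c * d' - d * c') * det2 a b"
    by (simp add: det2_def algebra_simps)
  moreover have "det2 (r *\<^sub>R edir 0) (r *\<^sub>R edir (pi/2)) = r * r"
    by (simp add: det2_def)
  ultimately show False using 0 r(1) cd by simp
qed

lemma det2_coordinates_unique:
  assumes "det2 a b \<noteq> 0" "\<alpha> *\<^sub>R a + \<beta> *\<^sub>R b = \<alpha>' *\<^sub>R a + \<beta>' *\<^sub>R b"
  shows "\<alpha> = \<alpha>'" "\<beta> = \<beta>'"
proof -
  have "det2 (\<alpha> *\<^sub>R a + \<beta> *\<^sub>R b) b = \<alpha> * det2 a b" "det2 a (\<alpha> *\<^sub>R a + \<beta> *\<^sub>R b) = \<beta> * det2 a b" for \<alpha> \<beta>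
    by (simp_all add: det2_def algebra_simps)
  then show "\<alpha> = \<alpha>'" "\<beta> = \<beta>'"
    using assms by (metis mult_cancel_right)+
qed

section \<open>Parallelograms and hexagons\<close>

definition parallelogram_ball :: "real^2 \<Rightarrow> real^2 \<Rightarrow> (real^2) set" where
  "parallelogram_ball a b = {\<alpha> *\<^sub>R a + \<beta> *\<^sub>R b | \<alpha> \<beta>. \<bar>\<alpha>\<bar> \<le> 1 \<and> \<bar>\<beta>\<bar> \<le> 1}"

text \<open>The vertices in cyclic order are a, b, b - a and their antipodes; the third condition
  cuts off two opposite corners of the parallelogram.\<close>

definition hexagon_ball :: "real^2 \<Rightarrow> real^2 \<Rightarrow> (real^2) set" where
  "hexagon_ball a b = {\<alpha> *\<^sub>R a + \<beta> *\<^sub>R b | \<alpha> \<beta>. \<bar>\<alpha>\<bar> \<le> 1 \<and> \<bar>\<beta>\<bar> \<le> 1 \<and> \<bar>\<alpha> + \<beta>\<bar> \<le> 1}"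

lemma mnorm_ge_1:
  assumes M: "M \<in> M2" and x: "x \<noteq> 0" and out: "\<And>c. c > 1 \<Longrightarrow> c *\<^sub>R x \<notin> M"
  shows "1 \<le> mnorm M x"
proof (rule ccontr)
  assume "\<not> ?thesis"
  then have "1 / mnorm M x > 1" using mnorm_pos[OF M x] by simp
  moreover have "(1 / mnorm M x) *\<^sub>R x \<in> M"
    using mnorm_normalize[OF M x] mnorm_le_1_iff[OF M, of "x /\<^sub>R mnorm M x"] by (simp add: inverse_eq_divide)
  ultimately show False using out by blast
qed

text \<open>For \<open>u = a\<close>, the midpoint of a side, the lens contains the parallelogram
  with half-sides a/2 and b, of perimeter 6. For the vertex \<open>u = a + b\<close> it is contained
  in a half-size copy of \<open>M\<close>, of perimeter 4. The general bounds 6 and 4 do the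
  rest.\<close>

lemma parallelogram_ball_extremes:
  assumes M: "M \<in> M2" and eq: "M = parallelogram_ball a b"
  shows "is_min (L_values M) 2" "is_max (L_values M) 3"
proof -
  have det: "det2 a b \<noteq> 0"
    by (rule det2_nonzero_if_spanning[OF M]) (auto simp: eq parallelogram_ball_def)
  have mem: "\<alpha> *\<^sub>R a + \<beta> *\<^sub>R b \<in> M \<longleftrightarrow> \<bar>\<alpha>\<bar> \<le> 1 \<and> \<bar>\<beta>\<bar> \<le> 1" for \<alpha> \<beta>
    using det2_coordinates_unique[OF det] unfolding eq parallelogram_ball_def by blast
  have norm1: "mnorm M (\<alpha> *\<^sub>R a + \<beta> *\<^sub>R b) = 1" if "\<bar>\<alpha>\<bar> \<le> 1" "\<bar>\<beta>\<bar> \<le> 1" "\<bar>\<alpha>\<bar> = 1 \<or> \<bar>\<beta>\<bar> = 1" for \<alpha> \<beta>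
  proof (rule antisym)
    show "mnorm M (\<alpha> *\<^sub>R a + \<beta> *\<^sub>R b) \<le> 1"
      using that by (simp add: mnorm_le_1_iff[OF M] mem)
    show "1 \<le> mnorm M (\<alpha> *\<^sub>R a + \<beta> *\<^sub>R b)"
    proof (rule mnorm_ge_1[OF M])
      show "\<alpha> *\<^sub>R a + \<beta> *\<^sub>R b \<noteq> 0"
        using det2_coordinates_unique[OF det, of \<alpha> \<beta> 0 0] that by auto
      fix c :: real assume c: "c > 1"
      have "c *\<^sub>R (\<alpha> *\<^sub>R a + \<beta> *\<^sub>R b) = (c * \<alpha>) *\<^sub>R a + (c * \<beta>) *\<^sub>R b"
        by (simp add: scaleR_add_right)
      then show "c *\<^sub>R (\<alpha> *\<^sub>R a + \<beta> *\<^sub>R b) \<notin> M"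
        using that c by (auto simp: mem abs_mult)
    qed
  qed
  have u1: "mnorm M a = 1" "mnorm M b = 1" "mnorm M (a + b) = 1"
    using norm1[of 1 0] norm1[of 0 1] norm1[of 1 1] by auto
  have "6 \<le> per M (lens M a)"
  proof -
    have sq: "\<sigma> *\<^sub>R (a /\<^sub>R 2) + \<tau> *\<^sub>R b \<in> lens M a" if "\<bar>\<sigma>\<bar> = 1" "\<bar>\<tau>\<bar> = 1" for \<sigma> \<tau> :: real
    proof -
      have eqs: "\<sigma> *\<^sub>R (a /\<^sub>R 2) + \<tau> *\<^sub>R b + a /\<^sub>R 2 = ((\<sigma> + 1) / 2) *\<^sub>R a + \<tau> *\<^sub>R b"
        "\<sigma> *\<^sub>R (a /\<^sub>R 2) + \<tau> *\<^sub>R b - a /\<^sub>R 2 = ((\<sigma> - 1) / 2) *\<^sub>R a + \<tau> *\<^sub>R b"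
        by (simp_all add: vec2_eq_iff field_simps)
      show ?thesis
        unfolding lens_def mem_Collect_eq eqs mem using that by (auto simp: abs_if split: if_splits)
    qed
    have "4 * (mnorm M (a /\<^sub>R 2) + mnorm M b) \<le> per M (lens M a)"
      using u1 sq[of 1 1] sq[of 1 "-1"] sq[of "-1" 1] sq[of "-1" "-1"]
      by (intro per_ge_parallelogram[OF M lens_convex_body[OF M]]) simp_all
    then show ?thesis using u1 by (simp add: mnorm_scale[OF M])
  qed
  then have "per M (lens M a) = 6"
    using per_lens_le_6[OF M u1(1)] by simp
  then show "is_max (L_values M) 3"
    unfolding is_max_L_values_iff[OF M] using u1(1) per_lens_le_6[OF M] by (intro exI[of _ a]) simp
  have "per M (lens M (a + b)) \<le> 4 * (mnorm M (a /\<^sub>R 2) + mnorm M (b /\<^sub>R 2) + mnorm M 0)"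
  proof (rule per_le_zonogon[OF M lens_convex_body[OF M]])
    fix x assume "x \<in> lens M (a + b)"
    moreover obtain \<alpha> \<beta> where x: "x = \<alpha> *\<^sub>R a + \<beta> *\<^sub>R b"
      using det2_expand[OF det] by blast
    moreover have "\<alpha> *\<^sub>R a + \<beta> *\<^sub>R b + (a + b) /\<^sub>R 2 = (\<alpha> + 1/2) *\<^sub>R a + (\<beta> + 1/2) *\<^sub>R b"
      "\<alpha> *\<^sub>R a + \<beta> *\<^sub>R b - (a + b) /\<^sub>R 2 = (\<alpha> - 1/2) *\<^sub>R a + (\<beta> - 1/2) *\<^sub>R b"
      by (simp_all add: vec2_eq_iff field_simps)
    ultimately have "\<bar>\<alpha> + 1/2\<bar> \<le> 1" "\<bar>\<alpha> - 1/2\<bar> \<le> 1" "\<bar>\<beta> + 1/2\<bar> \<le> 1" "\<bar>\<beta> - 1/2\<bar> \<le> 1"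
      by (simp_all only: lens_def mem_Collect_eq mem)
    then have "\<bar>2 * \<alpha>\<bar> \<le> 1" "\<bar>2 * \<beta>\<bar> \<le> 1" by linarith+
    moreover have "x = (2 * \<alpha>) *\<^sub>R (a /\<^sub>R 2) + (2 * \<beta>) *\<^sub>R (b /\<^sub>R 2) + 0 *\<^sub>R 0"
      by (simp add: x)
    ultimately show "\<exists>\<kappa> \<mu> \<nu>. \<bar>\<kappa>\<bar> \<le> 1 \<and> \<bar>\<mu>\<bar> \<le> 1 \<and> \<bar>\<nu>\<bar> \<le> 1 \<and> x = \<kappa> *\<^sub>R (a /\<^sub>R 2) + \<mu> *\<^sub>R (b /\<^sub>R 2) + \<nu> *\<^sub>R 0"
      by (metis abs_zero zero_le_one)
  qed (use u1 in simp)
  then have "per M (lens M (a + b)) = 4"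
    using per_lens_ge_4[OF M u1(3)] u1 by (simp add: mnorm_scale[OF M] mnorm_zero[OF M])
  then show "is_min (L_values M) 2"
    unfolding is_min_L_values_iff[OF M] using u1(3) per_lens_ge_4[OF M] by (intro exI[of _ "a + b"]) simp
qed

text \<open>The lens is a hexagon with sides parallel to \<open>b\<close>, \<open>b - a\<close>, \<open>a\<close>, whose lengths \<open>1 - s\<close>, \<open>1\<close>, \<open>s\<close>
  add up to 2.\<close>

lemma hexagon_edge_lens:
  assumes M: "M \<in> M2" and eq: "M = hexagon_ball a b"
    and u: "u = (1 - s) *\<^sub>R a + s *\<^sub>R b" "0 \<le> s" "s \<le> 1"
  shows "per M (lens M u) \<le> 4"
proof -
  have det: "det2 a b \<noteq> 0"
    by (rule det2_nonzero_if_spanning[OF M]) (auto simp: eq hexagon_ball_def)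
  have mem: "\<alpha> *\<^sub>R a + \<beta> *\<^sub>R b \<in> M \<longleftrightarrow> \<bar>\<alpha>\<bar> \<le> 1 \<and> \<bar>\<beta>\<bar> \<le> 1 \<and> \<bar>\<alpha> + \<beta>\<bar> \<le> 1" for \<alpha> \<beta>
    using det2_coordinates_unique[OF det] unfolding eq hexagon_ball_def by blast
  have v: "mnorm M a \<le> 1" "mnorm M b \<le> 1" "mnorm M (b - a) \<le> 1" "mnorm M u \<le> 1"
    using mem[of 1 0] mem[of 0 1] mem[of "-1" 1] mem[of "1 - s" s] u by (simp_all add: mnorm_le_1_iff[OF M])
  have "per M (lens M u) \<le> 4 * (mnorm M (((1 - s) / 2) *\<^sub>R b) + mnorm M ((1/2) *\<^sub>R (b - a)) + mnorm M ((s / 2) *\<^sub>R a))"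
  proof (rule per_le_zonogon[OF M lens_convex_body[OF M v(4)]])
    fix x assume "x \<in> lens M u"
    moreover obtain \<alpha> \<beta> where x: "x = \<alpha> *\<^sub>R a + \<beta> *\<^sub>R b"
      using det2_expand[OF det] by blast
    moreover have "\<alpha> *\<^sub>R a + \<beta> *\<^sub>R b + u /\<^sub>R 2 = (\<alpha> + (1 - s) / 2) *\<^sub>R a + (\<beta> + s / 2) *\<^sub>R b"
      "\<alpha> *\<^sub>R a + \<beta> *\<^sub>R b - u /\<^sub>R 2 = (\<alpha> - (1 - s) / 2) *\<^sub>R a + (\<beta> - s / 2) *\<^sub>R b"
      by (simp_all add: u(1) vec2_eq_iff field_simps)
    ultimately have "\<bar>\<alpha> + (1 - s) / 2\<bar> \<le> 1 \<and> \<bar>\<beta> + s / 2\<bar> \<le> 1 \<and> \<bar>\<alpha> + (1 - s) / 2 + (\<beta> + s / 2)\<bar> \<le> 1"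
      "\<bar>\<alpha> - (1 - s) / 2\<bar> \<le> 1 \<and> \<bar>\<beta> - s / 2\<bar> \<le> 1 \<and> \<bar>\<alpha> - (1 - s) / 2 + (\<beta> - s / 2)\<bar> \<le> 1"
      by (simp_all only: lens_def mem_Collect_eq mem)
    then have bounds: "\<alpha> \<le> (1 + s) / 2" "- (1 + s) / 2 \<le> \<alpha>" "\<beta> \<le> 1 - s / 2" "s / 2 - 1 \<le> \<beta>"
      "\<alpha> + \<beta> \<le> 1 / 2" "- 1 / 2 \<le> \<alpha> + \<beta>"
      by (auto simp: abs_le_iff field_simps)
    \<comment> \<open>The share of \<open>b - a\<close> in \<open>x\<close>. The three conditions in
      \<open>m\<close> ask for a common point of three intervals; by \<open>bounds\<close> they meet
      pairwise, so the largest left end lies in all of them.\<close>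
    define m where "m = max (- \<alpha> - s / 2) (max (\<beta> - (1 - s) / 2) (- 1 / 2))"
    have m: "\<bar>\<alpha> + m\<bar> \<le> s / 2" "\<bar>\<beta> - m\<bar> \<le> (1 - s) / 2" "\<bar>2 * m\<bar> \<le> 1"
      using bounds u(2,3) by (auto simp: m_def abs_le_iff max_def field_simps)
    \<comment> \<open>For \<open>s = 0\<close> or \<open>s = 1\<close> a segment degenerates; its
      numerator then vanishes and division by 0 gives the admissible coefficient 0.\<close>
    define \<kappa> \<nu> where "\<kappa> = (\<beta> - m) / ((1 - s) / 2)" and "\<nu> = (\<alpha> + m) / (s / 2)"
    have quot: "\<bar>y / d\<bar> \<le> 1 \<and> y / d * d = y" if "\<bar>y\<bar> \<le> d" for y d :: real
      using that by (cases "d = 0") (auto simp: abs_divide)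
    from quot[OF m(2)] quot[OF m(1)] have kn: "\<bar>\<kappa>\<bar> \<le> 1" "\<kappa> * ((1 - s) / 2) = \<beta> - m" "\<bar>\<nu>\<bar> \<le> 1" "\<nu> * (s / 2) = \<alpha> + m"
      by (auto simp: \<kappa>_def \<nu>_def)
    have "\<kappa> *\<^sub>R (((1 - s) / 2) *\<^sub>R b) + (2 * m) *\<^sub>R ((1/2) *\<^sub>R (b - a)) + \<nu> *\<^sub>R ((s / 2) *\<^sub>R a)
        = (\<beta> - m) *\<^sub>R b + m *\<^sub>R (b - a) + (\<alpha> + m) *\<^sub>R a"
      unfolding scaleR_scaleR kn by simp
    also have "\<dots> = x"
      by (simp add: x algebra_simps)
    finally show "\<exists>\<kappa> \<mu> \<nu>. \<bar>\<kappa>\<bar> \<le> 1 \<and> \<bar>\<mu>\<bar> \<le> 1 \<and> \<bar>\<nu>\<bar> \<le> 1 \<and>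
        x = \<kappa> *\<^sub>R (((1 - s) / 2) *\<^sub>R b) + \<mu> *\<^sub>R ((1/2) *\<^sub>R (b - a)) + \<nu> *\<^sub>R ((s / 2) *\<^sub>R a)"
      using kn(1,3) m(3) by metis
  qed
  also have "\<dots> = 4 * ((1 - s) / 2 * mnorm M b + 1 / 2 * mnorm M (b - a) + s / 2 * mnorm M a)"
    using u by (simp add: mnorm_scale[OF M])
  also have "\<dots> \<le> 4 * ((1 - s) / 2 * 1 + 1 / 2 * 1 + s / 2 * 1)"
    using v u by (intro mult_left_mono add_mono) auto
  also have "\<dots> = 4" by (simp add: field_simps)
  finally show ?thesis .
qed

text \<open>The linear sixth of a turn sending \<open>a\<close> to \<open>b\<close> and
  \<open>b\<close> to \<open>b - a\<close> preserves the hexagon, so each edge can play the role of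
  the edge from \<open>a\<close> to \<open>b\<close>.\<close>

lemma hexagon_ball_rotate: "hexagon_ball b (b - a) = hexagon_ball a b"
proof -
  have 1: "x *\<^sub>R b + y *\<^sub>R (b - a) = (- y) *\<^sub>R a + (x + y) *\<^sub>R b" for x y
    by (simp add: algebra_simps)
  show ?thesis
  proof (intro set_eqI iffI)
    fix z assume "z \<in> hexagon_ball b (b - a)"
    then obtain x y where "z = x *\<^sub>R b + y *\<^sub>R (b - a)" "\<bar>x\<bar> \<le> 1" "\<bar>y\<bar> \<le> 1" "\<bar>x + y\<bar> \<le> 1"
      by (auto simp: hexagon_ball_def)
    then have "z = (- y) *\<^sub>R a + (x + y) *\<^sub>R b \<and> \<bar>- y\<bar> \<le> 1 \<and> \<bar>x + y\<bar> \<le> 1 \<and> \<bar>- y + (x + y)\<bar> \<le> 1"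
      by (simp add: 1)
    then show "z \<in> hexagon_ball a b" unfolding hexagon_ball_def by blast
  next
    fix z assume "z \<in> hexagon_ball a b"
    then obtain x y where "z = x *\<^sub>R a + y *\<^sub>R b" "\<bar>x\<bar> \<le> 1" "\<bar>y\<bar> \<le> 1" "\<bar>x + y\<bar> \<le> 1"
      by (auto simp: hexagon_ball_def)
    then have "z = (x + y) *\<^sub>R b + (- x) *\<^sub>R (b - a) \<and> \<bar>x + y\<bar> \<le> 1 \<and> \<bar>- x\<bar> \<le> 1 \<and> \<bar>x + y + (- x)\<bar> \<le> 1"
      by (simp add: algebra_simps)
    then show "z \<in> hexagon_ball b (b - a)" unfolding hexagon_ball_def by blast
  qed
qed

text \<open>Up to sign every unit vector lies on one of three edges, so all lenses have perimeter
  exactly 4 and the minimum and maximum coincide.\<close>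

lemma hexagon_ball_extremes:
  assumes M: "M \<in> M2" and eq: "M = hexagon_ball a b"
  shows "is_min (L_values M) 2" "is_max (L_values M) 2"
proof -
  have eqs: "M = hexagon_ball a b" "M = hexagon_ball b (b - a)" "M = hexagon_ball (b - a) (- a)"
    using eq hexagon_ball_rotate[of b a] hexagon_ball_rotate[of "b - a" b] by (simp_all add: algebra_simps)
  have edge: "per M (lens M w) \<le> 4"
    if "M = hexagon_ball c d" "w = x *\<^sub>R c + y *\<^sub>R d" "\<bar>x\<bar> \<le> 1" "\<bar>y\<bar> \<le> 1" "\<bar>x + y\<bar> = 1" for c d w x y
  proof (cases "x + y = 1")
    case True
    then have "w = (1 - y) *\<^sub>R c + y *\<^sub>R d" "0 \<le> y" "y \<le> 1"
      using that by (auto simp: abs_le_iff eq_diff_eq[symmetric])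
    from hexagon_edge_lens[OF M that(1) this] show ?thesis .
  next
    case False
    then have x: "x = - 1 - y" using that(5) by linarith
    have "- w = (1 - (- y)) *\<^sub>R c + (- y) *\<^sub>R d" "0 \<le> - y" "- y \<le> 1"
      using that(3,4) unfolding that(2) x by (auto simp: abs_le_iff algebra_simps)
    from hexagon_edge_lens[OF M that(1) this] show ?thesis by (simp add: lens_minus)
  qed
  have four: "per M (lens M u) = 4" if u: "mnorm M u = 1" for u
  proof -
    have "u \<in> M" using u mnorm_le_1_iff[OF M, of u] by simp
    then obtain x y where xy: "u = x *\<^sub>R a + y *\<^sub>R b" "\<bar>x\<bar> \<le> 1" "\<bar>y\<bar> \<le> 1" "\<bar>x + y\<bar> \<le> 1"
      unfolding eq hexagon_ball_def by blast
    \<comment> \<open>The hexagonal gauge of \<open>u\<close> in coordinates; a value below 1 would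
      contradict \<open>mnorm M u = 1\<close>.\<close>
    define m where "m = max \<bar>x\<bar> (max \<bar>y\<bar> \<bar>x + y\<bar>)"
    have "m = 1"
    proof (rule ccontr)
      assume "m \<noteq> 1"
      moreover have "m \<noteq> 0"
      proof
        assume "m = 0"
        moreover have "\<bar>x\<bar> \<le> m" "\<bar>y\<bar> \<le> m" by (simp_all add: m_def)
        ultimately have "u = 0" by (simp add: xy(1))
        then show False using u mnorm_zero[OF M] by simp
      qed
      ultimately have m: "0 < m" "m < 1" using xy by (auto simp: m_def max_def split: if_splits)
      have le: "\<bar>x / m\<bar> \<le> 1" "\<bar>y / m\<bar> \<le> 1" "\<bar>x / m + y / m\<bar> \<le> 1"
      proof -
        have "\<bar>x\<bar> \<le> m" "\<bar>y\<bar> \<le> m" "\<bar>x + y\<bar> \<le> m"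
          unfolding m_def by (simp_all add: le_max_iff_disj)
        then show "\<bar>x / m\<bar> \<le> 1" "\<bar>y / m\<bar> \<le> 1" "\<bar>x / m + y / m\<bar> \<le> 1"
          using m(1) by (simp_all add: abs_divide flip: add_divide_distrib)
      qed
      have "u /\<^sub>R m = (x / m) *\<^sub>R a + (y / m) *\<^sub>R b"
        by (simp add: xy(1) scaleR_add_right divide_inverse mult.commute)
      then have "u /\<^sub>R m \<in> M" unfolding eq hexagon_ball_def using le by blast
      then have "mnorm M u \<le> m" using mnorm_le_iff[OF M m(1)] by simp
      then show False using u m by simp
    qed
    then consider "\<bar>x\<bar> = 1" | "\<bar>y\<bar> = 1" | "\<bar>x + y\<bar> = 1"
      by (auto simp: m_def max_def split: if_splits)
    then have "per M (lens M u) \<le> 4"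
    proof cases
      case 1
      have "u = y *\<^sub>R (b - a) + (- (x + y)) *\<^sub>R (- a)" by (simp add: xy(1) algebra_simps)
      from edge[OF eqs(3) this] show ?thesis using xy 1 by simp
    next
      case 2
      have "u = (x + y) *\<^sub>R b + (- x) *\<^sub>R (b - a)" by (simp add: xy(1) algebra_simps)
      from edge[OF eqs(2) this] show ?thesis using xy 2 by simp
    next
      case 3
      from edge[OF eqs(1) xy(1-3) 3] show ?thesis .
    qed
    then show ?thesis using per_lens_ge_4[OF M u] by simp
  qed
  obtain u where u: "mnorm M u = 1" using unit_sphere_compact(2)[OF M] by blast
  show "is_min (L_values M) 2"
    unfolding is_min_L_values_iff[OF M] using four u by (intro exI[of _ u]) simp
  show "is_max (L_values M) 2"
    unfolding is_max_L_values_iff[OF M] using four u by (intro exI[of _ u]) simp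
qed

section \<open>From convex hulls to centred coordinate form\<close>

lemma symmetric_translate:
  assumes S: "compact S" "S \<noteq> {}" "\<And>x. x \<in> S \<Longrightarrow> - x \<in> S"
    and T: "\<And>x. x \<in> (+) c ` S \<Longrightarrow> - x \<in> (+) c ` S"
  shows "c = (0 :: real^2)"
proof -
  \<comment> \<open>Two centres of symmetry make \<open>S\<close> invariant under the translation by
    -2c, which moves the point extreme in direction -c still further unless
    \<open>c = 0\<close>.\<close>
  obtain x where x: "x \<in> S" "\<And>y. y \<in> S \<Longrightarrow> (- c) \<bullet> y \<le> (- c) \<bullet> x"
    using supp_attained[OF S(1,2)] by metis
  have "- (c + (- x)) \<in> (+) c ` S"
    using S(3)[OF x(1)] by (intro T) blast
  then obtain y where "y \<in> S" "- (c + (- x)) = c + y" by auto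
  then have "y = x - 2 *\<^sub>R c" by (simp add: algebra_simps scaleR_2)
  with x(2)[OF \<open>y \<in> S\<close>] have "c \<bullet> c \<le> 0" by (simp add: inner_diff_right)
  then show ?thesis by (metis inner_gt_zero_iff not_less)
qed

text \<open>Parallelograms and affine hexagons may have any centre, but those that are unit balls
  are centred at 0.\<close>

lemma M2_translate_zero:
  assumes M: "M \<in> M2" and eq: "M = (+) c ` S" and sym: "\<And>x. x \<in> S \<Longrightarrow> - x \<in> S"
  shows "M = S"
proof -
  have S: "S = (+) (- c) ` M" by (simp add: eq image_image)
  have "compact S" unfolding S by (rule compact_translation[OF M2D(1)[OF M]])
  moreover have "S \<noteq> {}" unfolding S using M2_zero[OF M] by blast
  moreover have "- x \<in> M" if "x \<in> M" for x
    using that M2_uminus[OF M] by simp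
  ultimately have "c = 0"
    using sym unfolding eq by (intro symmetric_translate) auto
  then show ?thesis by (simp add: eq)
qed

lemma linear_combination_linear: "linear (\<lambda>p :: real \<times> real. fst p *\<^sub>R a + snd p *\<^sub>R b)"
  by (rule linearI) (simp_all add: algebra_simps)

lemma parallelogram_ball_convex: "convex (parallelogram_ball a b)"
proof -
  have "parallelogram_ball a b = (\<lambda>p. fst p *\<^sub>R a + snd p *\<^sub>R b) ` ({-1..1} \<times> {-1..1})"
    by (force simp: parallelogram_ball_def abs_le_iff)
  then show ?thesis
    by (simp add: convex_linear_image[OF linear_combination_linear] convex_Times)
qed

lemma hexagon_ball_convex: "convex (hexagon_ball a b)"
proof -
  let ?S = "({-1..1} \<times> {-1..1}) \<inter> {p :: real \<times> real. (1, 1) \<bullet> p \<le> 1} \<inter> {p. (1, 1) \<bullet> p \<ge> -1}"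
  have "hexagon_ball a b = (\<lambda>p. fst p *\<^sub>R a + snd p *\<^sub>R b) ` ?S"
    by (force simp: hexagon_ball_def abs_le_iff inner_prod_def)
  moreover have "convex ?S"
    by (intro convex_Int convex_Times convex_halfspace_le convex_halfspace_ge) auto
  ultimately show ?thesis
    by (simp add: convex_linear_image[OF linear_combination_linear])
qed

lemma parallelogram_hull_eq:
  "convex hull {a, a + u, a + u + v, a + v} = (+) (a + u /\<^sub>R 2 + v /\<^sub>R 2) ` parallelogram_ball (u /\<^sub>R 2) (v /\<^sub>R 2)"
  (is "?H = (+) ?c ` ?P")
proof
  have pt: "?c + (\<alpha> *\<^sub>R (u /\<^sub>R 2) + \<beta> *\<^sub>R (v /\<^sub>R 2)) \<in> (+) ?c ` ?P" if "\<bar>\<alpha>\<bar> \<le> 1" "\<bar>\<beta>\<bar> \<le> 1" for \<alpha> \<beta>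
    using that unfolding parallelogram_ball_def by blast
  have "a = ?c + ((-1) *\<^sub>R (u /\<^sub>R 2) + (-1) *\<^sub>R (v /\<^sub>R 2))" "a + u = ?c + (1 *\<^sub>R (u /\<^sub>R 2) + (-1) *\<^sub>R (v /\<^sub>R 2))"
    "a + u + v = ?c + (1 *\<^sub>R (u /\<^sub>R 2) + 1 *\<^sub>R (v /\<^sub>R 2))" "a + v = ?c + ((-1) *\<^sub>R (u /\<^sub>R 2) + 1 *\<^sub>R (v /\<^sub>R 2))"
    by (simp_all add: vec2_eq_iff)
  then have "a \<in> (+) ?c ` ?P" "a + u \<in> (+) ?c ` ?P" "a + u + v \<in> (+) ?c ` ?P" "a + v \<in> (+) ?c ` ?P"
    using pt[of "-1" "-1"] pt[of 1 "-1"] pt[of 1 1] pt[of "-1" 1] by (metis abs_minus_cancel abs_one order_refl)+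
  then show "?H \<subseteq> (+) ?c ` ?P"
    by (intro hull_minimal convex_translation parallelogram_ball_convex) auto
  show "(+) ?c ` ?P \<subseteq> ?H"
  proof (clarsimp simp only: parallelogram_ball_def image_iff)
    fix \<alpha> \<beta> :: real assume ab: "\<bar>\<alpha>\<bar> \<le> 1" "\<bar>\<beta>\<bar> \<le> 1"
    \<comment> \<open>Bilinear interpolation: \<open>l\<close> and \<open>m\<close> are the
      coordinates of the point relative to the corner \<open>a\<close> and the sides
      \<open>u\<close>, \<open>v\<close>.\<close>
    define l m where "l = (1 + \<alpha>) / 2" and "m = (1 + \<beta>) / 2"
    have lm: "0 \<le> l" "l \<le> 1" "0 \<le> m" "m \<le> 1" using ab by (auto simp: l_def m_def)
    have H: "convex ?H" "a \<in> ?H" "a + u \<in> ?H" "a + u + v \<in> ?H" "a + v \<in> ?H"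
      by (auto intro: hull_inc)
    have "(1 - m) *\<^sub>R ((1 - l) *\<^sub>R a + l *\<^sub>R (a + u)) + m *\<^sub>R ((1 - l) *\<^sub>R (a + v) + l *\<^sub>R (a + u + v)) \<in> ?H"
      using lm by (intro convexD_alt[OF H(1)] H)
    also have "(1 - m) *\<^sub>R ((1 - l) *\<^sub>R a + l *\<^sub>R (a + u)) + m *\<^sub>R ((1 - l) *\<^sub>R (a + v) + l *\<^sub>R (a + u + v))
        = a + l *\<^sub>R u + m *\<^sub>R v"
      by (simp add: algebra_simps)
    also have "\<dots> = ?c + (\<alpha> *\<^sub>R (u /\<^sub>R 2) + \<beta> *\<^sub>R (v /\<^sub>R 2))"
      by (simp add: l_def m_def vec2_eq_iff field_simps)
    finally show "?c + (\<alpha> *\<^sub>R (u /\<^sub>R 2) + \<beta> *\<^sub>R (v /\<^sub>R 2)) \<in> ?H" .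
  qed
qed

lemma parallelogram_extremes:
  assumes M: "M \<in> M2" and P: "parallelogram M"
  shows "is_min (L_values M) 2" "is_max (L_values M) 3"
proof -
  obtain a u v where "M = convex hull {a, a + u, a + u + v, a + v}"
    using P by (auto simp: parallelogram_def)
  then have eq: "M = (+) (a + u /\<^sub>R 2 + v /\<^sub>R 2) ` parallelogram_ball (u /\<^sub>R 2) (v /\<^sub>R 2)"
    by (simp only: parallelogram_hull_eq)
  have "- x \<in> parallelogram_ball c d" if "x \<in> parallelogram_ball c d" for x c d
  proof -
    obtain \<alpha> \<beta> where "x = \<alpha> *\<^sub>R c + \<beta> *\<^sub>R d" "\<bar>\<alpha>\<bar> \<le> 1" "\<bar>\<beta>\<bar> \<le> 1"
      using \<open>x \<in> _\<close> by (auto simp: parallelogram_ball_def)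
    then have "- x = (- \<alpha>) *\<^sub>R c + (- \<beta>) *\<^sub>R d \<and> \<bar>- \<alpha>\<bar> \<le> 1 \<and> \<bar>- \<beta>\<bar> \<le> 1" by simp
    then show ?thesis unfolding parallelogram_ball_def by blast
  qed
  with M2_translate_zero[OF M eq] have "M = parallelogram_ball (u /\<^sub>R 2) (v /\<^sub>R 2)" by blast
  with parallelogram_ball_extremes[OF M] show "is_min (L_values M) 2" "is_max (L_values M) 3" by blast+
qed

lemma hexagon_hull_eq:
  "convex hull {a, b, b - a, - a, - b, a - b} = hexagon_ball a b" (is "?H = ?P")
proof
  have pt: "\<alpha> *\<^sub>R a + \<beta> *\<^sub>R b \<in> ?P" if "\<bar>\<alpha>\<bar> \<le> 1" "\<bar>\<beta>\<bar> \<le> 1" "\<bar>\<alpha> + \<beta>\<bar> \<le> 1" for \<alpha> \<beta>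
    using that unfolding hexagon_ball_def by blast
  have "a \<in> ?P" "b \<in> ?P" "b - a \<in> ?P" "- a \<in> ?P" "- b \<in> ?P" "a - b \<in> ?P"
    using pt[of 1 0] pt[of 0 1] pt[of "-1" 1] pt[of "-1" 0] pt[of 0 "-1"] pt[of 1 "-1"] by simp_all
  then show "?H \<subseteq> ?P"
    by (intro hull_minimal hexagon_ball_convex) auto
  have H: "convex ?H" "a \<in> ?H" "b \<in> ?H" "b - a \<in> ?H" "- a \<in> ?H" "- b \<in> ?H" "a - b \<in> ?H"
    by (auto intro: hull_inc)
  have "(1 - 1/2) *\<^sub>R a + (1/2) *\<^sub>R (- a) \<in> ?H"
    by (rule convexD_alt[OF H(1,2,5)]) auto
  then have 0: "0 \<in> ?H" by simp
  \<comment> \<open>Weights with sum below 1 are allowed because 0 belongs to the hull; each of the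
    six sectors then needs only the two vertices that bound it.\<close>
  have comb: "l *\<^sub>R x + m *\<^sub>R y \<in> ?H" if "x \<in> ?H" "y \<in> ?H" "0 \<le> l" "0 \<le> m" "l + m \<le> 1" for x y l m
  proof (cases "l + m = 0")
    case True
    then have "l = 0" "m = 0" using that by linarith+
    then show ?thesis using 0 by simp
  next
    case False
    then have k: "(l + m) * (1 - m / (l + m)) = l" "(l + m) * (m / (l + m)) = m"
      by (simp_all add: field_simps)
    have "(1 - m / (l + m)) *\<^sub>R x + (m / (l + m)) *\<^sub>R y \<in> ?H"
      using that False by (intro convexD_alt[OF H(1)]) auto
    then have "(1 - (l + m)) *\<^sub>R 0 + (l + m) *\<^sub>R ((1 - m / (l + m)) *\<^sub>R x + (m / (l + m)) *\<^sub>R y) \<in> ?H"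
      using that by (intro convexD_alt[OF H(1) 0]) auto
    then show ?thesis
      unfolding scaleR_zero_right scaleR_add_right scaleR_scaleR k by simp
  qed
  show "?P \<subseteq> ?H"
  proof (clarsimp simp only: hexagon_ball_def)
    fix x y :: real assume xy: "\<bar>x\<bar> \<le> 1" "\<bar>y\<bar> \<le> 1" "\<bar>x + y\<bar> \<le> 1"
    consider (1) "x \<ge> 0" "y \<ge> 0" | (2) "x \<le> 0" "y \<le> 0" | (3) "x \<le> 0" "y \<ge> 0" "x + y \<ge> 0"
      | (4) "x \<ge> 0" "y \<le> 0" "x + y \<le> 0" | (5) "x \<le> 0" "y \<ge> 0" "x + y \<le> 0" | (6) "x \<ge> 0" "y \<le> 0" "x + y \<ge> 0"
      by linarith
    then show "x *\<^sub>R a + y *\<^sub>R b \<in> ?H"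
    proof cases
      case 1 then show ?thesis using comb[OF H(2,3), of x y] xy by simp
    next
      case 2 then show ?thesis using comb[OF H(5,6), of "- x" "- y"] xy by simp
    next
      case 3 then show ?thesis using comb[OF H(3,4), of "x + y" "- x"] xy by (simp add: algebra_simps)
    next
      case 4 then show ?thesis using comb[OF H(6,7), of "- (x + y)" x] xy by (simp add: algebra_simps)
    next
      case 5 then show ?thesis using comb[OF H(4,5), of y "- (x + y)"] xy by (simp add: algebra_simps)
    next
      case 6 then show ?thesis using comb[OF H(7,2), of "- y" "x + y"] xy by (simp add: algebra_simps)
    qed
  qed
qed

lemma affinely_regular_hexagon_extremes:
  assumes M: "M \<in> M2" and P: "affinely_regular_hexagon M"
  shows "is_min (L_values M) 2" "is_max (L_values M) 2"
proof -
  obtain H a f where H: "regular_hexagon H" and f: "linear f" and eq: "M = (\<lambda>x. a + f x) ` H"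
    using P by (auto simp: affinely_regular_hexagon_def)
  obtain c r \<theta> where "H = convex hull {c + r *\<^sub>R vector [cos (\<theta> + real k * pi / 3), sin (\<theta> + real k * pi / 3)] | k. k < (6::nat)}"
    using H by (auto simp: regular_hexagon_def)
  then have Heq: "H = convex hull {c + r *\<^sub>R edir (\<theta> + real k * pi / 3) | k. k < (6::nat)}"
    by (simp add: edir_def)
  \<comment> \<open>Two adjacent vertices relative to the centre determine the others: the next one
    is \<open>q - p\<close>, and half a turn changes signs.\<close>
  define p q where "p = r *\<^sub>R edir \<theta>" and "q = r *\<^sub>R edir (\<theta> + pi / 3)"
  have e: "edir (\<theta> + 2 * pi / 3) = edir (\<theta> + pi / 3) - edir \<theta>"
  proof -
    have cs: "cos (2 * pi / 3) = - 1 / 2" "sin (2 * pi / 3) = sqrt 3 / 2"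
      using cos_120 sin_120 by simp_all
    show ?thesis
      by (simp only: vec2_eq_iff edir_nth cos_add sin_add cos_60 sin_60 cs vector_minus_component)
         (simp add: field_simps)
  qed
  have e3: "edir (\<theta> + pi) = - edir \<theta>"
    by (rule edir_plus_pi)
  have e45: "edir (\<theta> + 4 * pi / 3) = - edir (\<theta> + pi / 3)"
    "edir (\<theta> + 5 * pi / 3) = - edir (\<theta> + 2 * pi / 3)"
    using edir_plus_pi[of "\<theta> + pi / 3"] edir_plus_pi[of "\<theta> + 2 * pi / 3"] by (simp_all add: algebra_simps)
  have six: "{k. k < (6::nat)} = {0, 1, 2, 3, 4, 5}" by auto
  have "{c + r *\<^sub>R edir (\<theta> + real k * pi / 3) | k. k < (6::nat)} = (\<lambda>k. c + r *\<^sub>R edir (\<theta> + real k * pi / 3)) ` {k. k < (6::nat)}"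
    by blast
  also have "\<dots> = (+) c ` {p, q, q - p, - p, - q, p - q}"
    unfolding six by (simp add: p_def q_def e e3 e45 scaleR_diff_right)
  finally have "H = (+) c ` (convex hull {p, q, q - p, - p, - q, p - q})"
    unfolding Heq by (simp only: convex_hull_translation)
  moreover have "f ` (convex hull {p, q, q - p, - p, - q, p - q}) =
      convex hull {f p, f q, f q - f p, - f p, - f q, f p - f q}"
    unfolding convex_hull_linear_image[OF f]
    by (simp add: linear_diff[OF f] linear_neg[OF f])
  ultimately have "M = (+) (a + f c) ` (convex hull {f p, f q, f q - f p, - f p, - f q, f p - f q})"
    unfolding eq by (simp add: image_image linear_add[OF f] add.assoc
        flip: \<open>f ` (convex hull _) = _\<close>)
  then have "M = (+) (a + f c) ` hexagon_ball (f p) (f q)"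
    unfolding hexagon_hull_eq .
  moreover have "- x \<in> hexagon_ball c d" if "x \<in> hexagon_ball c d" for x c d
  proof -
    obtain \<alpha> \<beta> where "x = \<alpha> *\<^sub>R c + \<beta> *\<^sub>R d" "\<bar>\<alpha>\<bar> \<le> 1" "\<bar>\<beta>\<bar> \<le> 1" "\<bar>\<alpha> + \<beta>\<bar> \<le> 1"
      using \<open>x \<in> _\<close> by (auto simp: hexagon_ball_def)
    then have "- x = (- \<alpha>) *\<^sub>R c + (- \<beta>) *\<^sub>R d \<and> \<bar>- \<alpha>\<bar> \<le> 1 \<and> \<bar>- \<beta>\<bar> \<le> 1 \<and> \<bar>- \<alpha> + (- \<beta>)\<bar> \<le> 1" by simp
    then show ?thesis unfolding hexagon_ball_def by blast
  qed
  ultimately have "M = hexagon_ball (f p) (f q)"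
    using M2_translate_zero[OF M] by blast
  with hexagon_ball_extremes[OF M] show "is_min (L_values M) 2" "is_max (L_values M) 2" by blast+
qed

lemma uminus_image_eq:
  fixes S :: "'a::group_add set"
  assumes "\<And>x. x \<in> S \<Longrightarrow> - x \<in> S"
  shows "uminus ` S = S"
proof
  show "S \<subseteq> uminus ` S"
  proof
    fix x assume "x \<in> S"
    from imageI[OF assms[OF this], of uminus] show "x \<in> uminus ` S" by simp
  qed
qed (use assms in blast)

lemma M2_parallelogram_exists: "parallelogram_ball (edir 0) (edir (pi/2)) \<in> M2"
proof -
  have "parallelogram_ball (edir 0) (edir (pi/2)) = cbox (vector [-1, -1]) (vector [1, 1])"
    by (force simp: parallelogram_ball_def mem_box_cart forall_2 vec2_eq_iff abs_le_iff)
  moreover have "vector [0, 0] \<in> box (vector [-1, -1]) (vector [1, 1] :: real^2)"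
    by (simp add: mem_box_cart forall_2)
  moreover have "- x \<in> cbox (vector [-1, -1]) (vector [1, 1])" if "x \<in> cbox (vector [-1, -1]) (vector [1, 1])" for x :: "real^2"
    using that by (auto simp: mem_box_cart forall_2)
  then have "uminus ` cbox (vector [-1, -1]) (vector [1, 1]) = cbox (vector [-1, -1]) (vector [1, 1] :: real^2)"
    by (rule uminus_image_eq)
  ultimately show ?thesis
    by (auto simp: M2_def interior_cbox convex_box)
qed

lemma M2_hexagon_exists: "hexagon_ball (edir 0) (edir (pi/2)) \<in> M2"
proof -
  let ?S = "hexagon_ball (edir 0) (edir (pi/2))"
  have mem: "x \<in> ?S \<longleftrightarrow> \<bar>x $ 1\<bar> \<le> 1 \<and> \<bar>x $ 2\<bar> \<le> 1 \<and> \<bar>x $ 1 + x $ 2\<bar> \<le> 1" for x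
    by (auto simp: hexagon_ball_def vec2_eq_iff)
  have "compact ?S"
    unfolding hexagon_hull_eq[symmetric] by (intro finite_imp_compact_convex_hull) auto
  moreover have "ball 0 (1/2) \<subseteq> ?S"
  proof
    fix x :: "real^2" assume "x \<in> ball 0 (1/2)"
    then have "\<bar>x $ 1\<bar> < 1/2" "\<bar>x $ 2\<bar> < 1/2"
      using component_le_norm_cart[of x 1] component_le_norm_cart[of x 2] by simp_all
    then show "x \<in> ?S" unfolding mem by linarith
  qed
  then have "interior ?S \<noteq> {}"
    using interior_maximal[OF _ open_ball, of 0 "1/2" ?S] by auto
  moreover have "- x \<in> ?S" if "x \<in> ?S" for x
    using that unfolding mem by simp linarith
  then have "uminus ` ?S = ?S"
    by (rule uminus_image_eq)
  ultimately show ?thesis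
    by (simp add: M2_def hexagon_ball_convex)
qed

section \<open>The Euclidean disk\<close>

lemma M2_cball: "cball (0 :: real^2) 1 \<in> M2"
  using uminus_image_eq[of "cball (0 :: real^2) 1"] by (simp add: M2_def)

lemma mnorm_cball: "mnorm (cball 0 1) x = norm x"
proof (cases "x = 0")
  case False
  then have "mnorm (cball 0 1) x \<le> norm x"
    using mnorm_le_iff[OF M2_cball, of "norm x" x] by simp
  moreover have "norm x \<le> mnorm (cball 0 1) x"
    using mnorm_le_iff[OF M2_cball mnorm_pos[OF M2_cball False], of x] mnorm_pos[OF M2_cball False]
    by (simp add: field_simps)
  ultimately show ?thesis by simp
qed (simp add: mnorm_zero[OF M2_cball])

text \<open>After the shift back by u/2 the point is \<open>edir \<omega>\<close> on the unit
  circle; shifted the other way it is a difference of unit vectors, of norm at most 1 when the angle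
  between them is at most \<pi>/3.\<close>

lemma disk_lens_point:
  assumes "cos (\<omega> - \<tau>) \<ge> 1 / 2"
  shows "edir \<omega> - edir \<tau> /\<^sub>R 2 \<in> lens (cball 0 1) (edir \<tau>)" "- (edir \<omega> - edir \<tau> /\<^sub>R 2) \<in> lens (cball 0 1) (edir \<tau>)"
proof -
  have half: "y - X /\<^sub>R 2 + X /\<^sub>R 2 = y" "y - X /\<^sub>R 2 - X /\<^sub>R 2 = y - X"
    "- (y - X /\<^sub>R 2) + X /\<^sub>R 2 = - (y - X)" "- (y - X /\<^sub>R 2) - X /\<^sub>R 2 = - y" for y X :: "real^2"
    by (simp_all add: vec2_eq_iff)
  have "(norm (edir \<omega> - edir \<tau>))\<^sup>2 \<le> 1"
    using assms cos_minus[of "\<omega> - \<tau>"]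
    by (simp add: power2_norm_eq_inner inner_diff_left inner_diff_right edir_inner)
  then have "norm (edir \<omega> - edir \<tau>) \<le> 1"
    by (simp add: power2_le_iff_abs_le abs_square_le_1)
  then show "edir \<omega> - edir \<tau> /\<^sub>R 2 \<in> lens (cball 0 1) (edir \<tau>)" "- (edir \<omega> - edir \<tau> /\<^sub>R 2) \<in> lens (cball 0 1) (edir \<tau>)"
    unfolding lens_def mem_Collect_eq half mem_cball dist_0_norm norm_minus_cancel by simp_all
qed

text \<open>The nodes start at \<open>\<tau> - 5\<pi>/6\<close> so that the directions of the first \<open>2m\<close> functionals run through the
  circular arc of the lens and those of the remaining ones lie in the normal cone of its vertex.\<close>

lemma disk_lens_zperim:
  assumes m: "m > 0"
  shows "8 * real m * sin (pi / (6 * real m)) \<le> per (cball 0 1) (lens (cball 0 1) (edir \<tau>))"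
proof -
  define n where "n = 3 * m"
  have n: "n \<ge> 2" using m by (simp add: n_def)
  define \<theta> where "\<theta> j = \<tau> - 5 * pi / 6 + real j * pi / real n" for j
  define f where "f j = edir (\<theta> j)" for j
  define \<phi> where "\<phi> j = (f (Suc j) - f j) /\<^sub>R 2" for j
  define \<delta> where "\<delta> = pi / real n"
  \<comment> \<open>The difference of two consecutive nodes is a chord of the circle, pointing a
    right angle ahead of the middle of its arc; \<open>\<psi> j\<close> is the direction of
    \<open>\<phi> j\<close>.\<close>
  define \<psi> where "\<psi> j = \<theta> j + \<delta> / 2 + pi / 2" for j
  define \<omega> where "\<omega> j = (if j < 2 * m then \<psi> j else \<tau> + pi / 3)" for j
  let ?D = "cball (0 :: real^2) 1" and ?u = "edir \<tau>"
  let ?K = "lens ?D ?u"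
  have K: "convex_body ?K"
    by (rule lens_convex_body[OF M2_cball]) (simp add: mnorm_cball)
  have \<theta>m: "\<theta> (2 * m) = \<tau> - pi / 6" "\<theta> n = \<tau> + pi / 6" "\<theta> 0 = \<tau> - 5 * pi / 6"
    using m by (simp_all add: \<theta>_def n_def field_simps)
  have "f n = - f 0"
    using edir_plus_pi[of "\<tau> - 5 * pi / 6"] by (simp add: f_def \<theta>m field_simps)
  have "znorm n \<phi> x \<le> mnorm ?D x" for x
    unfolding \<phi>_def
  proof (rule znorm_differences_le[OF M2_cball n, where a = "\<tau> - 5 * pi / 6"])
    show "f j \<bullet> x \<le> mnorm ?D x" for j x
      using Cauchy_Schwarz_ineq2[of "f j" x] by (simp add: mnorm_cball f_def abs_le_iff)
    show "f j \<bullet> edir (\<tau> - 5 * pi / 6 + real j * pi / real n) = mnorm ?D (edir (\<tau> - 5 * pi / 6 + real j * pi / real n))" for j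
      by (simp add: f_def \<theta>_def mnorm_cball edir_inner)
  qed fact
  from per_ge[OF M2_cball K this] have ge: "zperim n \<phi> ?K \<le> per ?D ?K" .
  have \<theta>Suc: "\<theta> (Suc j) = \<theta> j + \<delta>" for j
    by (simp add: \<theta>_def \<delta>_def add_divide_distrib algebra_simps)
  have \<omega>: "cos (\<omega> j - \<tau>) \<ge> 1 / 2" for j
  proof (cases "j < 2 * m")
    case True
    have "\<theta> j \<ge> \<tau> - 5 * pi / 6" by (simp add: \<theta>_def)
    moreover have "\<theta> j + \<delta> \<le> \<tau> - pi / 6"

    proof -
      have "real (Suc j) * pi / n \<le> real (2 * m) * pi / n"
        using True by (intro divide_right_mono mult_right_mono) auto
      then have "\<theta> (Suc j) \<le> \<theta> (2 * m)" by (simp add: \<theta>_def)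
      then show ?thesis unfolding \<theta>Suc \<theta>m(1) .
    qed
    moreover have "\<delta> \<ge> 0" by (simp add: \<delta>_def)
    ultimately have "\<bar>\<psi> j - \<tau>\<bar> \<le> pi / 3"
      unfolding \<psi>_def by linarith
    then have "cos (pi / 3) \<le> cos \<bar>\<psi> j - \<tau>\<bar>"
      by (intro cos_monotone_0_pi_le) auto
    then show ?thesis using True by (simp add: \<omega>_def cos_60)
  qed (simp add: \<omega>_def cos_60)
  have width: "width ?K (\<phi> j) \<ge> 2 * (\<phi> j \<bullet> (edir (\<omega> j) - ?u /\<^sub>R 2))" for j
    using supp_ge[OF convex_bodyD(1)[OF K] disk_lens_point(1)[OF \<omega>], of "\<phi> j" j]
      supp_ge[OF convex_bodyD(1)[OF K] disk_lens_point(2)[OF \<omega>], of "- \<phi> j" j]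
    unfolding width_def inner_minus_left inner_minus_right minus_minus by linarith
  have tele: "(\<Sum>j\<in>{p..<q}. \<phi> j \<bullet> x) = (f q \<bullet> x - f p \<bullet> x) / 2" if "p \<le> q" for p q x
  proof -
    have "(\<Sum>j\<in>{p..<q}. \<phi> j \<bullet> x) = (\<Sum>j\<in>{p..<q}. f (Suc j) \<bullet> x - f j \<bullet> x) / 2"
      unfolding sum_divide_distrib by (intro sum.cong refl) (simp add: \<phi>_def inner_diff_left)
    then show ?thesis using sum_Suc_diff'[OF that, of "\<lambda>j. f j \<bullet> x"] by simp
  qed
  have \<phi>\<psi>: "\<phi> j \<bullet> edir (\<psi> j) = sin (\<delta> / 2)" for j
  proof -
    have "\<theta> (Suc j) - \<psi> j = \<delta> / 2 - pi / 2" "\<theta> j - \<psi> j = - (\<delta> / 2) - pi / 2"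
      by (simp_all add: \<theta>Suc \<psi>_def)
    then have "\<phi> j \<bullet> edir (\<psi> j) = (cos (\<delta> / 2 - pi / 2) - cos (- (\<delta> / 2) - pi / 2)) / 2"
      by (simp add: \<phi>_def f_def inner_diff_left edir_inner)
    then show ?thesis by (simp add: cos_diff)
  qed
  have "(\<Sum>j<n. \<phi> j \<bullet> edir (\<omega> j)) = (\<Sum>j\<in>{0..<2*m}. \<phi> j \<bullet> edir (\<omega> j)) + (\<Sum>j\<in>{2*m..<n}. \<phi> j \<bullet> edir (\<omega> j))"
    by (subst sum.atLeastLessThan_concat) (auto simp: n_def lessThan_atLeast0)
  also have "(\<Sum>j\<in>{0..<2*m}. \<phi> j \<bullet> edir (\<omega> j)) = (\<Sum>j\<in>{0..<2*m}. sin (\<delta> / 2))"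
    by (intro sum.cong) (auto simp: \<omega>_def \<phi>\<psi>)
  also have "(\<Sum>j\<in>{2*m..<n}. \<phi> j \<bullet> edir (\<omega> j)) = (\<Sum>j\<in>{2*m..<n}. \<phi> j \<bullet> edir (\<tau> + pi / 3))"
    by (intro sum.cong) (auto simp: \<omega>_def)
  also have "\<dots> = (f n \<bullet> edir (\<tau> + pi / 3) - f (2 * m) \<bullet> edir (\<tau> + pi / 3)) / 2"
    by (rule tele) (simp add: n_def)
  also have "\<dots> = sqrt 3 / 4"
  proof -
    have "\<theta> n - (\<tau> + pi / 3) = - (pi / 6)" "\<theta> (2 * m) - (\<tau> + pi / 3) = - (pi / 2)"
      unfolding \<theta>m by simp_all
    then show ?thesis by (simp add: f_def edir_inner cos_30)
  qed
  finally have s1: "(\<Sum>j<n. \<phi> j \<bullet> edir (\<omega> j)) = 2 * m * sin (\<delta> / 2) + sqrt 3 / 4" by simp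
  have s2: "(\<Sum>j<n. \<phi> j \<bullet> ?u) = sqrt 3 / 2"
  proof -
    have "(\<Sum>j<n. \<phi> j \<bullet> ?u) = (f n \<bullet> ?u - f 0 \<bullet> ?u) / 2"
      using tele[of 0 n ?u] by (simp add: lessThan_atLeast0)
    also have "\<dots> = f n \<bullet> ?u" using \<open>f n = - f 0\<close> by simp
    also have "\<dots> = sqrt 3 / 2" by (simp add: f_def \<theta>m edir_inner cos_30)
    finally show ?thesis .
  qed
  \<comment> \<open>The contribution of the vertex and that of the shift by u/2 both amount to
    \<open>sqrt 3 / 2\<close> and cancel, leaving only the arc.\<close>
  have "(\<Sum>j<n. 2 * (\<phi> j \<bullet> (edir (\<omega> j) - ?u /\<^sub>R 2))) = 2 * (\<Sum>j<n. \<phi> j \<bullet> edir (\<omega> j)) - (\<Sum>j<n. \<phi> j \<bullet> ?u)"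
    by (simp add: inner_diff_right right_diff_distrib sum_subtractf sum_distrib_left)
  also have "\<dots> = 4 * m * sin (\<delta> / 2)"
    unfolding s1 s2 by simp
  finally have "4 * m * sin (\<delta> / 2) = (\<Sum>j<n. 2 * (\<phi> j \<bullet> (edir (\<omega> j) - ?u /\<^sub>R 2)))" by simp
  also have "\<dots> \<le> (\<Sum>j<n. width ?K (\<phi> j))"
    by (intro sum_mono width)
  finally have "8 * m * sin (\<delta> / 2) \<le> zperim n \<phi> ?K"
    by (simp add: zperim_def)
  moreover have "\<delta> / 2 = pi / (6 * real m)"
    by (simp add: \<delta>_def n_def)
  ultimately show ?thesis using ge by simp
qed

text \<open>The number 4\<pi>/3 is the limit of 8m sin(\<pi>/(6m)), the total length of the two arcs
  of the lens.\<close>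

lemma disk_lens_perimeter:
  assumes "norm u = 1"
  shows "4 * pi / 3 \<le> per (cball 0 1) (lens (cball 0 1) u)"
proof -
  obtain r t where rt: "u = r *\<^sub>R edir t"
    using polar_half[of 0 u] by metis
  then have "\<bar>r\<bar> = 1" using assms by simp
  then have lens: "lens (cball 0 1) u = lens (cball 0 1) (edir t)"
    by (cases "r = 1") (auto simp: rt lens_minus abs_if split: if_splits)
  have "(\<lambda>m. 8 * real (Suc m) * sin (pi / (6 * real (Suc m)))) \<longlonglongrightarrow> 4 * pi / 3"
    by real_asymp
  then show ?thesis
    unfolding lens by (rule LIMSEQ_le_const2) (use disk_lens_zperim in blast)
qed

lemma L_values_linear_image:
  assumes M: "M \<in> M2" and f: "linear f" "bij f"
  shows "L_values (f ` M) = L_values M"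
proof -
  have per: "per (f ` M) (lens (f ` M) (f u)) = per M (lens M u)" if "mnorm M u = 1" for u
    using that per_linear_image[OF M lens_convex_body[OF M] f, of u] by (simp add: lens_linear_image[OF f])
  have "{u. mnorm (f ` M) u = 1} = f ` {u. mnorm M u = 1}"
  proof (intro set_eqI iffI)
    fix u assume "u \<in> {u. mnorm (f ` M) u = 1}"
    moreover obtain y where "u = f y" using bij_is_surj[OF f(2)] by (metis surjD)
    ultimately show "u \<in> f ` {u. mnorm M u = 1}" by (simp add: mnorm_linear_image[OF f])
  qed (auto simp: mnorm_linear_image[OF f])
  then show ?thesis
    unfolding L_values_eq[OF M] L_values_eq[OF M2_linear_image[OF M f]]
    by (simp add: image_image per cong: image_cong_simp)
qed

section \<open>Compactness of the family of unit balls\<close>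

text \<open>Mapping a pair of maximal determinant to the standard basis puts the unit ball between
  the square with vertices on the axes at distance 1 and the square with sides of length 2. The
  constants 1/2 and 2 come from comparing with the sum of the coordinates.\<close>

lemma normalized_position:
  assumes M: "M \<in> M2"
  obtains M' where "M' \<in> M2" "L_values M' = L_values M"
    "\<And>x. norm x / 2 \<le> mnorm M' x" "\<And>x. mnorm M' x \<le> 2 * norm x"
proof -
  obtain a b where ab: "a \<in> M" "b \<in> M" "det2 a b > 0"
    "\<And>x. x \<in> M \<Longrightarrow> \<bar>det2 x b\<bar> \<le> det2 a b" "\<And>x. x \<in> M \<Longrightarrow> \<bar>det2 a x\<bar> \<le> det2 a b"
    by (rule auerbach_basis[OF M]) (rule that; assumption)
  define f :: "real^2 \<Rightarrow> real^2" where "f x = vector [det2 x b / det2 a b, det2 a x / det2 a b]" for x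
  have fn: "f x $ 1 = det2 x b / det2 a b" "f x $ 2 = det2 a x / det2 a b" for x
    by (simp_all add: f_def)
  have lin: "linear f"
  proof (rule linearI)
    show "f (x + y) = f x + f y" for x y
      by (simp add: vec2_eq_iff fn det2_def flip: add_divide_distrib) (simp add: algebra_simps)
    show "f (c *\<^sub>R x) = c *\<^sub>R f x" for c x
      by (simp add: vec2_eq_iff fn det2_def algebra_simps diff_divide_distrib)
  qed
  have "inj f"
  proof (rule injI)
    fix x y assume "f x = f y"
    then have "det2 x b / det2 a b = det2 y b / det2 a b" "det2 a x / det2 a b = det2 a y / det2 a b"
      by (metis fn)+
    then show "x = y"
      using det2_expand[of a b x] det2_expand[of a b y] ab(3) by simp
  qed
  then have f: "linear f" "bij f"
    using lin linear_inj_imp_surj[OF lin] by (auto simp: bij_def)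
  have M': "f ` M \<in> M2" by (rule M2_linear_image[OF M f])
  have "f a = edir 0" "f b = edir (pi / 2)"
    using ab(3) by (simp_all add: vec2_eq_iff fn) (simp_all add: det2_def)
  then have e: "mnorm (f ` M) (edir 0) \<le> 1" "mnorm (f ` M) (edir (pi/2)) \<le> 1"
    using ab(1,2) by (metis mnorm_le_1_iff[OF M'] imageI)+
  have comp: "\<bar>x $ 1\<bar> \<le> norm x" "\<bar>x $ 2\<bar> \<le> norm x" for x :: "real^2"
    by (rule component_le_norm_cart)+
  show thesis
  proof (rule that[OF M' L_values_linear_image[OF M f]])
    have bd: "norm y \<le> 2" if y: "y \<in> f ` M" for y
    proof -
      obtain x where x: "x \<in> M" "y = f x" using y by blast
      have "\<bar>y $ 1\<bar> \<le> 1" "\<bar>y $ 2\<bar> \<le> 1"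
        using ab(3) ab(4,5)[OF x(1)] by (simp_all add: x(2) fn divide_le_eq)
      then show ?thesis
        using norm_le_l1_cart[of y] by (simp add: sum_2)
    qed
    show "norm x / 2 \<le> mnorm (f ` M) x" for x
    proof (cases "x = 0")
      case False
      have p: "mnorm (f ` M) x > 0" by (rule mnorm_pos[OF M' False])
      have "x /\<^sub>R mnorm (f ` M) x \<in> f ` M"
        using mnorm_le_iff[OF M' p, of x] by simp
      from bd[OF this] show ?thesis using p by (simp add: field_simps)
    qed (simp add: mnorm_zero[OF M'])
    show "mnorm (f ` M) x \<le> 2 * norm x" for x
    proof -
      have "x = x $ 1 *\<^sub>R edir 0 + x $ 2 *\<^sub>R edir (pi / 2)" by (simp add: vec2_eq_iff)
      then have "mnorm (f ` M) x \<le> mnorm (f ` M) (x $ 1 *\<^sub>R edir 0) + mnorm (f ` M) (x $ 2 *\<^sub>R edir (pi/2))"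
        using mnorm_triangle[OF M'] by metis
      also have "\<dots> = \<bar>x $ 1\<bar> * mnorm (f ` M) (edir 0) + \<bar>x $ 2\<bar> * mnorm (f ` M) (edir (pi/2))"
        by (simp add: mnorm_scale[OF M'])
      also have "\<dots> \<le> norm x * 1 + norm x * 1"
        using e comp by (intro add_mono mult_mono) (auto simp: mnorm_nonneg[OF M'])
      finally show ?thesis by simp
    qed
  qed
qed

text \<open>The new unit vector is \<open>u\<close> rescaled, which moves it by at most
  \<open>e\<close>. The lens then grows at most by 1 + 2e + e, and measuring it in the other norm
  costs the factor 1 + e.\<close>

lemma lens_stability:
  assumes M: "M \<in> M2" and M': "M' \<in> M2" and e: "e \<ge> 0"
    and le: "\<And>x. mnorm M x \<le> (1 + e) * mnorm M' x" and le': "\<And>x. mnorm M' x \<le> (1 + e) * mnorm M x"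
    and u: "mnorm M u = 1"
  obtains u' where "mnorm M' u' = 1" "per M' (lens M' u') \<le> (1 + e) * (1 + 3 * e) * per M (lens M u)"
proof -
  define t where "t = mnorm M' u"
  define u' where "u' = u /\<^sub>R t"
  have "u \<noteq> 0" using u mnorm_zero[OF M] by auto
  then have t0: "t > 0" and u': "mnorm M' u' = 1"
    using mnorm_pos[OF M'] mnorm_normalize[OF M'] by (auto simp: t_def u'_def)
  have t: "t \<le> 1 + e" "1 \<le> (1 + e) * t"
    using le'[of u] le[of u] u by (simp_all add: t_def)
  have "\<bar>1 - 1 / t\<bar> \<le> e"
  proof -
    have "1 / t \<le> 1 + e" using t(2) t0 by (simp add: field_simps)
    moreover have "1 - e \<le> 1 / t"
    proof -
      have "(1 - e) * (1 + e) \<le> 1" by (simp add: algebra_simps)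
      then have "(1 - e) * t \<le> 1"
      proof (cases "e \<le> 1")
        case True
        then have "(1 - e) * t \<le> (1 - e) * (1 + e)" using t(1) by (intro mult_left_mono) auto
        with \<open>(1 - e) * (1 + e) \<le> 1\<close> show ?thesis by simp
      next
        case False
        then have "(1 - e) * t \<le> 0" using t0 by (simp add: mult_nonpos_nonneg)
        then show ?thesis by simp
      qed
      then show ?thesis using t0 by (simp add: field_simps)
    qed
    ultimately show ?thesis by (simp add: abs_le_iff)
  qed
  moreover have "u - u' = (1 - 1 / t) *\<^sub>R u"
    by (simp add: u'_def algebra_simps inverse_eq_divide)
  ultimately have d: "mnorm M (u - u') \<le> e"
    using u by (simp add: mnorm_scale[OF M])
  have sub: "mnorm M x \<le> 1 + e" if "x \<in> M'" for x
  proof -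
    have "mnorm M' x \<le> 1" using that mnorm_le_1_iff[OF M'] by simp
    then have "(1 + e) * mnorm M' x \<le> (1 + e) * 1" using e by (intro mult_left_mono) auto
    with le[of x] show ?thesis by simp
  qed
  have K: "convex_body (lens M' u')" "convex_body (lens M u)"
    using u u' by (auto intro: lens_convex_body M M')
  have "per M (lens M' u') \<le> (1 + 2 * e + e) * per M (lens M u)"
    using e u by (intro per_mono_scale[OF M K] lens_compare[OF M e sub _ d]) auto
  moreover have "1 + 2 * e + e = 1 + 3 * e" by simp
  ultimately have "per M (lens M' u') \<le> (1 + 3 * e) * per M (lens M u)" by (simp only:)
  then have "(1 + e) * per M (lens M' u') \<le> (1 + e) * ((1 + 3 * e) * per M (lens M u))"
    using e by (intro mult_left_mono) auto
  moreover have "per M' (lens M' u') \<le> (1 + e) * per M (lens M' u')"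
    using e le' by (intro per_mono_unit_ball[OF M M' K(1)]) auto
  ultimately have "per M' (lens M' u') \<le> (1 + e) * (1 + 3 * e) * per M (lens M u)"
    by (simp add: mult.assoc)
  with u' show thesis by (rule that)
qed

text \<open>All norms are 2-Lipschitz, and all unit balls lie in the disk of radius 2, so uniform
  convergence there controls the norms everywhere by homogeneity.\<close>

lemma unit_balls_compact:
  assumes M: "\<And>k. M k \<in> M2" and lo: "\<And>k x. norm x / 2 \<le> mnorm (M k) x" and up: "\<And>k x. mnorm (M k) x \<le> 2 * norm x"
  obtains M' and r :: "nat \<Rightarrow> nat" where "M' \<in> M2" "strict_mono r"
    "\<And>e. e > 0 \<Longrightarrow> \<forall>\<^sub>F k in sequentially. (\<forall>x. mnorm M' x \<le> (1 + e) * mnorm (M (r k)) x) \<and>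
      (\<forall>x. mnorm (M (r k)) x \<le> (1 + e) * mnorm M' x)"
proof -
  let ?S = "cball (0 :: real^2) 2"
  have lip: "\<bar>mnorm (M k) x - mnorm (M k) y\<bar> \<le> 2 * norm (x - y)" for k x y
    using mnorm_diff_ge[OF M, of k x y] mnorm_diff_ge[OF M, of k y x] up[of k "x - y"] up[of k "y - x"]
    by (simp add: abs_le_iff norm_minus_commute)
  obtain g and r :: "nat \<Rightarrow> nat" where g: "continuous_on ?S g" "strict_mono r"
    and unif: "\<And>e. 0 < e \<Longrightarrow> \<exists>N. \<forall>n x. n \<ge> N \<and> x \<in> ?S \<longrightarrow> norm (mnorm (M (r n)) x - g x) < e"
  proof (rule Arzela_Ascoli[of ?S "\<lambda>k. mnorm (M k)" 4])
    show "norm (mnorm (M k) x) \<le> 4" if "x \<in> ?S" for k x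
    proof -
      have "norm x \<le> 2" using that by simp
      then have "2 * norm x \<le> 4" by simp
      with up[of k x] mnorm_nonneg[OF M, of k x] show ?thesis by simp
    qed
    show "\<exists>d>0. \<forall>n y. y \<in> ?S \<and> norm (x - y) < d \<longrightarrow> norm (mnorm (M n) x - mnorm (M n) y) < e" if "0 < e" for x e
    proof (intro exI[of _ "e / 2"] conjI allI impI)
      show "norm (mnorm (M n) x - mnorm (M n) y) < e" if "y \<in> ?S \<and> norm (x - y) < e / 2" for n y
        using lip[of n x y] that unfolding real_norm_def by linarith
    qed (use that in simp)
  qed (auto intro: that)
  have lim: "(\<lambda>n. mnorm (M (r n)) x) \<longlonglongrightarrow> g x" if "x \<in> ?S" for x
  proof (rule LIMSEQ_I)
    fix e :: real assume "0 < e"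
    from unif[OF this] that show "\<exists>N. \<forall>n\<ge>N. norm (mnorm (M (r n)) x - g x) < e"
      by blast
  qed
  \<comment> \<open>The limit \<open>g\<close> is known only on the disk, so the limit norm is
    recovered from its unit ball rather than taken to be \<open>g\<close>.\<close>
  define M' where "M' = {x \<in> ?S. g x \<le> 1}"
  have small: "norm x \<le> 2" if "mnorm (M k) x \<le> 1" for k x
    using lo[of x k] that by simp
  have "closed M'"
    using continuous_closed_preimage[OF g(1) closed_cball closed_atMost[of 1]]
    by (simp add: M'_def vimage_def Int_def)
  moreover have "bounded M'"
    by (rule bounded_subset[OF bounded_cball[of 0 2]]) (auto simp: M'_def)
  ultimately have "compact M'" by (simp add: compact_eq_bounded_closed)
  moreover have "convex M'"
  proof (rule convexI)
    fix x y u v assume xy: "x \<in> M'" "y \<in> M'" and uv: "0 \<le> (u::real)" "0 \<le> v" "u + v = 1"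
    let ?z = "u *\<^sub>R x + v *\<^sub>R y"
    have S: "x \<in> ?S" "y \<in> ?S" using xy by (auto simp: M'_def)
    have z: "?z \<in> ?S" by (rule convexD[OF convex_cball S uv])
    have le: "mnorm (M k) ?z \<le> u * mnorm (M k) x + v * mnorm (M k) y" for k
      using mnorm_triangle[OF M, of k "u *\<^sub>R x" "v *\<^sub>R y"] uv by (simp add: mnorm_scale[OF M])
    have "(\<lambda>n. u * mnorm (M (r n)) x + v * mnorm (M (r n)) y) \<longlonglongrightarrow> u * g x + v * g y"
      by (intro tendsto_intros lim S)
    with lim[OF z] have "g ?z \<le> u * g x + v * g y"
      by (rule LIMSEQ_le) (use le in blast)
    also have "\<dots> \<le> u * 1 + v * 1"
      using xy uv by (intro add_mono mult_left_mono) (auto simp: M'_def)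
    finally show "?z \<in> M'" using z uv by (simp add: M'_def)
  qed
  moreover have "ball 0 (1/2) \<subseteq> M'"
  proof
    fix x :: "real^2" assume "x \<in> ball 0 (1/2)"
    then have x: "norm x < 1/2" by simp
    then have "x \<in> ?S" by simp
    moreover have "mnorm (M (r n)) x \<le> 1" for n
      using up[of "r n" x] x by simp
    then have "g x \<le> 1"
      by (intro LIMSEQ_le_const2[OF lim[OF \<open>x \<in> ?S\<close>]]) blast
    ultimately show "x \<in> M'" by (simp add: M'_def)
  qed
  then have "interior M' \<noteq> {}"
    using interior_maximal[OF _ open_ball, of 0 "1/2" M'] by auto
  moreover have "- x \<in> M'" if "x \<in> M'" for x
  proof -
    have S: "x \<in> ?S" "- x \<in> ?S" using that by (auto simp: M'_def)
    have "g (- x) = g x"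
      using lim[OF S(2)] lim[OF S(1)] by (simp add: mnorm_minus[OF M] LIMSEQ_unique)
    then show ?thesis using that by (simp add: M'_def)
  qed
  then have "uminus ` M' = M'" by (rule uminus_image_eq)
  ultimately have M': "M' \<in> M2" by (simp add: M2_def)
  show thesis
  proof (rule that[OF M' g(2)])
    fix e :: real assume e: "e > 0"
    obtain N where N: "\<And>n x. n \<ge> N \<Longrightarrow> x \<in> ?S \<Longrightarrow> norm (mnorm (M (r n)) x - g x) < e"
      using unif[OF e] by blast
    \<comment> \<open>A bound on the unit ball of \<open>A\<close> extends to all vectors by
      scaling, which turns an additive error into the factor 1 + e.\<close>
    have hom: "mnorm B x \<le> (1 + e) * mnorm A x"
      if A: "A \<in> M2" and B: "B \<in> M2" and AB: "\<And>x. mnorm A x \<le> 1 \<Longrightarrow> mnorm B x \<le> 1 + e" for A B x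
    proof (cases "x = 0")
      case False
      have "mnorm B (x /\<^sub>R mnorm A x) \<le> 1 + e"
        by (rule AB) (simp add: mnorm_normalize[OF A False])
      then show ?thesis
        using mnorm_pos[OF A False] by (simp add: mnorm_scale[OF B] field_simps)
    qed (simp add: mnorm_zero[OF A] mnorm_zero[OF B])
    show "\<forall>\<^sub>F k in sequentially. (\<forall>x. mnorm M' x \<le> (1 + e) * mnorm (M (r k)) x) \<and>
      (\<forall>x. mnorm (M (r k)) x \<le> (1 + e) * mnorm M' x)"
      using eventually_ge_at_top[of N]
    proof eventually_elim
      case (elim k)
      have 1: "mnorm (M (r k)) x \<le> 1 + e" if "mnorm M' x \<le> 1" for x
      proof -
        have "x \<in> M'" using that mnorm_le_1_iff[OF M'] by simp
        then have "x \<in> ?S" "g x \<le> 1" by (auto simp: M'_def)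
        with N[OF elim \<open>x \<in> ?S\<close>] show ?thesis by (simp add: abs_less_iff)
      qed
      have 2: "mnorm M' x \<le> 1 + e" if x: "mnorm (M (r k)) x \<le> 1" for x
      proof -
        have nx: "norm x \<le> 2" by (rule small[OF x])
        then have S: "x \<in> ?S" by simp
        have gx: "g x \<le> 1 + e" using N[OF elim S] x by (simp add: abs_less_iff)
        \<comment> \<open>Shrinking by 1 + e brings a point of the approximating ball into the limit
          ball, as \<open>g\<close> inherits homogeneity on the disk.\<close>
        define y where "y = x /\<^sub>R (1 + e)"
        have "norm x \<le> 2 * (1 + e)" using nx e by (simp add: algebra_simps)
        then have y: "y \<in> ?S" using e by (simp add: y_def field_simps)
        have "(\<lambda>n. mnorm (M (r n)) x / (1 + e)) \<longlonglongrightarrow> g x / (1 + e)"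
          using e by (intro tendsto_intros lim S) auto
        moreover have "mnorm (M (r n)) y = mnorm (M (r n)) x / (1 + e)" for n
          using e by (simp add: y_def mnorm_scale[OF M] field_simps)
        ultimately have "g y = g x / (1 + e)"
          using lim[OF y] by (simp add: LIMSEQ_unique)
        then have "y \<in> M'" using gx e y by (simp add: M'_def)
        then show ?thesis
          using mnorm_le_iff[OF M', of "1 + e" x] e by (simp add: y_def)
      qed
      show ?case using hom[OF M M' 2] hom[OF M' M 1] by blast
    qed
  qed
qed

text \<open>A limit of normalized balls whose minima tend to the supremum \<open>s\<close>. Every
  lens of the limit ball is compared with a lens of an approximating ball, whose perimeter is nearly
  bounded below by 2s; hence no lens of the limit ball falls below this bound.\<close>

lemma MaxMin_attained: "\<exists>m. is_MaxMin m"
proof -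
  define R where "R = {r. \<exists>M\<in>M2. is_min (L_values M) (ereal r)}"
  have ne: "R \<noteq> {}"
  proof -
    obtain m where m: "is_min (L_values (cball 0 1)) m"
      using L_values_min_exists[OF M2_cball] by blast
    then obtain u where "m = ereal (per (cball 0 1) (lens (cball 0 1) u) / 2)"
      using is_min_L_values_iff[OF M2_cball] by blast
    with m M2_cball show ?thesis
      unfolding R_def by blast
  qed
  have bdd: "bdd_above R"
  proof (rule bdd_aboveI[of _ 3])
    fix r assume "r \<in> R"
    then obtain M where M: "M \<in> M2" "is_min (L_values M) (ereal r)" by (auto simp: R_def)
    then have "ereal r \<in> L_values M" by (simp add: is_min_def)
    then obtain u where "mnorm M u = 1" "r = per M (lens M u) / 2"
      unfolding L_values_eq[OF M(1)] by auto
    then show "r \<le> 3" using per_lens_le_6[OF M(1), of u] by simp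
  qed
  define s where "s = Sup R"
  have "\<exists>M. M \<in> M2 \<and> (\<forall>x. norm x / 2 \<le> mnorm M x) \<and> (\<forall>x. mnorm M x \<le> 2 * norm x) \<and>
      (\<forall>u. mnorm M u = 1 \<longrightarrow> s - 1 / real (Suc k) \<le> per M (lens M u) / 2)" for k
  proof -
    obtain r where r: "r \<in> R" "s - 1 / real (Suc k) < r"
      using less_cSup_iff[OF ne bdd, of "s - 1 / real (Suc k)"] by (auto simp: s_def)
    then obtain A where A: "A \<in> M2" "is_min (L_values A) (ereal r)" by (auto simp: R_def)
    obtain M where M: "M \<in> M2" "L_values M = L_values A"
      "\<And>x. norm x / 2 \<le> mnorm M x" "\<And>x. mnorm M x \<le> 2 * norm x"
      by (rule normalized_position[OF A(1)]) (rule that; assumption)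
    have "s - 1 / real (Suc k) \<le> per M (lens M u) / 2" if "mnorm M u = 1" for u
    proof -
      have "ereal (per M (lens M u) / 2) \<in> L_values M"
        unfolding L_values_eq[OF M(1)] using that by blast
      then have "ereal r \<le> ereal (per M (lens M u) / 2)"
        using A(2) unfolding M(2) is_min_def by blast
      with r(2) show ?thesis by simp
    qed
    with M show ?thesis by blast
  qed
  then obtain M where M: "\<And>k. M k \<in> M2" "\<And>k x. norm x / 2 \<le> mnorm (M k) x" "\<And>k x. mnorm (M k) x \<le> 2 * norm x"
    and Ms: "\<And>k u. mnorm (M k) u = 1 \<Longrightarrow> s - 1 / real (Suc k) \<le> per (M k) (lens (M k) u) / 2"
    by metis
  obtain A and r :: "nat \<Rightarrow> nat" where A: "A \<in> M2" "strict_mono r"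
    and close: "\<And>e. e > 0 \<Longrightarrow> \<forall>\<^sub>F k in sequentially. (\<forall>x. mnorm A x \<le> (1 + e) * mnorm (M (r k)) x) \<and>
      (\<forall>x. mnorm (M (r k)) x \<le> (1 + e) * mnorm A x)"
    by (rule unit_balls_compact[OF M]) (rule that; assumption)
  have ge: "s \<le> per A (lens A u) / 2" if u: "mnorm A u = 1" for u
  proof -
    have le: "s - e \<le> (1 + e) * (1 + 3 * e) * per A (lens A u) / 2" if e: "e > 0" for e
    proof -
      have "\<forall>\<^sub>F k in sequentially. 1 / real (Suc k) < e"
        using order_tendstoD(2)[OF LIMSEQ_inverse_real_of_nat e] by (simp add: inverse_eq_divide)
      then have "\<forall>\<^sub>F k in sequentially. 1 / real (Suc k) < e \<and> (\<forall>x. mnorm A x \<le> (1 + e) * mnorm (M (r k)) x) \<and>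
          (\<forall>x. mnorm (M (r k)) x \<le> (1 + e) * mnorm A x)"
        using close[OF e] by (rule eventually_conj)
      from eventually_happens'[OF sequentially_bot this] obtain k where k: "1 / real (Suc k) < e"
        "\<And>x. mnorm A x \<le> (1 + e) * mnorm (M (r k)) x" "\<And>x. mnorm (M (r k)) x \<le> (1 + e) * mnorm A x"
        by blast
      obtain u' where u': "mnorm (M (r k)) u' = 1"
        "per (M (r k)) (lens (M (r k)) u') \<le> (1 + e) * (1 + 3 * e) * per A (lens A u)"
        by (rule lens_stability[OF A(1) M(1) _ k(2,3) u]) (use e in auto)
      \<comment> \<open>The index of a subsequence never lags behind \<open>k\<close>, so the error
        bound for index \<open>k\<close> also covers index \<open>r k\<close>.\<close>
      have "real (Suc k) \<le> real (Suc (r k))"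
        using seq_suble[OF A(2), of k] by simp
      then have "1 / real (Suc (r k)) \<le> 1 / real (Suc k)"
        by (intro divide_left_mono) auto
      then show ?thesis using Ms[OF u'(1)] u'(2) k(1) by linarith
    qed
    have e0: "(\<lambda>k. 1 / real (Suc k)) \<longlonglongrightarrow> 0"
      using LIMSEQ_inverse_real_of_nat by (simp add: inverse_eq_divide)
    have lim: "(\<lambda>k. (1 + 1 / real (Suc k)) * (1 + 3 * (1 / real (Suc k))) * per A (lens A u) / 2 + 1 / real (Suc k))
        \<longlonglongrightarrow> (1 + 0) * (1 + 3 * 0) * per A (lens A u) / 2 + 0"
      by (intro tendsto_intros e0) auto
    have "s \<le> (1 + 1 / real (Suc k)) * (1 + 3 * (1 / real (Suc k))) * per A (lens A u) / 2 + 1 / real (Suc k)" for k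
    proof -
      have "1 / real (Suc k) > 0" by simp
      from le[OF this] show ?thesis by linarith
    qed
    then have "s \<le> (1 + 0) * (1 + 3 * 0) * per A (lens A u) / 2 + 0"
      by (intro LIMSEQ_le_const[OF lim]) blast
    then show ?thesis by simp
  qed
  obtain m where m: "is_min (L_values A) m" using L_values_min_exists[OF A(1)] by blast
  then obtain u where u: "mnorm A u = 1" "m = ereal (per A (lens A u) / 2)"
    using is_min_L_values_iff[OF A(1)] by blast
  have "m' \<le> m" if B: "B \<in> M2" "is_min (L_values B) m'" for B m'
  proof -
    obtain w where w: "m' = ereal (per B (lens B w) / 2)"
      using B(2) is_min_L_values_iff[OF B(1)] by blast
    then have "per B (lens B w) / 2 \<in> R" using B by (auto simp: R_def)
    then have "per B (lens B w) / 2 \<le> s" unfolding s_def by (rule cSup_upper[OF _ bdd])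
    with ge[OF u(1)] show ?thesis by (simp add: w u(2))
  qed
  with m A(1) have "is_MaxMin m"
    unfolding is_MaxMin_def is_max_def[of _ m] by blast
  then show ?thesis by blast
qed

section \<open>The four extremal quantities\<close>

lemma L_values_ge_2:
  assumes "M \<in> M2" "x \<in> L_values M"
  shows "2 \<le> x"
  using assms per_lens_ge_4[OF assms(1)] unfolding L_values_eq[OF assms(1)] by fastforce

lemma L_values_le_3:
  assumes "M \<in> M2" "x \<in> L_values M"
  shows "x \<le> 3"
  using assms per_lens_le_6[OF assms(1)] unfolding L_values_eq[OF assms(1)] by fastforce

theorem theorem2:
  shows
    "(\<forall>M\<in>M2. (\<exists>m. is_min (L_values M) m) \<and> (\<exists>m. is_max (L_values M) m)) \<and>
     (is_MinMin 2 \<and>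
       (\<forall>M\<in>M2. parallelogram M \<or> affinely_regular_hexagon M \<longrightarrow> is_min (L_values M) 2)) \<and>
     (is_MinMax 2 \<and>
       (\<forall>M\<in>M2. affinely_regular_hexagon M \<longrightarrow> is_max (L_values M) 2)) \<and>
     (\<exists>m. is_MaxMin m \<and> ereal (2 * pi / 3) \<le> m \<and> m \<le> ereal (8 / 3)) \<and>
     (is_MaxMax 3 \<and>
       (\<forall>M\<in>M2. parallelogram M \<longrightarrow> is_max (L_values M) 3))"
proof -
  note hexagon = hexagon_ball_extremes[OF M2_hexagon_exists refl]
    and square = parallelogram_ball_extremes[OF M2_parallelogram_exists refl]
  have MinMin: "is_MinMin 2"
    unfolding is_MinMin_def is_min_def[of _ 2]
    using hexagon(1) M2_hexagon_exists L_values_ge_2 by (auto simp: is_min_def)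
  have MinMax: "is_MinMax 2"
    unfolding is_MinMax_def is_min_def[of _ 2]
    using hexagon(2) M2_hexagon_exists L_values_ge_2 by (auto simp: is_max_def)
  have MaxMax: "is_MaxMax 3"
    unfolding is_MaxMax_def is_max_def[of _ 3]
    using square(2) M2_parallelogram_exists L_values_le_3 by (auto simp: is_max_def)
  obtain m where m: "is_MaxMin m"
    using MaxMin_attained by blast
  obtain d where d: "is_min (L_values (cball 0 1)) d"
    using L_values_min_exists[OF M2_cball] by blast
  \<comment> \<open>Every lens of the Euclidean disk satisfies the bound, so its minimum is a
    competitor for MaxMin.\<close>
  have "ereal (2 * pi / 3) \<le> d"
    using d disk_lens_perimeter by (force simp: is_min_L_values_iff[OF M2_cball] mnorm_cball)
  also have "d \<le> m"
    using m d M2_cball by (auto simp: is_MaxMin_def is_max_def)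
  finally have lower: "ereal (2 * pi / 3) \<le> m" .
  obtain M where M: "M \<in> M2" "is_min (L_values M) m"
    using m by (auto simp: is_MaxMin_def is_max_def)
  obtain u where "mnorm M u = 1" "per M (lens M u) \<le> 16 / 3"
    using short_lens_exists[OF M(1)] by blast
  then have "m \<le> ereal (per M (lens M u) / 2)" "ereal (per M (lens M u) / 2) \<le> ereal (8 / 3)"
    using M unfolding is_min_def L_values_eq[OF M(1)] by (blast, simp)
  then have "m \<le> ereal (8 / 3)"
    by (rule order_trans)
  with m lower MinMin MinMax MaxMax show ?thesis
    using L_values_min_exists L_values_max_exists parallelogram_extremes affinely_regular_hexagon_extremes
    by blast
qed

end
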